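(* Let $T_V$ be a $p$-dimensional irreducible representation of $U_q(\mathfrak g)$ with highest weight $-\mu$, let $(a_{ij})_{n\times n}$ be the Cartan matrix of $\mathfrak g$, and let $\nu$ be the weight of the central element $c^{-1}$. Then the resulting quantum group $U\bigl(V^{\vee}(R',R_{21}^{-1}),\widetilde{U_q^{\mathrm{ext}}(\mathfrak g)},V(R',R)\bigr)$ has rank one higher, and its Cartan matrix is obtained from $(a_{ij})_{n\times n}$ by adding a row and a column with $$a_{i,n+1}=\frac{2(\alpha_i,\mu)}{(\alpha_i,\alpha_i)},\qquad a_{n+1,i}=\frac{2(\mu,\alpha_i)}{(\mu,\mu)+(\nu,\nu)},$$ and $\nu$ is orthogonal to $\mu$ and to $\alpha_i$ for $i=1,\dots,n$.
   Context: The base field is $k=\mathbb{C}$; $q$ is generic (not a root of unity), with the needed fractional powers fixed. $\mathfrak g$ is a finite-dimensional complex simple Lie algebra with simple roots $\alpha_1,\dots,\alpha_n$ in a Euclidean space $E$ (a suitable subspace of some $\mathbb R^N$, which also contains $\nu$), Cartan matrix $a_{ij}=\frac{2(\alpha_i,\alpha_j)}{(\alpha_i,\alpha_i)}$, $d_i=(\alpha_i,\alpha_i)/2$, $q_i=q^{d_i}$. $U_q(\mathfrak g)$ is generated by $E_i,F_i,K_i^{\pm1}$ with $E_iK_j=q_i^{a_{ij}}K_jE_i$, $F_iK_j=q_i^{-a_{ij}}K_jF_i$, $[E_i,F_j]=\delta_{ij}\frac{K_i-K_i^{-1}}{q_i-q_i^{-1}}$ and the $q$-Serre relations; $U_q^{\mathrm{ext}}(\mathfrak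 g)$ is its extension by suitable fractional powers $K_i^{1/m}$, so that $K_\beta$ makes sense for weights $\beta$ ($K_{\alpha_i}=K_i$). The construction (the proposition summarizes the inductive constructions of the $U_q(\mathfrak g)$ by this method). Choose a weight basis of $V$, indexed $1,\dots,p$, such that the $E_i$ raise and the $F_i$ lower the index (so $p$ is the index of the highest weight vector). Let $R_{VV}=B_{VV}\circ(T_V\otimes T_V)(\mathfrak R)$, with $\mathfrak R=\sum_{r_1,\dots,r_N\ge0}\prod_j\frac{(1-q_{\beta_j}^{-2})^{r_j}}{[r_j]_{q_{\beta_j}}!}q_{\beta_j}^{r_j(r_j+1)/2}E_{\beta_j}^{r_j}\otimes F_{\beta_j}^{r_j}$ (product over ordered positive roots) and $B_{VV}(v\otimes w)=q^{(\kappa,\kappa')}v\otimes w$ for $v,w$ of weights $\kappa,\kappa'$. Let $P$ be the permutation matrix. $R_{VV}=\lambda R$, where $R$ is the normalization of $R_{VV}$ for which a chosen eigenvalue of $PR$ is $-1$, $\lambda$ is the normalization constant, and $R'$ is a matrix with (i) $R_{12}R_{13}R'_{23}=R'_{23}R_{13}R_{12}$, $R_{23}R_{13}R'_{12}=R'_{12}R_{13}R_{23}$; (ii) $(PR+1)(PR'-1)=0$; (iii) $R_{21}R'_{12}=R'_{21}R_{12}$ (namely $R'=P+P\prod_{j}(PR-x_j)$ over the remaining eigenvalues $x_j\ne-1$ of $PR$). $(m^\pm)^i_j=S(l^\pm_{ij})$, where $l^\pm_{ij}$ are given by $(\mathrm{id}\otimes T_V)(\mathcal R)(1\otimes v_j)=\sum_il^+_{ij}\otimes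 v_i$, $(T_V\otimes\mathrm{id})(\mathcal R^{-1})(v_j\otimes1)=\sum_iv_i\otimes l^-_{ij}$, $\mathcal R$ being the universal $R$-matrix. $V(R',R)$ is the braided vector algebra with generators $e^i$ and relations $e^ie^j=\sum R'{}^{ji}_{ab}e^ae^b$; $V^\vee(R',R_{21}^{-1})$ is the braided covector algebra with dual generators $f_i$ and relations $f_if_j=\sum f_bf_aR'{}^{ab}_{ij}$. $\widetilde{U_q^{\mathrm{ext}}(\mathfrak g)}=U_q^{\mathrm{ext}}(\mathfrak g)\otimes k[c,c^{-1}]$ with $c$ central and group-like. $U(V^\vee(R',R_{21}^{-1}),\widetilde{U_q^{\mathrm{ext}}(\mathfrak g)},V(R',R))$ is Majid's double-bosonization: the Hopf algebra on the tensor product of the three algebras, with cross relations $cf_i=\lambda f_ic$, $e^ic=\lambda ce^i$, $[e^i,f_j]=\frac{(m^+)^i_jc^{-1}-c(m^-)^i_j}{q_*-q_*^{-1}}$ ($e^i$ suitably normalized), $e^i(m^+)^j_k=R_{VV}{}^{ji}_{ab}(m^+)^a_ke^b$, $(m^-)^i_je^k=R_{VV}{}^{ki}_{ab}e^a(m^-)^b_j$, $(m^+)^i_jf_k=f_b(m^+)^i_aR_{VV}{}^{ab}_{jk}$, $f_i(m^-)^j_k=(m^-)^j_bf_aR_{VV}{}^{ab}_{ik}$ and coproducts $\Delta e^i=e^a\otimes(m^+)^i_ac^{-1}+1\otimes e^i$, $\Delta f_i=f_i\otimes1+c(m^-)^a_i\otimes f_a$. The additional simple root vectors are $E_{n+1}=e^p$,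 $F_{n+1}=f_p$ and the additional group-like is $K_{n+1}=(m^+)^p_pc^{-1}$. "The weight $\nu$ of $c^{-1}$" means that $c^{-1}$ is written as $K_\nu$ with $\nu$ in the enlarged Euclidean space; since $(m^+)^p_p=K_\mu$, one has $K_{n+1}=K_{\mu+\nu}$, so $\mu+\nu$ is the new simple root $\alpha_{n+1}$. *)

theory Defs
  imports "HOL-Analysis.Analysis" "HOL-Library.Poly_Mapping"
begin

section \<open>Complex algebras, generators and relations\<close>

class complex_algebra_1 = ring_1 +
  fixes scaleC :: "complex \<Rightarrow> 'a \<Rightarrow> 'a"  (infixr \<open>*\<^sub>C\<close> 75)
  assumes scaleC_add_right: "z *\<^sub>C (x + y) = z *\<^sub>C x + z *\<^sub>C y"
    and scaleC_add_left: "(z + z') *\<^sub>C x = z *\<^sub>C x + z' *\<^sub>C x"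
    and scaleC_scaleC: "z *\<^sub>C z' *\<^sub>C x = (z * z') *\<^sub>C x"
    and scaleC_one: "1 *\<^sub>C x = x"
    and mult_scaleC_left: "(z *\<^sub>C x) * y = z *\<^sub>C (x * y)"
    and mult_scaleC_right: "x * (z *\<^sub>C y) = z *\<^sub>C (x * y)"

global_interpretation cvs: vector_space "scaleC :: complex \<Rightarrow> 'a \<Rightarrow> 'a::complex_algebra_1"
  by unfold_locales (rule scaleC_add_right scaleC_add_left scaleC_scaleC scaleC_one)+

definition alg_hom :: "('a::complex_algebra_1 \<Rightarrow> 'b::complex_algebra_1) \<Rightarrow> bool" where
  "alg_hom g \<longleftrightarrow> g 1 = 1 \<and> (\<forall>x y. g (x + y) = g x + g y) \<and> (\<forall>z x. g (z *\<^sub>C x) = z *\<^sub>C g x)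
     \<and> (\<forall>x y. g (x * y) = g x * g y)"

definition alg_antihom :: "('a::complex_algebra_1 \<Rightarrow> 'b::complex_algebra_1) \<Rightarrow> bool" where
  "alg_antihom g \<longleftrightarrow> g 1 = 1 \<and> (\<forall>x y. g (x + y) = g x + g y) \<and> (\<forall>z x. g (z *\<^sub>C x) = z *\<^sub>C g x)
     \<and> (\<forall>x y. g (x * y) = g y * g x)"

definition is_basis :: "'a::complex_algebra_1 set \<Rightarrow> bool" where
  "is_basis B \<longleftrightarrow> cvs.independent B \<and> cvs.span B = UNIV"

definition invertible_elem :: "'a::ring_1 \<Rightarrow> bool" where
  "invertible_elem x \<longleftrightarrow> (\<exists>y. x * y = 1 \<and> y * x = 1)"

definition inv_elem :: "'a::ring_1 \<Rightarrow> 'a" where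
  "inv_elem x = (THE y. x * y = 1 \<and> y * x = 1)"

definition int_pow :: "'a::ring_1 \<Rightarrow> int \<Rightarrow> 'a" where
  "int_pow x k = (if k \<ge> 0 then x ^ nat k else inv_elem x ^ nat (- k))"

inductive_set generated_alg :: "'a::complex_algebra_1 set \<Rightarrow> 'a set" for G where
  one: "1 \<in> generated_alg G"
| gen: "x \<in> G \<Longrightarrow> x \<in> generated_alg G"
| add: "x \<in> generated_alg G \<Longrightarrow> y \<in> generated_alg G \<Longrightarrow> x + y \<in> generated_alg G"
| scale: "x \<in> generated_alg G \<Longrightarrow> z *\<^sub>C x \<in> generated_alg G"
| mult: "x \<in> generated_alg G \<Longrightarrow> y \<in> generated_alg G \<Longrightarrow> x * y \<in> generated_alg G"

text \<open>The free associative algebra is the algebra of the free monoid of words; lists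
  are wrapped because lists carry no \<open>monoid_add\<close> structure.\<close>

datatype 'x word = Word (letters: "'x list")

instantiation word :: (type) monoid_add
begin
definition "0 = Word []"
definition "u + v = Word (letters u @ letters v)"
instance by standard (auto simp: zero_word_def plus_word_def)
end

type_synonym 'x free_alg = "'x word \<Rightarrow>\<^sub>0 complex"

definition var :: "'x \<Rightarrow> 'x free_alg" where
  "var x = Poly_Mapping.single (Word [x]) 1"

definition const :: "complex \<Rightarrow> 'x free_alg" where
  "const z = Poly_Mapping.single 0 z"

definition free_over :: "'x set \<Rightarrow> 'x free_alg set" where
  "free_over X = {p. \<forall>w \<in> Poly_Mapping.keys p. set (letters w) \<subseteq> X}"

definition eval_free :: "('x \<Rightarrow> 'a::complex_algebra_1) \<Rightarrow> 'x free_alg \<Rightarrow> 'a" where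
  "eval_free g p =
     (\<Sum>w \<in> Poly_Mapping.keys p. Poly_Mapping.lookup p w *\<^sub>C prod_list (map g (letters w)))"

inductive_set ideal_gen :: "'x free_alg set \<Rightarrow> 'x free_alg set" for Rel where
  zero: "0 \<in> ideal_gen Rel"
| rel: "r \<in> Rel \<Longrightarrow> r \<in> ideal_gen Rel"
| add: "p \<in> ideal_gen Rel \<Longrightarrow> p' \<in> ideal_gen Rel \<Longrightarrow> p + p' \<in> ideal_gen Rel"
| mult: "p \<in> ideal_gen Rel \<Longrightarrow> a * p * b \<in> ideal_gen Rel"

text \<open>The algebra \<open>'a\<close> is the quotient of the free algebra on \<open>X\<close> by the two-sided ideal
  of \<open>Rel\<close>, the generator \<open>x\<close> being sent to \<open>g x\<close>.\<close>

definition presented_by ::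
  "'x set \<Rightarrow> 'x free_alg set \<Rightarrow> ('x \<Rightarrow> 'a::complex_algebra_1) \<Rightarrow> bool" where
  "presented_by X Rel g \<longleftrightarrow>
     eval_free g ` free_over X = UNIV \<and>
     (\<forall>p \<in> free_over X. eval_free g p = 0 \<longleftrightarrow> p \<in> ideal_gen Rel)"

text \<open>The algebra \<open>'t\<close>, with the two embeddings, is the tensor product algebra
  \<open>'a \<otimes> 'a\<close>.\<close>

definition tensor_square ::
  "('a::complex_algebra_1 \<Rightarrow> 't::complex_algebra_1) \<Rightarrow> ('a \<Rightarrow> 't) \<Rightarrow> bool" where
  "tensor_square in1 in2 \<longleftrightarrow> alg_hom in1 \<and> alg_hom in2 \<and>
     (\<forall>x y. in1 x * in2 y = in2 y * in1 x) \<and>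
     (\<forall>X Y. is_basis X \<and> is_basis Y \<longrightarrow>
        inj_on (\<lambda>(x, y). in1 x * in2 y) (X \<times> Y) \<and>
        is_basis ((\<lambda>(x, y). in1 x * in2 y) ` (X \<times> Y)))"


section \<open>Root systems\<close>

definition reflect :: "'e::real_inner \<Rightarrow> 'e \<Rightarrow> 'e" where
  "reflect a x = x - (2 * (a \<bullet> x) / (a \<bullet> a)) *\<^sub>R a"

definition root_system :: "'e::real_inner set \<Rightarrow> bool" where
  "root_system \<Phi> \<longleftrightarrow> finite \<Phi> \<and> 0 \<notin> \<Phi> \<and>
     (\<forall>a\<in>\<Phi>. \<forall>b\<in>\<Phi>. reflect a b \<in> \<Phi> \<and> 2 * (a \<bullet> b) / (a \<bullet> a) \<in> \<int>) \<and>
     (\<forall>a\<in>\<Phi>. \<forall>t. t *\<^sub>R a \<in> \<Phi> \<longrightarrow> t = 1 \<or> t = - 1)"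

definition irreducible_roots :: "'e::real_inner set \<Rightarrow> bool" where
  "irreducible_roots \<Phi> \<longleftrightarrow> \<Phi> \<noteq> {} \<and>
     \<not> (\<exists>A B. A \<noteq> {} \<and> B \<noteq> {} \<and> A \<union> B = \<Phi> \<and> A \<inter> B = {} \<and> (\<forall>a\<in>A. \<forall>b\<in>B. a \<bullet> b = 0))"

text \<open>Simple roots are indexed by \<open>0, \<dots>, n - 1\<close>.\<close>

definition positive_roots :: "'e::real_inner set \<Rightarrow> nat \<Rightarrow> (nat \<Rightarrow> 'e) \<Rightarrow> 'e set" where
  "positive_roots \<Phi> n \<alpha> = {b \<in> \<Phi>. \<exists>z::nat \<Rightarrow> nat. b = (\<Sum>i<n. real (z i) *\<^sub>R \<alpha> i)}"

definition simple_roots :: "'e::real_inner set \<Rightarrow> nat \<Rightarrow> (nat \<Rightarrow> 'e) \<Rightarrow> bool" where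
  "simple_roots \<Phi> n \<alpha> \<longleftrightarrow> inj_on \<alpha> {..<n} \<and> \<alpha> ` {..<n} \<subseteq> \<Phi> \<and> independent (\<alpha> ` {..<n}) \<and>
     (\<forall>b\<in>\<Phi>. b \<in> positive_roots \<Phi> n \<alpha> \<or> - b \<in> positive_roots \<Phi> n \<alpha>)"

text \<open>A finite-dimensional complex simple Lie algebra enters the construction only through
  its irreducible reduced root system and a base of it.\<close>

definition simple_lie_type :: "'e::real_inner set \<Rightarrow> nat \<Rightarrow> (nat \<Rightarrow> 'e) \<Rightarrow> bool" where
  "simple_lie_type \<Phi> n \<alpha> \<longleftrightarrow> root_system \<Phi> \<and> irreducible_roots \<Phi> \<and> simple_roots \<Phi> n \<alpha>"

definition cartan :: "(nat \<Rightarrow> 'e::real_inner) \<Rightarrow> nat \<Rightarrow> nat \<Rightarrow> real" where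
  "cartan \<alpha> i j = 2 * (\<alpha> i \<bullet> \<alpha> j) / (\<alpha> i \<bullet> \<alpha> i)"

definition root_seq :: "(nat \<Rightarrow> 'e::real_inner) \<Rightarrow> nat list \<Rightarrow> nat \<Rightarrow> 'e" where
  "root_seq \<alpha> w j = foldr (\<lambda>i. reflect (\<alpha> i)) (take j w) (\<alpha> (w ! j))"

text \<open>A word in the simple reflections is a reduced expression of the longest Weyl group
  element iff the roots \<open>\<beta>\<^sub>j = s\<^bsub>w0\<^esub> \<cdots> s\<^bsub>w(j-1)\<^esub> \<alpha>\<^bsub>wj\<^esub>\<close> enumerate the positive roots
  without repetition.\<close>

definition reduced_longest :: "'e::real_inner set \<Rightarrow> nat \<Rightarrow> (nat \<Rightarrow> 'e) \<Rightarrow> nat list \<Rightarrow> bool" where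
  "reduced_longest \<Phi> n \<alpha> w \<longleftrightarrow> set w \<subseteq> {..<n} \<and>
     bij_betw (root_seq \<alpha> w) {..<length w} (positive_roots \<Phi> n \<alpha>)"


section \<open>The extended quantized enveloping algebra\<close>

text \<open>All powers of \<open>q = exp h\<close> are fixed by the choice of \<open>h\<close>: \<open>q\<^sup>x\<close> is \<open>qpow h x\<close>.\<close>

definition qpow :: "complex \<Rightarrow> real \<Rightarrow> complex" where
  "qpow h x = exp (h * complex_of_real x)"

definition not_root_of_unity :: "complex \<Rightarrow> bool" where
  "not_root_of_unity h \<longleftrightarrow> (\<forall>k::nat. k > 0 \<longrightarrow> qpow h 1 ^ k \<noteq> 1)"

definition qnum :: "complex \<Rightarrow> nat \<Rightarrow> complex" where
  "qnum t k = (t ^ k - inverse t ^ k) / (t - inverse t)"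

definition qfact :: "complex \<Rightarrow> nat \<Rightarrow> complex" where
  "qfact t k = (\<Prod>j = 1..k. qnum t j)"

definition qbinom :: "complex \<Rightarrow> nat \<Rightarrow> nat \<Rightarrow> complex" where
  "qbinom t k r = qfact t k / (qfact t r * qfact t (k - r))"

definition qroot :: "complex \<Rightarrow> 'e::real_inner \<Rightarrow> complex" where
  "qroot h b = qpow h ((b \<bullet> b) / 2)"

text \<open>The weights \<open>\<beta>\<close> for which \<open>K\<^sub>\<beta>\<close> is adjoined: \<open>K\<^sub>\<beta>\<close> for \<open>\<beta> = \<alpha>\<^sub>i / m\<close> is the
  fractional power \<open>K\<^sub>i\<^sup>1\<^sup>/\<^sup>m\<close>.\<close>

definition weight_lattice :: "nat \<Rightarrow> (nat \<Rightarrow> 'e::real_inner) \<Rightarrow> nat \<Rightarrow> 'e set" where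
  "weight_lattice n \<alpha> m = range (\<lambda>z::nat \<Rightarrow> int. \<Sum>i<n. (of_int (z i) / real m) *\<^sub>R \<alpha> i)"

datatype 'e uq_gen = GE nat | GF nat | GK 'e

definition serre_element ::
  "complex \<Rightarrow> (nat \<Rightarrow> 'e::real_inner) \<Rightarrow> nat \<Rightarrow> nat \<Rightarrow> (nat \<Rightarrow> 'e uq_gen) \<Rightarrow> 'e uq_gen free_alg" where
  "serre_element h \<alpha> i j G = (let N = nat \<lfloor>1 - cartan \<alpha> i j\<rfloor> in
     \<Sum>r\<le>N. const ((- 1) ^ r * qbinom (qroot h (\<alpha> i)) N r)
              * var (G i) ^ (N - r) * var (G j) * var (G i) ^ r)"

definition uq_relations ::
  "complex \<Rightarrow> nat \<Rightarrow> (nat \<Rightarrow> 'e::real_inner) \<Rightarrow> 'e set \<Rightarrow> 'e uq_gen free_alg set" where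
  "uq_relations h n \<alpha> L =
     {var (GK 0) - 1}
   \<union> {var (GK \<beta>) * var (GK \<gamma>) - var (GK (\<beta> + \<gamma>)) | \<beta> \<gamma>. \<beta> \<in> L \<and> \<gamma> \<in> L}
   \<union> {var (GK \<beta>) * var (GE i) - const (qpow h (\<beta> \<bullet> \<alpha> i)) * var (GE i) * var (GK \<beta>) | \<beta> i. \<beta> \<in> L \<and> i < n}
   \<union> {var (GK \<beta>) * var (GF i) - const (qpow h (- (\<beta> \<bullet> \<alpha> i))) * var (GF i) * var (GK \<beta>) | \<beta> i. \<beta> \<in> L \<and> i < n}
   \<union> {var (GE i) * var (GF j) - var (GF j) * var (GE i)
        - (if i = j then const (1 / (qroot h (\<alpha> i) - inverse (qroot h (\<alpha> i))))
                           * (var (GK (\<alpha> i)) - var (GK (- \<alpha> i))) else 0) | i j. i < n \<and> j < n}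
   \<union> {serre_element h \<alpha> i j GE | i j. i < n \<and> j < n \<and> i \<noteq> j}
   \<union> {serre_element h \<alpha> i j GF | i j. i < n \<and> j < n \<and> i \<noteq> j}"

text \<open>This is the normalization \<open>K\<^sub>\<beta> E\<^sub>i = q\<^bsup>(\<beta>,\<alpha>i)\<^esup> E\<^sub>i K\<^sub>\<beta>\<close>, the one for which the formula for
  the universal R-matrix below is valid and for which vectors of weight \<open>\<kappa>\<close> satisfy
  \<open>K\<^sub>\<beta> v = q\<^bsup>(\<beta>,\<kappa>)\<^esup> v\<close> with the \<open>E\<^sub>i\<close> raising weights.  The double-bosonization contains the
  \<^emph>\<open>opposite\<close> of this algebra, and there the elements \<open>E\<^sub>i\<close>, \<open>- F\<^sub>i\<close>, \<open>K\<^sub>i\<close> satisfy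
  \<open>E\<^sub>i K\<^sub>j = q\<^sub>i\<^bsup>aij\<^esup> K\<^sub>j E\<^sub>i\<close>, \<open>F\<^sub>i K\<^sub>j = q\<^sub>i\<^bsup>-aij\<^esup> K\<^sub>j F\<^sub>i\<close> and
  \<open>[E\<^sub>i, F\<^sub>j] = \<delta>\<^sub>i\<^sub>j (K\<^sub>i - K\<^sub>i\<^sup>-\<^sup>1) / (q\<^sub>i - q\<^sub>i\<^sup>-\<^sup>1)\<close>.\<close>

definition uq_ext ::
  "complex \<Rightarrow> nat \<Rightarrow> (nat \<Rightarrow> 'e::real_inner) \<Rightarrow> 'e set
    \<Rightarrow> (nat \<Rightarrow> 'u::complex_algebra_1) \<Rightarrow> (nat \<Rightarrow> 'u) \<Rightarrow> ('e \<Rightarrow> 'u) \<Rightarrow> bool" where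
  "uq_ext h n \<alpha> L E F K \<longleftrightarrow>
     presented_by (GE ` {..<n} \<union> GF ` {..<n} \<union> GK ` L) (uq_relations h n \<alpha> L) (case_uq_gen E F K)"

text \<open>The antipode belonging to \<open>\<Delta>(E\<^sub>i) = E\<^sub>i \<otimes> K\<^sub>i + 1 \<otimes> E\<^sub>i\<close> and
  \<open>\<Delta>(F\<^sub>i) = F\<^sub>i \<otimes> 1 + K\<^sub>i\<^sup>-\<^sup>1 \<otimes> F\<^sub>i\<close>.\<close>

definition uq_antipode ::
  "nat \<Rightarrow> (nat \<Rightarrow> 'e::real_inner) \<Rightarrow> 'e set \<Rightarrow> (nat \<Rightarrow> 'u::complex_algebra_1) \<Rightarrow> (nat \<Rightarrow> 'u) \<Rightarrow> ('e \<Rightarrow> 'u)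
    \<Rightarrow> ('u \<Rightarrow> 'u) \<Rightarrow> bool" where
  "uq_antipode n \<alpha> L E F K S \<longleftrightarrow> alg_antihom S \<and> (\<forall>\<beta>\<in>L. S (K \<beta>) = K (- \<beta>)) \<and>
     (\<forall>i<n. S (E i) = - (E i * K (- \<alpha> i)) \<and> S (F i) = - (K (\<alpha> i) * F i))"

definition divided_power :: "complex \<Rightarrow> 'u::complex_algebra_1 \<Rightarrow> nat \<Rightarrow> 'u" where
  "divided_power t x r = (1 / qfact t r) *\<^sub>C x ^ r"

text \<open>Lusztig's automorphisms \<open>T\<^sub>i\<close>.\<close>

definition braid_action ::
  "complex \<Rightarrow> nat \<Rightarrow> (nat \<Rightarrow> 'e::real_inner) \<Rightarrow> 'e set \<Rightarrow> (nat \<Rightarrow> 'u::complex_algebra_1) \<Rightarrow> (nat \<Rightarrow> 'u)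
    \<Rightarrow> ('e \<Rightarrow> 'u) \<Rightarrow> (nat \<Rightarrow> 'u \<Rightarrow> 'u) \<Rightarrow> bool" where
  "braid_action h n \<alpha> L E F K \<tau> \<longleftrightarrow> (\<forall>i<n.
     alg_hom (\<tau> i) \<and> (\<forall>\<beta>\<in>L. \<tau> i (K \<beta>) = K (reflect (\<alpha> i) \<beta>)) \<and>
     \<tau> i (E i) = - (F i * K (\<alpha> i)) \<and> \<tau> i (F i) = - (K (- \<alpha> i) * E i) \<and>
     (\<forall>j<n. j \<noteq> i \<longrightarrow> (let N = nat \<lfloor>- cartan \<alpha> i j\<rfloor>; t = qroot h (\<alpha> i) in
        \<tau> i (E j) = (\<Sum>r\<le>N. ((- 1) ^ (N + r) * inverse t ^ r) *\<^sub>C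
                         (divided_power t (E i) (N - r) * E j * divided_power t (E i) r)) \<and>
        \<tau> i (F j) = (\<Sum>r\<le>N. ((- 1) ^ (N + r) * t ^ r) *\<^sub>C
                         (divided_power t (F i) r * F j * divided_power t (F i) (N - r))))))"

text \<open>The root vector \<open>T\<^bsub>w0\<^esub> \<cdots> T\<^bsub>w(j-1)\<^esub> X\<^bsub>wj\<^esub>\<close> of \<open>\<beta>\<^sub>j\<close>, for \<open>X = E\<close> or \<open>X = F\<close>.  When \<open>\<beta>\<^sub>j\<close> is
  a simple root \<open>\<alpha>\<^sub>k\<close> it equals \<open>X\<^sub>k\<close> by a theorem of Lusztig; this is built in.\<close>

definition root_vector ::
  "nat \<Rightarrow> (nat \<Rightarrow> 'e::real_inner) \<Rightarrow> nat list \<Rightarrow> (nat \<Rightarrow> 'u \<Rightarrow> 'u) \<Rightarrow> (nat \<Rightarrow> 'u) \<Rightarrow> nat \<Rightarrow> 'u" where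
  "root_vector n \<alpha> w \<tau> X j =
     (if \<exists>k<n. root_seq \<alpha> w j = \<alpha> k then X (THE k. k < n \<and> root_seq \<alpha> w j = \<alpha> k)
      else foldr \<tau> (take j w) (X (w ! j)))"

definition root_monomial ::
  "nat \<Rightarrow> (nat \<Rightarrow> 'e::real_inner) \<Rightarrow> nat list \<Rightarrow> (nat \<Rightarrow> 'u \<Rightarrow> 'u) \<Rightarrow> (nat \<Rightarrow> 'u::complex_algebra_1)
    \<Rightarrow> nat list \<Rightarrow> 'u" where
  "root_monomial n \<alpha> w \<tau> X r =
     prod_list (map (\<lambda>j. root_vector n \<alpha> w \<tau> X j ^ (r ! j)) [0..<length w])"

definition quasi_R_coeff ::
  "complex \<Rightarrow> (nat \<Rightarrow> 'e::real_inner) \<Rightarrow> nat list \<Rightarrow> nat list \<Rightarrow> complex" where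
  "quasi_R_coeff h \<alpha> w r =
     (\<Prod>j<length w. let t = qroot h (root_seq \<alpha> w j) in
        (1 - inverse t ^ 2) ^ (r ! j) / qfact t (r ! j) * t ^ (r ! j * (r ! j + 1) div 2))"


section \<open>Representations and R-matrices\<close>

text \<open>The weight basis is indexed by a finite linear order \<open>'p\<close> of cardinality \<open>p\<close>, and \<open>T x $ i $ j\<close>
  is the coefficient of \<open>v\<^sub>i\<close> in \<open>x v\<^sub>j\<close>.\<close>

definition representation :: "('u::complex_algebra_1 \<Rightarrow> complex^'p^'p) \<Rightarrow> bool" where
  "representation T \<longleftrightarrow> T 1 = mat 1 \<and> (\<forall>x y. T (x + y) = T x + T y) \<and>
     (\<forall>z x. T (z *\<^sub>C x) = mat z ** T x) \<and> (\<forall>x y. T (x * y) = T x ** T y)"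

definition irreducible_rep ::
  "nat \<Rightarrow> (nat \<Rightarrow> 'e::real_inner) \<Rightarrow> (nat \<Rightarrow> 'u::complex_algebra_1) \<Rightarrow> (nat \<Rightarrow> 'u) \<Rightarrow> ('e \<Rightarrow> 'u)
    \<Rightarrow> ('u \<Rightarrow> complex^'p^'p) \<Rightarrow> bool" where
  "irreducible_rep n \<alpha> E F K T \<longleftrightarrow> representation T \<and>
     (\<forall>W. 0 \<in> W \<and> (\<forall>x\<in>W. \<forall>y\<in>W. x + y \<in> W) \<and> (\<forall>z. \<forall>x\<in>W. z *s x \<in> W) \<and>
          (\<forall>i<n. \<forall>x\<in>W. T (E i) *v x \<in> W \<and> T (F i) *v x \<in> W \<and>
                         T (K (\<alpha> i)) *v x \<in> W \<and> T (K (- \<alpha> i)) *v x \<in> W)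
        \<longrightarrow> W = {0} \<or> W = UNIV)"

definition top_index :: "'p::{finite,linorder}" where
  "top_index = Max UNIV"

definition weight_basis ::
  "complex \<Rightarrow> nat \<Rightarrow> 'e::real_inner set \<Rightarrow> (nat \<Rightarrow> 'u::complex_algebra_1) \<Rightarrow> (nat \<Rightarrow> 'u) \<Rightarrow> ('e \<Rightarrow> 'u)
    \<Rightarrow> ('u \<Rightarrow> complex^('p::{finite,linorder})^('p::{finite,linorder})) \<Rightarrow> ('p \<Rightarrow> 'e) \<Rightarrow> bool" where
  "weight_basis h n L E F K T \<kappa> \<longleftrightarrow> range \<kappa> \<subseteq> L \<and>
     (\<forall>\<beta>\<in>L. \<forall>i j. T (K \<beta>) $ i $ j = (if i = j then qpow h (\<beta> \<bullet> \<kappa> i) else 0)) \<and>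
     (\<forall>k<n. \<forall>i j. (T (E k) $ i $ j \<noteq> 0 \<longrightarrow> j < i) \<and> (T (F k) $ i $ j \<noteq> 0 \<longrightarrow> i < j))"

text \<open>The exponents in the quasi-R-matrix are restricted to be smaller than \<open>p\<close>: a root vector
  shifts weights by a root, so its \<open>p\<close>-th power vanishes on a \<open>p\<close>-dimensional representation.\<close>

definition exponents :: "nat \<Rightarrow> nat \<Rightarrow> nat list set" where
  "exponents N p = {r. length r = N \<and> set r \<subseteq> {..<p}}"

text \<open>\<open>B\<^sub>V\<^sub>V \<circ> (T \<otimes> T)\<close> of the quasi-R-matrix; the entry at \<open>(i, j)\<close>, \<open>(k, l)\<close> is the coefficient of
  \<open>v\<^sub>i \<otimes> v\<^sub>j\<close> in the image of \<open>v\<^sub>k \<otimes> v\<^sub>l\<close>.  In \<open>l_plus\<close> and \<open>l_hat\<close> the diagonal factor of the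
  universal R-matrix acts on the other tensor factor through \<open>K\<^bsub>\<kappa> i\<^esub>\<close>.\<close>

definition R_VV ::
  "complex \<Rightarrow> nat \<Rightarrow> (nat \<Rightarrow> 'e::real_inner) \<Rightarrow> nat list \<Rightarrow> (nat \<Rightarrow> 'u::complex_algebra_1 \<Rightarrow> 'u)
    \<Rightarrow> (nat \<Rightarrow> 'u) \<Rightarrow> (nat \<Rightarrow> 'u) \<Rightarrow> ('u \<Rightarrow> complex^'p^'p) \<Rightarrow> ('p \<Rightarrow> 'e)
    \<Rightarrow> complex^('p::finite \<times> 'p)^('p \<times> 'p)" where
  "R_VV h n \<alpha> w \<tau> E F T \<kappa> = (\<chi> x y. qpow h (\<kappa> (fst x) \<bullet> \<kappa> (snd x)) *
     (\<Sum>r \<in> exponents (length w) CARD('p). quasi_R_coeff h \<alpha> w r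
         * T (root_monomial n \<alpha> w \<tau> E r) $ fst x $ fst y
         * T (root_monomial n \<alpha> w \<tau> F r) $ snd x $ snd y))"

text \<open>\<open>(id \<otimes> T)(\<R>) (1 \<otimes> v\<^sub>j) = \<Sum>\<^sub>i l_plus\<^sub>i\<^sub>j \<otimes> v\<^sub>i\<close> and
  \<open>(T \<otimes> id)(\<R>) (v\<^sub>j \<otimes> 1) = \<Sum>\<^sub>i v\<^sub>i \<otimes> l_hat\<^sub>i\<^sub>j\<close>.\<close>

definition l_plus ::
  "complex \<Rightarrow> nat \<Rightarrow> (nat \<Rightarrow> 'e::real_inner) \<Rightarrow> nat list \<Rightarrow> (nat \<Rightarrow> 'u::complex_algebra_1 \<Rightarrow> 'u)
    \<Rightarrow> (nat \<Rightarrow> 'u) \<Rightarrow> (nat \<Rightarrow> 'u) \<Rightarrow> ('e \<Rightarrow> 'u) \<Rightarrow> ('u \<Rightarrow> complex^'p^'p) \<Rightarrow> ('p::finite \<Rightarrow> 'e)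
    \<Rightarrow> 'p \<Rightarrow> 'p \<Rightarrow> 'u" where
  "l_plus h n \<alpha> w \<tau> E F K T \<kappa> i j = (\<Sum>r \<in> exponents (length w) CARD('p).
     (quasi_R_coeff h \<alpha> w r * T (root_monomial n \<alpha> w \<tau> F r) $ i $ j)
       *\<^sub>C (K (\<kappa> i) * root_monomial n \<alpha> w \<tau> E r))"

definition l_hat ::
  "complex \<Rightarrow> nat \<Rightarrow> (nat \<Rightarrow> 'e::real_inner) \<Rightarrow> nat list \<Rightarrow> (nat \<Rightarrow> 'u::complex_algebra_1 \<Rightarrow> 'u)
    \<Rightarrow> (nat \<Rightarrow> 'u) \<Rightarrow> (nat \<Rightarrow> 'u) \<Rightarrow> ('e \<Rightarrow> 'u) \<Rightarrow> ('u \<Rightarrow> complex^'p^'p) \<Rightarrow> ('p::finite \<Rightarrow> 'e)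
    \<Rightarrow> 'p \<Rightarrow> 'p \<Rightarrow> 'u" where
  "l_hat h n \<alpha> w \<tau> E F K T \<kappa> i j = (\<Sum>r \<in> exponents (length w) CARD('p).
     (quasi_R_coeff h \<alpha> w r * T (root_monomial n \<alpha> w \<tau> E r) $ i $ j)
       *\<^sub>C (K (\<kappa> i) * root_monomial n \<alpha> w \<tau> F r))"

text \<open>Used to obtain \<open>l\<^sup>-\<close>, the matrix of \<open>(T \<otimes> id)(\<R>\<^sup>-\<^sup>1)\<close>, as the inverse of \<open>l_hat\<close>.\<close>

definition inverse_matrices :: "('p::finite \<Rightarrow> 'p \<Rightarrow> 'u::ring_1) \<Rightarrow> ('p \<Rightarrow> 'p \<Rightarrow> 'u) \<Rightarrow> bool" where
  "inverse_matrices A B \<longleftrightarrow> (\<forall>i j. (\<Sum>k\<in>UNIV. A i k * B k j) = (if i = j then 1 else 0) \<and>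
                              (\<Sum>k\<in>UNIV. B i k * A k j) = (if i = j then 1 else 0))"

definition perm_matrix :: "complex^('p::finite \<times> 'p)^('p \<times> 'p)" where
  "perm_matrix = (\<chi> x y. if fst x = snd y \<and> snd x = fst y then 1 else 0)"

definition eigenvalue_of :: "complex^'a^'a \<Rightarrow> complex \<Rightarrow> bool" where
  "eigenvalue_of A z \<longleftrightarrow> (\<exists>v. v \<noteq> 0 \<and> A *v v = z *s v)"

definition leg12 :: "complex^('p::finite \<times> 'p)^('p \<times> 'p) \<Rightarrow> complex^('p \<times> 'p \<times> 'p)^('p \<times> 'p \<times> 'p)" where
  "leg12 A = (\<chi> x y. case (x, y) of ((i, j, k), (i', j', k')) \<Rightarrow>
     if k = k' then A $ (i, j) $ (i', j') else 0)"

definition leg13 :: "complex^('p::finite \<times> 'p)^('p \<times> 'p) \<Rightarrow> complex^('p \<times> 'p \<times> 'p)^('p \<times> 'p \<times> 'p)" where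
  "leg13 A = (\<chi> x y. case (x, y) of ((i, j, k), (i', j', k')) \<Rightarrow>
     if j = j' then A $ (i, k) $ (i', k') else 0)"

definition leg23 :: "complex^('p::finite \<times> 'p)^('p \<times> 'p) \<Rightarrow> complex^('p \<times> 'p \<times> 'p)^('p \<times> 'p \<times> 'p)" where
  "leg23 A = (\<chi> x y. case (x, y) of ((i, j, k), (i', j', k')) \<Rightarrow>
     if i = i' then A $ (j, k) $ (j', k') else 0)"

definition flip21 :: "complex^('p::finite \<times> 'p)^('p \<times> 'p) \<Rightarrow> complex^('p \<times> 'p)^('p \<times> 'p)" where
  "flip21 A = perm_matrix ** A ** perm_matrix"

definition matrix_prod_list :: "(complex^'a^'a) list \<Rightarrow> complex^'a^'a" where
  "matrix_prod_list As = foldr (**) As (mat 1)"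

text \<open>\<open>R'\<close> is obtained from \<open>R\<close>, where \<open>- 1\<close> is an eigenvalue of \<open>P R\<close>, and satisfies (i)--(iii).\<close>

definition braided_pair ::
  "complex^('p::finite \<times> 'p)^('p \<times> 'p) \<Rightarrow> complex^('p \<times> 'p)^('p \<times> 'p) \<Rightarrow> bool" where
  "braided_pair R' R \<longleftrightarrow>
     (let P = perm_matrix in
       eigenvalue_of (P ** R) (- 1) \<and>
       (\<exists>xs. distinct xs \<and> set xs = {z. eigenvalue_of (P ** R) z \<and> z \<noteq> - 1} \<and>
          R' = P + P ** matrix_prod_list (map (\<lambda>z. P ** R - mat z) xs)) \<and>
       leg12 R ** leg13 R ** leg23 R' = leg23 R' ** leg13 R ** leg12 R \<and>
       leg23 R ** leg13 R ** leg12 R' = leg12 R' ** leg13 R ** leg23 R \<and>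
       (P ** R + mat 1) ** (P ** R' - mat 1) = 0 \<and>
       flip21 R ** R' = flip21 R' ** R)"


section \<open>Double-bosonization\<close>

text \<open>The index convention for the entries \<open>R\<^sup>i\<^sup>j\<^sub>k\<^sub>l\<close> that occur in the relations below: the
  second pair of tensor slots is listed first, that is, \<open>R\<^sup>i\<^sup>j\<^sub>k\<^sub>l\<close> is the coefficient of
  \<open>v\<^sub>j \<otimes> v\<^sub>i\<close> in \<open>R (v\<^sub>l \<otimes> v\<^sub>k)\<close>.  The matrices \<open>m\<^sup>+\<close> and \<open>m\<^sup>-\<close> are upper and lower
  triangular; with the slots in the other order the cross relations would contradict the
  triangular decomposition.\<close>

definition R_entry :: "complex^('p::finite \<times> 'p)^('p \<times> 'p) \<Rightarrow> 'p \<Rightarrow> 'p \<Rightarrow> 'p \<Rightarrow> 'p \<Rightarrow> complex" where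
  "R_entry R i j k l = R $ (j, i) $ (l, k)"

text \<open>The algebra underlying \<open>V(R', R)\<close> depends on \<open>R'\<close> only, \<open>R\<close> being its braiding; likewise
  for the covector algebra.\<close>

definition vector_algebra ::
  "complex^('p::finite \<times> 'p)^('p \<times> 'p) \<Rightarrow> ('p \<Rightarrow> 'v::complex_algebra_1) \<Rightarrow> bool" where
  "vector_algebra R' e \<longleftrightarrow> presented_by UNIV
     {var i * var j - (\<Sum>a\<in>UNIV. \<Sum>b\<in>UNIV. const (R_entry R' j i a b) * var a * var b) | i j. True} e"

definition covector_algebra ::
  "complex^('p::finite \<times> 'p)^('p \<times> 'p) \<Rightarrow> ('p \<Rightarrow> 'w::complex_algebra_1) \<Rightarrow> bool" where
  "covector_algebra R' f \<longleftrightarrow> presented_by UNIV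
     {var i * var j - (\<Sum>a\<in>UNIV. \<Sum>b\<in>UNIV. const (R_entry R' a b i j) * var b * var a) | i j. True} f"

text \<open>Multiplication identifies \<open>V\<^sup>\<or> \<otimes> (U\<^sup>o\<^sup>p \<otimes> k[c, c\<^sup>-\<^sup>1]) \<otimes> V\<close> with the algebra \<open>'d\<close>.\<close>

definition triangular_decomposition ::
  "('w::complex_algebra_1 \<Rightarrow> 'd::complex_algebra_1) \<Rightarrow> ('u::complex_algebra_1 \<Rightarrow> 'd) \<Rightarrow> 'd
    \<Rightarrow> ('v::complex_algebra_1 \<Rightarrow> 'd) \<Rightarrow> bool" where
  "triangular_decomposition jw ju c jv \<longleftrightarrow>
     (\<forall>X Y Z. is_basis X \<and> is_basis Y \<and> is_basis Z \<longrightarrow>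
        (let g = (\<lambda>(x, y, k, z). jw x * ju y * int_pow c k * jv z); B = X \<times> Y \<times> (UNIV :: int set) \<times> Z
         in inj_on g B \<and> is_basis (g ` B)))"

definition cross_relations ::
  "complex^('p::finite \<times> 'p)^('p \<times> 'p) \<Rightarrow> complex \<Rightarrow> complex
    \<Rightarrow> ('p \<Rightarrow> 'd::complex_algebra_1) \<Rightarrow> ('p \<Rightarrow> 'd) \<Rightarrow> ('p \<Rightarrow> 'p \<Rightarrow> 'd) \<Rightarrow> ('p \<Rightarrow> 'p \<Rightarrow> 'd) \<Rightarrow> 'd \<Rightarrow> bool" where
  "cross_relations RVV lam qs e f mp mm c \<longleftrightarrow>
     (\<forall>i. c * f i = lam *\<^sub>C (f i * c) \<and> e i * c = lam *\<^sub>C (c * e i)) \<and>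
     (\<forall>i j. e i * f j - f j * e i =
        (1 / (qs - inverse qs)) *\<^sub>C (mp i j * inv_elem c - c * mm i j)) \<and>
     (\<forall>i j k. e i * mp j k = (\<Sum>a\<in>UNIV. \<Sum>b\<in>UNIV. R_entry RVV j i a b *\<^sub>C (mp a k * e b))) \<and>
     (\<forall>i j k. mm i j * e k = (\<Sum>a\<in>UNIV. \<Sum>b\<in>UNIV. R_entry RVV k i a b *\<^sub>C (e a * mm b j))) \<and>
     (\<forall>i j k. mp i j * f k = (\<Sum>a\<in>UNIV. \<Sum>b\<in>UNIV. R_entry RVV a b j k *\<^sub>C (f b * mp i a))) \<and>
     (\<forall>i j k. f i * mm j k = (\<Sum>a\<in>UNIV. \<Sum>b\<in>UNIV. R_entry RVV a b i k *\<^sub>C (mm j b * f a)))"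

text \<open>The coproduct is an algebra homomorphism, hence determined by its values on generators, and
  it determines the counit and the antipode.\<close>

definition bosonization_coproduct ::
  "nat \<Rightarrow> (nat \<Rightarrow> 'e::real_inner) \<Rightarrow> 'e set \<Rightarrow> (nat \<Rightarrow> 'd::complex_algebra_1) \<Rightarrow> (nat \<Rightarrow> 'd) \<Rightarrow> ('e \<Rightarrow> 'd)
    \<Rightarrow> ('p::finite \<Rightarrow> 'd) \<Rightarrow> ('p \<Rightarrow> 'd) \<Rightarrow> ('p \<Rightarrow> 'p \<Rightarrow> 'd) \<Rightarrow> ('p \<Rightarrow> 'p \<Rightarrow> 'd) \<Rightarrow> 'd
    \<Rightarrow> ('d \<Rightarrow> 't::complex_algebra_1) \<Rightarrow> ('d \<Rightarrow> 't) \<Rightarrow> ('d \<Rightarrow> 't) \<Rightarrow> bool" where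
  "bosonization_coproduct n \<alpha> L E F K e f mp mm c in1 in2 \<Delta> \<longleftrightarrow> alg_hom \<Delta> \<and>
     (\<forall>\<beta>\<in>L. \<Delta> (K \<beta>) = in1 (K \<beta>) * in2 (K \<beta>)) \<and>
     (\<forall>i<n. \<Delta> (E i) = in1 (E i) * in2 (K (\<alpha> i)) + in2 (E i) \<and>
            \<Delta> (F i) = in1 (F i) + in1 (K (- \<alpha> i)) * in2 (F i)) \<and>
     \<Delta> c = in1 c * in2 c \<and>
     (\<forall>i. \<Delta> (e i) = (\<Sum>a\<in>UNIV. in1 (e a) * in2 (mp i a * inv_elem c)) + in2 (e i)) \<and>
     (\<forall>i. \<Delta> (f i) = in1 (f i) + (\<Sum>a\<in>UNIV. in1 (c * mm a i) * in2 (f a)))"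

text \<open>\<open>'d\<close> is the Hopf algebra \<open>U(V\<^sup>\<or>, U\<^bsub>ext\<^esub> \<otimes> k[c, c\<^sup>-\<^sup>1], V)\<close>, with \<open>U\<^bsub>ext\<^esub>\<close> embedded through \<open>ju\<close>
  by an algebra antihomomorphism (see the remark at \<open>uq_ext\<close>).\<close>

definition double_bosonization ::
  "nat \<Rightarrow> (nat \<Rightarrow> 'e::real_inner) \<Rightarrow> 'e set
    \<Rightarrow> (nat \<Rightarrow> 'u::complex_algebra_1) \<Rightarrow> (nat \<Rightarrow> 'u) \<Rightarrow> ('e \<Rightarrow> 'u)
    \<Rightarrow> ('p::finite \<Rightarrow> 'v::complex_algebra_1) \<Rightarrow> ('p \<Rightarrow> 'w::complex_algebra_1)
    \<Rightarrow> ('p \<Rightarrow> 'p \<Rightarrow> 'u) \<Rightarrow> ('p \<Rightarrow> 'p \<Rightarrow> 'u)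
    \<Rightarrow> complex^('p \<times> 'p)^('p \<times> 'p) \<Rightarrow> complex \<Rightarrow> complex
    \<Rightarrow> ('w \<Rightarrow> 'd::complex_algebra_1) \<Rightarrow> ('u \<Rightarrow> 'd) \<Rightarrow> 'd \<Rightarrow> ('v \<Rightarrow> 'd)
    \<Rightarrow> ('d \<Rightarrow> 't::complex_algebra_1) \<Rightarrow> ('d \<Rightarrow> 't) \<Rightarrow> ('d \<Rightarrow> 't) \<Rightarrow> bool" where
  "double_bosonization n \<alpha> L E F K e f mp mm RVV lam qs jw ju c jv in1 in2 \<Delta> \<longleftrightarrow>
     alg_hom jw \<and> alg_antihom ju \<and> alg_hom jv \<and>
     invertible_elem c \<and> (\<forall>x. c * ju x = ju x * c) \<and>
     triangular_decomposition jw ju c jv \<and>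
     cross_relations RVV lam qs (jv \<circ> e) (jw \<circ> f) (\<lambda>i j. ju (mp i j)) (\<lambda>i j. ju (mm i j)) c \<and>
     tensor_square in1 in2 \<and>
     bosonization_coproduct n \<alpha> L (ju \<circ> E) (ju \<circ> F) (ju \<circ> K) (jv \<circ> e) (jw \<circ> f)
       (\<lambda>i j. ju (mp i j)) (\<lambda>i j. ju (mm i j)) c in1 in2 \<Delta>"


section \<open>Rank and Cartan matrix\<close>

definition adjoin :: "nat \<Rightarrow> (nat \<Rightarrow> 'a) \<Rightarrow> 'a \<Rightarrow> nat \<Rightarrow> 'a" where
  "adjoin n X y i = (if i < n then X i else y)"

text \<open>The element \<open>x\<close> is \<open>K\<^sub>\<nu>\<close> with respect to the simple roots \<open>\<alpha>\<close> and root vectors \<open>E\<close>, \<open>F\<close>.  The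
  pairings are rational because only fractional powers of \<open>q\<close> are used.\<close>

definition has_weight ::
  "complex \<Rightarrow> nat \<Rightarrow> (nat \<Rightarrow> 'e::real_inner) \<Rightarrow> (nat \<Rightarrow> 'd::complex_algebra_1) \<Rightarrow> (nat \<Rightarrow> 'd)
    \<Rightarrow> 'd \<Rightarrow> 'e \<Rightarrow> bool" where
  "has_weight h r \<alpha> E F x \<nu> \<longleftrightarrow> (\<forall>i<r. \<alpha> i \<bullet> \<nu> \<in> \<rat> \<and>
     E i * x = qpow h (\<alpha> i \<bullet> \<nu>) *\<^sub>C (x * E i) \<and> F i * x = qpow h (- (\<alpha> i \<bullet> \<nu>)) *\<^sub>C (x * F i))"

definition torus_monomial :: "nat \<Rightarrow> (nat \<Rightarrow> 'd::ring_1) \<Rightarrow> (nat \<Rightarrow> int) \<Rightarrow> 'd" where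
  "torus_monomial r K z = prod_list (map (\<lambda>i. int_pow (K i) (z i)) [0..<r])"

text \<open>The Hopf algebra \<open>'d\<close> is a quantum group of rank \<open>r\<close> with Cartan matrix \<open>a\<close> and
  \<open>q\<^sub>i = q\<^bsup>d i\<^esup>\<close>: it is generated by a commutative group \<open>H\<close> of group-likes and by \<open>r\<close> pairs of nonzero
  skew-primitive simple root vectors; the \<open>K\<^sub>i\<close> are independent, and \<open>H\<close> consists of fractional
  powers of products of the \<open>K\<^sub>i\<^sup>\<plusminus>\<^sup>1\<close>; the Cartan matrix is the matrix of exponents in the
  commutation relations of \<open>E\<^sub>i\<close>, \<open>F\<^sub>i\<close> with \<open>K\<^sub>j\<close>.  No q-Serre relations are included, since the
  entries \<open>a\<^sub>i\<^sub>j\<close> need not be integers.\<close>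

definition quantum_group ::
  "complex \<Rightarrow> nat \<Rightarrow> (nat \<Rightarrow> nat \<Rightarrow> real) \<Rightarrow> (nat \<Rightarrow> real) \<Rightarrow> 'd set
    \<Rightarrow> (nat \<Rightarrow> 'd::complex_algebra_1) \<Rightarrow> (nat \<Rightarrow> 'd) \<Rightarrow> (nat \<Rightarrow> 'd)
    \<Rightarrow> ('d \<Rightarrow> 't::complex_algebra_1) \<Rightarrow> ('d \<Rightarrow> 't) \<Rightarrow> ('d \<Rightarrow> 't) \<Rightarrow> bool" where
  "quantum_group h r a d H E F K in1 in2 \<Delta> \<longleftrightarrow>
     1 \<in> H \<and> (\<forall>x\<in>H. \<forall>y\<in>H. x * y \<in> H \<and> x * y = y * x) \<and>
     (\<forall>x\<in>H. invertible_elem x \<and> inv_elem x \<in> H \<and> \<Delta> x = in1 x * in2 x) \<and>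
     K ` {..<r} \<subseteq> H \<and>
     (\<forall>z. torus_monomial r K z = 1 \<longrightarrow> (\<forall>i<r. z i = 0)) \<and>
     (\<forall>x\<in>H. \<exists>N>0. \<exists>z. x ^ N = torus_monomial r K z) \<and>
     (\<forall>i<r. E i \<noteq> 0 \<and> F i \<noteq> 0) \<and>
     (\<forall>i<r. \<forall>j<r. E i * K j = qpow h (d i * a i j) *\<^sub>C (K j * E i) \<and>
                    F i * K j = qpow h (- (d i * a i j)) *\<^sub>C (K j * F i)) \<and>
     (\<forall>i<r. \<forall>j<r. E i * F j - F j * E i =
        (if i = j then (1 / (qpow h (d i) - inverse (qpow h (d i)))) *\<^sub>C (K i - inv_elem (K i)) else 0)) \<and>
     (\<forall>i<r. \<Delta> (E i) = in1 (E i) * in2 (K i) + in2 (E i) \<and>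
            \<Delta> (F i) = in1 (F i) + in1 (inv_elem (K i)) * in2 (F i)) \<and>
     generated_alg (H \<union> E ` {..<r} \<union> F ` {..<r}) = UNIV"

end

theory Submission
  imports Defs
begin

text \<open>Write \<open>A\<close> for the image of the L-operator \<open>l_hat\<close> in the double-bosonization.  Since \<open>v\<^sub>p\<close> generates
  the irreducible module \<open>V\<close> under the \<open>F\<^sub>i\<close>, its weight \<open>-\<mu>\<close> is the highest one; hence the row and
  column of \<open>m\<^sup>+\<close>, \<open>m\<^sup>-\<close> belonging to \<open>v\<^sub>p\<close> reduce to \<open>K\<^bsub>\<mu>\<^esub>\<close>, \<open>K\<^bsub>-\<mu>\<^esub>\<close>, and the cross relations for
  \<open>e\<^sup>p\<close>, \<open>f\<^sub>p\<close> become diagonal.  The entries of \<open>m\<^sup>+\<close> and \<open>A\<close> whose weights differ by a simple root are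
  multiples of \<open>E\<^sub>s\<close> and \<open>F\<^sub>s\<close>, so these relations say that \<open>e\<^sup>p\<close>, \<open>f\<^sub>p\<close> are simple root vectors, while
  the cross relations for general \<open>e\<^sup>i\<close>, \<open>f\<^sub>i\<close> express \<open>\<Sum>\<^sub>b T(E\<^sub>s)\<^sub>i\<^sub>b e\<^sup>b\<close> and \<open>\<Sum>\<^sub>a T(F\<^sub>s)\<^sub>a\<^sub>i f\<^sub>a\<close> through
  \<open>e\<^sup>i\<close>, \<open>f\<^sub>i\<close> and \<open>U\<^sub>q\<close>; by irreducibility \<open>e\<^sup>p\<close> and \<open>f\<^sub>p\<close> generate the rest.  Because \<open>c\<close> is central in
  \<open>U\<^sub>q\<close> and \<open>E\<^sub>i \<noteq> 0\<close>, the weight \<open>\<nu>\<close> is orthogonal to all \<open>\<alpha>\<^sub>i\<close>, and \<open>\<mu>\<close> lies in their span.\<close>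

section \<open>Complex algebras\<close>

text \<open>Two obstacles shape the proof. First, \<open>mm\<close> comes from the inverse of the
  matrix \<open>l_hat\<close>, so its entries are not explicit; the relations that contain it are
  conjugated by \<open>A\<close>, whose entries can be read off from the quasi-R-matrix. A linear
  height function isolates the relevant terms there: height zero leaves only the zero exponent
  tuple, height one only a single simple root. Second, the cross relations give the commutation of
  e^i, f_i with K_\<gamma> only for \<gamma> generated by the weights of V. A simple root is a
  difference of such weights once its \<open>E s\<close> acts nontrivially. If some
  \<open>E s\<close> acted as zero, connectedness of the Dynkin diagram would make V trivial; then
  R_VV = 1, and the eigenvalue -1 of PR gives \<lambda> = -1. But \<lambda> governs how e^p commutes
  with c, and no rational power of q equals -1. This is where the rationality in
  \<open>has_weight\<close> and the eigenvalue in \<open>braided_pair\<close> enter.\<close>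

lemma invertible_elemI: "x * y = 1 \<Longrightarrow> y * x = 1 \<Longrightarrow> invertible_elem (x::'a::ring_1)"
  unfolding invertible_elem_def by blast

lemma inv_elem_unique: "(x::'a::ring_1) * y = 1 \<Longrightarrow> y * x = 1 \<Longrightarrow> inv_elem x = y"
  unfolding inv_elem_def
proof (rule the_equality)
  fix z assume "x * y = 1" "y * x = 1" "x * z = 1 \<and> z * x = 1"
  then have "z = z * (x * y)" "z * x = 1" by simp_all
  then show "z = y" by (simp add: mult.assoc [symmetric])
qed simp

lemma inv_elem:
  assumes "invertible_elem (x::'a::ring_1)"
  shows "x * inv_elem x = 1" "inv_elem x * x = 1"
  using assms inv_elem_unique unfolding invertible_elem_def by metis+

text \<open>A homomorphism defined on the integers is determined by its value at 1. Integer powers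
  of the group-likes K_\<gamma> c^z are computed this way, without a case distinction on
  signs.\<close>

lemma int_pow_of_hom:
  fixes g :: "int \<Rightarrow> 'a::ring_1"
  assumes g0: "g 0 = 1" and g_add: "\<And>a b. g (a + b) = g a * g b"
  shows "int_pow (g 1) z = g z"
proof -
  have pow: "g a ^ k = g (int k * a)" for a k
    by (induction k) (simp_all add: g0 g_add [symmetric] distrib_right)
  have "inv_elem (g 1) = g (- 1)"
    by (rule inv_elem_unique) (simp_all add: g_add [symmetric] g0)
  then show ?thesis
    by (simp add: int_pow_def pow)
qed

lemma
  assumes "invertible_elem (x::'a::ring_1)"
  shows int_pow_add: "int_pow x (a + b) = int_pow x a * int_pow x b"
    and int_pow_0: "int_pow x 0 = 1" and int_pow_1: "int_pow x 1 = x"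
    and int_pow_minus_1: "int_pow x (- 1) = inv_elem x"
proof -
  note inv = inv_elem[OF assms]
  show 0: "int_pow x 0 = 1" and 1: "int_pow x 1 = x" and "int_pow x (- 1) = inv_elem x"
    by (simp_all add: int_pow_def)
  have step: "int_pow x (k + 1) = x * int_pow x k" for k
  proof (cases "k \<ge> 0")
    \<comment> \<open>Writing k = -1 - l keeps the passage from exponent -1 to 0, which is l = 0,
      inside this case.\<close>
    case False
    then obtain l where l: "k = - 1 - int l"
      by (intro that[of "nat (- 1 - k)"]) simp
    have "int_pow x (k + 1) = inv_elem x ^ l" 
      by (cases l) (simp_all add: int_pow_def l nat_add_distrib)
    moreover have "int_pow x k = inv_elem x ^ Suc l"
      by (simp add: int_pow_def l nat_add_distrib)
    ultimately show ?thesis by (simp add: mult.assoc [symmetric] inv)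
  qed (simp add: int_pow_def nat_add_distrib)
  have step': "int_pow x (k - 1) = inv_elem x * int_pow x k" for k
    using step[of "k - 1"] inv by (simp add: mult.assoc [symmetric])
  show "int_pow x (a + b) = int_pow x a * int_pow x b"
  proof (induction a rule: int_induct[where k = 0])
    case (step1 i)
    have "int_pow x (i + 1 + b) = int_pow x ((i + b) + 1)" by (simp add: ac_simps)
    then show ?case using step1 by (simp only: step mult.assoc)
  next
    case (step2 i)
    have "int_pow x (i - 1 + b) = int_pow x ((i + b) - 1)" by (simp add: algebra_simps)
    then show ?case using step2 by (simp only: step' mult.assoc)
  qed (simp add: 0)
qed

lemma int_pow_commute:
  assumes x: "invertible_elem (x::'a::ring_1)" and "x * y = y * x"
  shows "int_pow x k * y = y * int_pow x k"
proof -
  have "inv_elem x * y = inv_elem x * (y * x) * inv_elem x"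
    using inv_elem[OF x] by (simp add: mult.assoc)
  also have "\<dots> = y * inv_elem x"
    using inv_elem[OF x] by (simp add: assms(2) [symmetric] mult.assoc [symmetric])
  finally have inv: "inv_elem x * y = y * inv_elem x" .
  have pow: "z * y = y * z \<Longrightarrow> z ^ k * y = y * z ^ k" for z k
    by (rule power_commuting_commutes)
  show ?thesis
    using pow[OF inv] pow[OF assms(2)] by (simp add: int_pow_def)
qed

lemma alg_hom_simps:
  assumes "alg_hom g"
  shows "g 1 = 1" "g (x + y) = g x + g y" "g (z *\<^sub>C x) = z *\<^sub>C g x" "g (x * y) = g x * g y"
    "g 0 = 0" "g (- x) = - g x" "g (x - y) = g x - g y"
proof -
  show 1: "g 1 = 1" "g (x + y) = g x + g y" "g (z *\<^sub>C x) = z *\<^sub>C g x" "g (x * y) = g x * g y" for x y z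
    using assms by (auto simp: alg_hom_def)
  show 0: "g 0 = 0" using 1(2)[of 0 0] by simp
  show minus: "g (- x) = - g x" for x using 1(2)[of x "- x"] by (simp add: 0 add_eq_0_iff)
  show "g (x - y) = g x - g y" using 1(2)[of x "- y"] by (simp add: minus)
qed

lemma alg_antihom_simps:
  assumes "alg_antihom g"
  shows "g 1 = 1" "g (x + y) = g x + g y" "g (z *\<^sub>C x) = z *\<^sub>C g x" "g (x * y) = g y * g x"
    "g 0 = 0" "g (- x) = - g x" "g (x - y) = g x - g y"
proof -
  show 1: "g 1 = 1" "g (x + y) = g x + g y" "g (z *\<^sub>C x) = z *\<^sub>C g x" "g (x * y) = g y * g x" for x y z
    using assms by (auto simp: alg_antihom_def)
  show 0: "g 0 = 0" using 1(2)[of 0 0] by simp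
  show minus: "g (- x) = - g x" for x using 1(2)[of x "- x"] by (simp add: 0 add_eq_0_iff)
  show "g (x - y) = g x - g y" using 1(2)[of x "- y"] by (simp add: minus)
qed

lemma alg_hom_sum: "alg_hom g \<Longrightarrow> g (\<Sum>i\<in>A. h i) = (\<Sum>i\<in>A. g (h i))"
  by (induction A rule: infinite_finite_induct) (simp_all add: alg_hom_simps)

lemma alg_hom_inv_elem:
  assumes "alg_hom g" "invertible_elem x"
  shows "g (inv_elem x) = inv_elem (g x)"
  by (rule inv_elem_unique [symmetric])
    (simp_all add: alg_hom_simps[OF assms(1), symmetric] inv_elem[OF assms(2)])

lemma alg_antihom_comp: "alg_antihom g \<Longrightarrow> alg_antihom g' \<Longrightarrow> alg_hom (g \<circ> g')"
  by (simp add: alg_hom_def alg_antihom_def)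

lemma generated_alg_0: "0 \<in> generated_alg G"
  using generated_alg.scale[OF generated_alg.one, of 0] by simp

lemma generated_alg_uminus: "x \<in> generated_alg G \<Longrightarrow> - x \<in> generated_alg G"
  using generated_alg.scale[of x G "- 1"] by (simp add: cvs.scale_minus_left scaleC_one)

lemma generated_alg_diff:
  "x \<in> generated_alg G \<Longrightarrow> y \<in> generated_alg G \<Longrightarrow> x - y \<in> generated_alg G"
  using generated_alg.add[OF _ generated_alg_uminus] by fastforce

lemma generated_alg_sum:
  "(\<And>i. i \<in> A \<Longrightarrow> f i \<in> generated_alg G) \<Longrightarrow> (\<Sum>i\<in>A. f i) \<in> generated_alg G"
  by (induction A rule: infinite_finite_induct) (auto intro: generated_alg_0 generated_alg.add)

lemma generated_alg_prod_list:
  "set xs \<subseteq> generated_alg G \<Longrightarrow> prod_list xs \<in> generated_alg G"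
  by (induction xs) (auto intro: generated_alg.one generated_alg.mult)

lemma generated_alg_subspace: "cvs.subspace (generated_alg G)"
  by (auto simp: cvs.subspace_def intro: generated_alg_0 generated_alg.add generated_alg.scale)

lemma generated_alg_hom_image:
  assumes "alg_hom g \<or> alg_antihom g" "x \<in> generated_alg G" "\<And>y. y \<in> G \<Longrightarrow> g y \<in> generated_alg G'"
  shows "g x \<in> generated_alg G'"
  using assms(2)
proof induction
  case one show ?case using assms(1) by (auto simp: alg_hom_simps alg_antihom_simps generated_alg.one)
next
  case (gen x) then show ?case using assms(3) by blast
next
  case (add x y) then show ?case using assms(1)
    by (auto simp: alg_hom_simps alg_antihom_simps intro: generated_alg.add)
next
  case (scale x z) then show ?case using assms(1)
    by (auto simp: alg_hom_simps alg_antihom_simps intro: generated_alg.scale)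
next
  case (mult x y) then show ?case using assms(1)
    by (auto simp: alg_hom_simps alg_antihom_simps intro: generated_alg.mult)
qed

text \<open>The triangular decomposition is encoded by a condition on all bases; a statement about a
  single nonzero vector enters through a basis that contains it.\<close>

lemma ex_basis_containing:
  assumes "(y::'a::complex_algebra_1) \<noteq> 0"
  obtains B where "is_basis B" "y \<in> B"
proof -
  have "cvs.independent {y}"
    using assms by (simp add: cvs.independent_insert cvs.independent_empty)
  then show thesis
    by (rule cvs.maximal_independent_subset_extend[rotated, where V = UNIV])
      (use that in \<open>auto simp: is_basis_def\<close>)
qed

section \<open>Free algebras and presentations\<close>

lemma eval_free_alt:
  assumes "finite A" "Poly_Mapping.keys p \<subseteq> A"
  shows "eval_free g p = (\<Sum>w\<in>A. Poly_Mapping.lookup p w *\<^sub>C prod_list (map g (letters w)))"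
  unfolding eval_free_def using assms
  by (intro sum.mono_neutral_left) (auto simp: in_keys_iff cvs.scale_zero_left)

lemma eval_free_single:
  "eval_free g (Poly_Mapping.single w z) = z *\<^sub>C prod_list (map g (letters w))"
  by (subst eval_free_alt[of "{w}"]) auto

lemma eval_free_add: "eval_free g (p + q) = eval_free g p + eval_free g q"
proof -
  let ?A = "Poly_Mapping.keys p \<union> Poly_Mapping.keys q"
  have "Poly_Mapping.keys (p + q) \<subseteq> ?A" by (rule Poly_Mapping.keys_add)
  then show ?thesis
    by (simp add: eval_free_alt[of ?A] lookup_add scaleC_add_left sum.distrib)
qed

lemma eval_free_0: "eval_free g 0 = 0"
  by (simp add: eval_free_def)

lemma free_alg_induct [case_names single add]:
  fixes p :: "'x free_alg"
  assumes single: "\<And>w z. P (Poly_Mapping.single w z)" and add: "\<And>p q. P p \<Longrightarrow> P q \<Longrightarrow> P (p + q)"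
  shows "P p"
proof (induction p rule: Poly_Mapping.update_induct)
  case const
  show ?case using single[of 0 0] by simp
next
  case (update f a b)
  then have "Poly_Mapping.update a b f = f + Poly_Mapping.single a b"
    by (intro poly_mapping_eqI) (auto simp: lookup_update lookup_add lookup_single in_keys_iff when_def)
  then show ?case using update.IH single add by simp
qed

lemma eval_free_mult_single:
  "eval_free g (Poly_Mapping.single w z * q) = eval_free g (Poly_Mapping.single w z) * eval_free g q"
proof (induction q rule: free_alg_induct)
  case (single k v)
  then show ?case
    by (simp add: mult_single eval_free_single plus_word_def mult_scaleC_left mult_scaleC_right
        scaleC_scaleC mult.commute)
next
  case (add f g)
  then show ?case by (simp add: distrib_left eval_free_add)
qed

lemma eval_free_mult: "eval_free g (p * q) = eval_free g p * eval_free g q"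
proof (induction p rule: free_alg_induct)
  case (single k v)
  then show ?case by (simp add: eval_free_mult_single)
next
  case (add f h)
  then show ?case by (simp add: distrib_right eval_free_add)
qed

lemma eval_free_uminus: "eval_free g (- p) = - eval_free g p"
  using eval_free_add[of g p "- p"] by (simp add: eval_free_0 add_eq_0_iff)

lemma eval_free_diff: "eval_free g (p - q) = eval_free g p - eval_free g q"
  using eval_free_add[of g p "- q"] by (simp add: eval_free_uminus)

lemma eval_free_var: "eval_free g (var x) = g x"
  by (simp add: var_def eval_free_single scaleC_one)

lemma eval_free_const: "eval_free g (const z) = z *\<^sub>C 1"
  by (simp add: const_def eval_free_single zero_word_def)

lemma eval_free_1: "eval_free g 1 = 1"
  using eval_free_const[of g 1] by (simp add: const_def scaleC_one)

lemmas eval_free_simps = eval_free_0 eval_free_1 eval_free_add eval_free_diff eval_free_mult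
  eval_free_uminus eval_free_var eval_free_const

lemma presented_by_relation:
  assumes "presented_by X Rel g" "r \<in> Rel" "r \<in> free_over X"
  shows "eval_free g r = 0"
  using assms by (auto simp: presented_by_def intro: ideal_gen.rel)

lemma free_over_closed:
  "var x \<in> free_over X \<longleftrightarrow> x \<in> X" "const z \<in> free_over X" "0 \<in> free_over X" "1 \<in> free_over X"
  "p \<in> free_over X \<Longrightarrow> q \<in> free_over X \<Longrightarrow> p + q \<in> free_over X"
  "p \<in> free_over X \<Longrightarrow> q \<in> free_over X \<Longrightarrow> p - q \<in> free_over X"
  "p \<in> free_over X \<Longrightarrow> q \<in> free_over X \<Longrightarrow> p * q \<in> free_over X"
proof -
  show "var x \<in> free_over X \<longleftrightarrow> x \<in> X" by (simp add: free_over_def var_def)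
  show "const z \<in> free_over X" by (simp add: free_over_def const_def zero_word_def)
  show "0 \<in> free_over X" by (simp add: free_over_def)
  show "1 \<in> free_over X" by (simp add: free_over_def zero_word_def)
  assume *: "p \<in> free_over X" "q \<in> free_over X"
  show "p + q \<in> free_over X" using * Poly_Mapping.keys_add[of p q] by (auto simp: free_over_def)
  show "p - q \<in> free_over X" using * keys_diff[of p q] by (fastforce simp: free_over_def)
  show "p * q \<in> free_over X" using * keys_mult[of p q]
    by (fastforce simp: free_over_def plus_word_def)
qed

lemma presented_by_generated:
  assumes "presented_by X Rel g"
  shows "generated_alg (g ` X) = UNIV"
proof -
  have "eval_free g p \<in> generated_alg (g ` X)" if "p \<in> free_over X" for p
    unfolding eval_free_def
    using that by (intro generated_alg_sum generated_alg.scale generated_alg_prod_list)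
      (auto simp: free_over_def intro: generated_alg.gen)
  then show ?thesis using assms unfolding presented_by_def
    by (metis (no_types, lifting) UNIV_eq_I imageE UNIV_I)
qed

text \<open>Every word occurring in an element of the ideal contains a word of a relation, hence has
  length at least two, whereas \<open>var x\<close> and \<open>1\<close> consist of words of length
  one and zero.\<close>

lemma presented_by_quadratic:
  fixes g :: "'x \<Rightarrow> 'a::complex_algebra_1"
  assumes pres: "presented_by UNIV Rel g"
    and quad: "\<And>r w. r \<in> Rel \<Longrightarrow> w \<in> Poly_Mapping.keys r \<Longrightarrow> 2 \<le> length (letters w)"
  shows "g x \<noteq> 0" "(1::'a) \<noteq> 0"
proof -
  have *: "\<forall>w\<in>Poly_Mapping.keys p. 2 \<le> length (letters w)" if "p \<in> ideal_gen Rel" for p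
    using that
  proof induction
    case (add p p') then show ?case using Poly_Mapping.keys_add[of p p'] by blast
  next
    case (mult p a b)
    have "Poly_Mapping.keys (a * p * b) \<subseteq> {u + v + w |u v w. v \<in> Poly_Mapping.keys p}"
      using keys_mult[of "a * p" b] keys_mult[of a p] by blast
    moreover have "2 \<le> length (letters (u + v + w))" if "v \<in> Poly_Mapping.keys p" for u v w
      using mult.IH that by (auto simp: plus_word_def intro: trans_le_add2 trans_le_add1)
    ultimately show ?case by blast
  qed (use quad in auto)
  show "g x \<noteq> 0"
  proof
    assume "g x = 0"
    then have "var x \<in> ideal_gen Rel"
      using pres by (auto simp: presented_by_def free_over_def eval_free_var)
    then show False using * by (fastforce simp: var_def)
  qed
  show "(1::'a) \<noteq> 0"
  proof
    assume "(1::'a) = 0"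
    then have "1 \<in> ideal_gen Rel"
      using pres by (auto simp: presented_by_def free_over_def eval_free_1)
    then show False using * by (fastforce simp: zero_word_def)
  qed
qed

section \<open>Powers of \<open>q\<close>\<close>

lemma qpow_0: "qpow h 0 = 1"
  and qpow_add: "qpow h (x + y) = qpow h x * qpow h y"
  and qpow_nonzero: "qpow h x \<noteq> 0"
  and qpow_minus: "qpow h (- x) = inverse (qpow h x)"
  by (simp_all add: qpow_def distrib_left exp_add exp_minus)

lemma qpow_diff: "qpow h (x - y) = qpow h x / qpow h y"
  using qpow_add[of h x "- y"] by (simp add: qpow_minus divide_inverse)

lemma qpow_of_nat_mult: "qpow h (of_nat k * x) = qpow h x ^ k"
  by (induction k) (simp_all add: qpow_0 distrib_right qpow_add)

text \<open>Raising to a power clears the denominator of \<open>x\<close>. Rationality matters: for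
  h = 2 pi i t with t irrational, q is not a root of unity, yet q^(1/t) = 1.\<close>

lemma qpow_eq_1_imp:
  assumes "not_root_of_unity h" "x \<in> \<rat>" "qpow h x = 1"
  shows "x = 0"
proof (rule ccontr)
  assume "x \<noteq> 0"
  obtain k l :: nat where "l \<noteq> 0" and kl: "\<bar>x\<bar> = real k / real l"
    using Rats_abs_nat_div_natE[OF assms(2)] by metis
  with \<open>x \<noteq> 0\<close> have "l > 0" "k > 0" by (auto intro!: Nat.gr0I)
  have "qpow h \<bar>x\<bar> = 1" using assms(3) by (simp add: abs_if qpow_minus)
  then have "qpow h (real l * \<bar>x\<bar>) = 1" by (simp add: qpow_of_nat_mult)
  then have "qpow h 1 ^ k = 1"
    using kl \<open>l > 0\<close> qpow_of_nat_mult[of h k 1] by simp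
  then show False using assms(1) \<open>k > 0\<close> by (auto simp: not_root_of_unity_def)
qed

lemma qpow_eq_imp:
  assumes "not_root_of_unity h" "x - y \<in> \<rat>" "qpow h x = qpow h y"
  shows "x = y"
  using qpow_eq_1_imp[OF assms(1,2)] assms(3) by (simp add: qpow_diff qpow_nonzero)

section \<open>Simple roots\<close>

lemma independent_sum_zero:
  fixes \<alpha> :: "nat \<Rightarrow> 'e::real_vector"
  assumes "inj_on \<alpha> {..<n}" "independent (\<alpha> ` {..<n})" "(\<Sum>i<n. x i *\<^sub>R \<alpha> i) = 0" "i < n"
  shows "x i = 0"
proof -
  let ?u = "\<lambda>v. x (inv_into {..<n} \<alpha> v)"
  have "(\<Sum>v\<in>\<alpha> ` {..<n}. ?u v *\<^sub>R v) = (\<Sum>i<n. x i *\<^sub>R \<alpha> i)"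
    using assms(1) by (subst sum.reindex) auto
  then have "?u (\<alpha> i) = 0"
    using assms by (intro independentD[OF assms(2), of "\<alpha> ` {..<n}"]) auto
  then show ?thesis using assms by simp
qed

lemma independent_sum_eq:
  fixes \<alpha> :: "nat \<Rightarrow> 'e::real_vector"
  assumes "inj_on \<alpha> {..<n}" "independent (\<alpha> ` {..<n})"
    "(\<Sum>i<n. x i *\<^sub>R \<alpha> i) = (\<Sum>i<n. y i *\<^sub>R \<alpha> i)" "i < n"
  shows "x i = y i"
  using independent_sum_zero[OF assms(1,2), of "\<lambda>i. x i - y i"] assms(3,4)
  by (simp add: scaleR_left_diff_distrib sum_subtractf)

lemma span_orthogonal:
  assumes "\<And>a b. a \<in> A \<Longrightarrow> b \<in> B \<Longrightarrow> a \<bullet> b = 0" "x \<in> span A" "y \<in> span B"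
  shows "x \<bullet> y = (0::real)"
proof -
  have "a \<bullet> y = 0" if "a \<in> A" for a
    using assms(3) by (induction rule: span_induct)
      (use that assms(1) in \<open>auto simp: subspace_def inner_add_right\<close>)
  with assms(2) show ?thesis
    by (induction rule: span_induct) (auto simp: subspace_def inner_add_left)
qed

text \<open>By induction on the height of a positive root \<open>b\<close>: reflecting \<open>b\<close> in a simple root
  \<open>\<alpha>\<^sub>i\<close> with \<open>(b, \<alpha>\<^sub>i) > 0\<close> lowers the height and changes the coefficient of \<open>\<alpha>\<^sub>i\<close> only.\<close>

lemma positive_root_support:
  fixes \<alpha> :: "nat \<Rightarrow> 'e::real_inner" and z :: "nat \<Rightarrow> nat"
  assumes rs: "root_system \<Phi>" and sr: "simple_roots \<Phi> n \<alpha>"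
    and orth: "\<And>i j. i \<in> J \<Longrightarrow> j < n \<Longrightarrow> j \<notin> J \<Longrightarrow> \<alpha> i \<bullet> \<alpha> j = 0"
  shows "(\<Sum>i<n. real (z i) *\<^sub>R \<alpha> i) \<in> \<Phi> \<Longrightarrow> (\<forall>i<n. i \<in> J \<longrightarrow> z i = 0) \<or> (\<forall>i<n. i \<notin> J \<longrightarrow> z i = 0)"
proof (induction "\<Sum>i<n. z i" arbitrary: z rule: less_induct)
  case less
  define b where "b = (\<Sum>i<n. real (z i) *\<^sub>R \<alpha> i)"
  have b: "b \<in> \<Phi>" using less.prems by (simp add: b_def)
  then have "b \<noteq> 0" using rs by (auto simp: root_system_def)
  then have "0 < b \<bullet> b" by simp
  also have "b \<bullet> b = (\<Sum>i<n. real (z i) * (\<alpha> i \<bullet> b))"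
    by (subst (1) b_def) (simp add: inner_sum_left)
  finally have "\<not> (\<forall>i\<in>{..<n}. real (z i) * (\<alpha> i \<bullet> b) \<le> 0)"
    using sum_nonpos[of "{..<n}" "\<lambda>i. real (z i) * (\<alpha> i \<bullet> b)"] by fastforce
  then obtain i where i: "i < n" "real (z i) * (\<alpha> i \<bullet> b) > 0"
    by (auto simp: not_le)
  then have zi: "z i > 0" and ib: "\<alpha> i \<bullet> b > 0" by (auto simp: zero_less_mult_iff)
  have inj: "inj_on \<alpha> {..<n}" and indep: "independent (\<alpha> ` {..<n})" and \<alpha>i: "\<alpha> i \<in> \<Phi>"
    using sr i by (auto simp: simple_roots_def)
  have ii: "\<alpha> i \<bullet> \<alpha> i > 0" using rs \<alpha>i by (auto simp: root_system_def)
  define k where "k = 2 * (\<alpha> i \<bullet> b) / (\<alpha> i \<bullet> \<alpha> i)"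
  have k: "k > 0" using ib ii by (simp add: k_def)
  define b' where "b' = reflect (\<alpha> i) b"
  have b': "b' \<in> \<Phi>" using rs \<alpha>i b by (auto simp: root_system_def b'_def)
  have b'_sum: "b' = (\<Sum>j<n. (real (z j) - (if j = i then k else 0)) *\<^sub>R \<alpha> j)"
    using i(1) by (simp add: b'_def reflect_def k_def [symmetric] b_def [symmetric]
        scaleR_left_diff_distrib sum_subtractf if_distrib[of "\<lambda>x. x *\<^sub>R _"] sum.delta cong: if_cong)
  have ib': "\<alpha> i \<bullet> b' < 0"
    using ii ib by (simp add: b'_def reflect_def inner_diff_right k_def)
  consider z' :: "nat \<Rightarrow> nat" where "b' = (\<Sum>j<n. real (z' j) *\<^sub>R \<alpha> j)"
    | z' :: "nat \<Rightarrow> nat" where "- b' = (\<Sum>j<n. real (z' j) *\<^sub>R \<alpha> j)"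
    using sr b' unfolding simple_roots_def positive_roots_def by blast
  then show ?case
  proof cases
    case 1
    have z': "real (z' j) = real (z j) - (if j = i then k else 0)" if "j < n" for j
      by (rule independent_sum_eq[OF inj indep trans[OF sym[OF 1] b'_sum] that])
    have "(\<Sum>j<n. z' j) < (\<Sum>j<n. z j)"
    proof (rule sum_strict_mono_ex1)
      show "\<forall>j\<in>{..<n}. z' j \<le> z j"
      proof
        fix j assume "j \<in> {..<n}"
        then show "z' j \<le> z j" using z'[of j] k by (auto split: if_splits)
      qed
      show "\<exists>j\<in>{..<n}. z' j < z j" using z'[of i] i(1) k by (intro bexI[of _ i]) auto
    qed simp
    from less.hyps[OF this] 1 b'
    have IH: "(\<forall>j<n. j \<in> J \<longrightarrow> z' j = 0) \<or> (\<forall>j<n. j \<notin> J \<longrightarrow> z' j = 0)" by simp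
    \<comment> \<open>This product is negative, so \<open>b'\<close> cannot be supported on the side
      away from \<open>i\<close>, all of which is orthogonal to \<open>\<alpha> i\<close>. Thus
      \<open>b'\<close> lives on the side of \<open>i\<close>, and so does \<open>b\<close>, which
      differs from it only in the coefficient at \<open>i\<close>.\<close>
    have ib'_sum: "\<alpha> i \<bullet> b' = (\<Sum>j<n. real (z' j) * (\<alpha> i \<bullet> \<alpha> j))"
      by (simp add: 1 inner_sum_right)
    show ?thesis
    proof (cases "i \<in> J")
      case True
      have "\<not> (\<forall>j<n. j \<in> J \<longrightarrow> z' j = 0)"
      proof
        assume "\<forall>j<n. j \<in> J \<longrightarrow> z' j = 0"
        then have "\<alpha> i \<bullet> b' = 0" unfolding ib'_sum using orth[OF True] by (intro sum.neutral) auto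
        then show False using ib' by simp
      qed
      then have "\<forall>j<n. j \<notin> J \<longrightarrow> z' j = 0" using IH by blast
      then show ?thesis using z' True by (metis diff_zero of_nat_eq_iff)
    next
      case False
      have "\<not> (\<forall>j<n. j \<notin> J \<longrightarrow> z' j = 0)"
      proof
        assume "\<forall>j<n. j \<notin> J \<longrightarrow> z' j = 0"
        then have "\<alpha> i \<bullet> b' = 0" unfolding ib'_sum using orth[OF _ i(1) False]
          by (intro sum.neutral) (auto simp: inner_commute)
        then show False using ib' by simp
      qed
      then have "\<forall>j<n. j \<in> J \<longrightarrow> z' j = 0" using IH by blast
      then show ?thesis using z' False by (metis diff_zero of_nat_eq_iff)
    qed
  next
    case 2
    \<comment> \<open>Now \<open>b\<close> has nonnegative and \<open>b'\<close> nonpositive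
      coefficients, but they agree away from \<open>i\<close>: \<open>b\<close> is a multiple of
      \<open>\<alpha> i\<close>.\<close>
    have "b' = (\<Sum>j<n. - real (z' j) *\<^sub>R \<alpha> j)"
      using arg_cong[OF 2, of uminus] by (simp add: sum_negf)
    from independent_sum_eq[OF inj indep trans[OF sym[OF this] b'_sum]]
    have "- real (z' j) = real (z j) - (if j = i then k else 0)" if "j < n" for j
      using that .
    then have "z j = 0" if "j < n" "j \<noteq> i" for j
      using that by fastforce
    then show ?thesis by metis
  qed
qed

text \<open>By \<open>positive_root_support\<close> every root lies in the span of \<open>J\<close>
  or of its complement, and two nonempty orthogonal parts contradict irreducibility. This is
  connectedness of the Dynkin diagram; it will spread the vanishing of one \<open>T (E s)\<close> to
  all of them.\<close>

lemma simple_roots_connected: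
  fixes \<alpha> :: "nat \<Rightarrow> 'e::real_inner"
  assumes "simple_lie_type \<Phi> n \<alpha>" and J: "J \<subseteq> {..<n}" "J \<noteq> {}"
    and orth: "\<And>i j. i \<in> J \<Longrightarrow> j < n \<Longrightarrow> j \<notin> J \<Longrightarrow> \<alpha> i \<bullet> \<alpha> j = 0"
  shows "J = {..<n}"
proof (rule ccontr)
  assume "J \<noteq> {..<n}"
  then obtain j where j: "j < n" "j \<notin> J" using J by blast
  have rs: "root_system \<Phi>" and irr: "irreducible_roots \<Phi>" and sr: "simple_roots \<Phi> n \<alpha>"
    using assms(1) by (auto simp: simple_lie_type_def)
  define J' where "J' = {..<n} - J"
  define A where "A = \<Phi> \<inter> span (\<alpha> ` J)"
  define B where "B = \<Phi> \<inter> span (\<alpha> ` J')"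
  have AB: "a \<bullet> b = 0" if "a \<in> A" "b \<in> B" for a b
    by (rule span_orthogonal[of "\<alpha> ` J" "\<alpha> ` J'"]) (use that in \<open>auto simp: A_def B_def J'_def orth\<close>)
  have pos: "b \<in> A \<union> B" if b: "b \<in> positive_roots \<Phi> n \<alpha>" for b
  proof -
    obtain z :: "nat \<Rightarrow> nat" where z: "b = (\<Sum>i<n. real (z i) *\<^sub>R \<alpha> i)" "b \<in> \<Phi>"
      using b unfolding positive_roots_def by blast
    then have "(\<Sum>i<n. real (z i) *\<^sub>R \<alpha> i) \<in> \<Phi>" by simp
    from positive_root_support[OF rs sr orth this]
    show ?thesis
    proof
      assume "\<forall>i<n. i \<in> J \<longrightarrow> z i = 0"
      then have mem: "real (z i) *\<^sub>R \<alpha> i \<in> span (\<alpha> ` J')" if "i \<in> {..<n}" for i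
        using that by (cases "z i = 0") (auto simp: span_zero J'_def intro!: span_scale[OF span_base])
      have "b \<in> span (\<alpha> ` J')" unfolding z
        by (intro span_sum) (blast intro: mem)
      then show ?thesis using z by (simp add: B_def)
    next
      assume "\<forall>i<n. i \<notin> J \<longrightarrow> z i = 0"
      then have mem: "real (z i) *\<^sub>R \<alpha> i \<in> span (\<alpha> ` J)" if "i \<in> {..<n}" for i
        using that by (cases "z i = 0") (auto simp: span_zero intro!: span_scale[OF span_base])
      have "b \<in> span (\<alpha> ` J)" unfolding z
        by (intro span_sum) (blast intro: mem)
      then show ?thesis using z by (simp add: A_def)
    qed
  qed
  have "A \<union> B = \<Phi>"
  proof (intro equalityI subsetI)
    fix b assume b: "b \<in> \<Phi>"
    then have "b \<in> positive_roots \<Phi> n \<alpha> \<or> - b \<in> positive_roots \<Phi> n \<alpha>"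
      using sr by (auto simp: simple_roots_def)
    then have "b \<in> span (\<alpha> ` J) \<or> b \<in> span (\<alpha> ` J')"
      using pos span_neg[of "- b"] by (auto simp: A_def B_def)
    then show "b \<in> A \<union> B" using b by (auto simp: A_def B_def)
  qed (auto simp: A_def B_def)
  \<comment> \<open>A common element would be orthogonal to itself, hence zero, which is not a
    root.\<close>
  moreover have "A \<inter> B = {}"
  proof -
    have False if "b \<in> A" "b \<in> B" for b
      using AB[OF that] that rs by (auto simp: root_system_def A_def)
    then show ?thesis by blast
  qed
  moreover obtain i where i: "i \<in> J" using J by blast
  then have "\<alpha> i \<in> A" "\<alpha> j \<in> B"
    using J(1) j sr by (auto simp: A_def B_def J'_def simple_roots_def intro: span_base)
  ultimately show False using irr AB unfolding irreducible_roots_def by (metis empty_iff)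
qed

lemma simple_root_facts:
  assumes "simple_lie_type \<Phi> n \<alpha>"
  shows "inj_on \<alpha> {..<n}" "independent (\<alpha> ` {..<n})" "i < n \<Longrightarrow> \<alpha> i \<in> \<Phi>" "i < n \<Longrightarrow> \<alpha> i \<bullet> \<alpha> i > 0"
    "i < n \<Longrightarrow> j < n \<Longrightarrow> cartan \<alpha> i j \<in> \<int>"
proof -
  show "inj_on \<alpha> {..<n}" "independent (\<alpha> ` {..<n})"
    using assms by (auto simp: simple_lie_type_def simple_roots_def)
  have \<Phi>: "\<alpha> i \<in> \<Phi>" if "i < n" for i
    using assms that by (auto simp: simple_lie_type_def simple_roots_def)
  then show "i < n \<Longrightarrow> \<alpha> i \<in> \<Phi>" .
  have "0 \<notin> \<Phi>" using assms by (auto simp: simple_lie_type_def root_system_def)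
  then show "i < n \<Longrightarrow> \<alpha> i \<bullet> \<alpha> i > 0" using \<Phi>[of i] by (metis inner_gt_zero_iff)
  show "i < n \<Longrightarrow> j < n \<Longrightarrow> cartan \<alpha> i j \<in> \<int>"
    using assms \<Phi>[of i] \<Phi>[of j] by (auto simp: simple_lie_type_def root_system_def cartan_def)
qed

section \<open>Complex subspaces of \<open>\<complex>\<^sup>p\<close>\<close>

lemma mat_mult_entry: "(mat z ** A) $ i $ j = z * (A :: complex^'p^'p) $ i $ j"
  by (simp add: matrix_matrix_mult_def mat_def if_distrib[of "\<lambda>x. x * _"] sum.delta cong: if_cong)

lemma mat_mult_vector: "(mat z ** A) *v x = z *s ((A :: complex^'p^'p) *v x)"
  by (simp add: vec_eq_iff matrix_vector_mult_def mat_mult_entry sum_distrib_left mult.assoc)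

text \<open>Only the operators \<open>F\<close> are applied; stability under the other generators is
  the highest weight argument below. The inductive form lets the coordinates of all vectors of a
  cyclic module be controlled step by step.\<close>

inductive_set cyclic_span :: "nat \<Rightarrow> (nat \<Rightarrow> complex^'p^'p) \<Rightarrow> complex^'p \<Rightarrow> (complex^'p) set"
  for n :: nat and F :: "nat \<Rightarrow> complex^'p^'p" and v :: "complex^'p" where
  base: "v \<in> cyclic_span n F v"
| add: "x \<in> cyclic_span n F v \<Longrightarrow> y \<in> cyclic_span n F v \<Longrightarrow> x + y \<in> cyclic_span n F v"
| scale: "x \<in> cyclic_span n F v \<Longrightarrow> z *s x \<in> cyclic_span n F v"
| act: "i < n \<Longrightarrow> x \<in> cyclic_span n F v \<Longrightarrow> F i *v x \<in> cyclic_span n F v"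

lemma cyclic_span_0: "0 \<in> cyclic_span n F v"
  using cyclic_span.scale[OF cyclic_span.base, of 0] by simp

text \<open>\<open>E i\<close> moves past each \<open>F j\<close> at the price of a Cartan term
  until it reaches \<open>v\<close> and vanishes. Abstract matrices allow two uses: for
  \<open>T\<close> itself, and for its transpose with the roles of E and F exchanged.\<close>

lemma cyclic_span_invariant:
  fixes E F K K' :: "nat \<Rightarrow> complex^'p^'p"
  assumes Ev: "\<And>i. i < n \<Longrightarrow> E i *v v = 0"
    and Kv: "\<And>i. i < n \<Longrightarrow> \<exists>s. K i *v v = s *s v" "\<And>i. i < n \<Longrightarrow> \<exists>s. K' i *v v = s *s v"
    and KF: "\<And>i j. i < n \<Longrightarrow> j < n \<Longrightarrow> \<exists>s. K i ** F j = mat s ** (F j ** K i)"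
      "\<And>i j. i < n \<Longrightarrow> j < n \<Longrightarrow> \<exists>s. K' i ** F j = mat s ** (F j ** K' i)"
    and EF: "\<And>i j. i < n \<Longrightarrow> j < n \<Longrightarrow>
      E i ** F j = F j ** E i + (if i = j then mat (t i) ** (K i - K' i) else 0)"
    and i: "i < n" and x: "x \<in> cyclic_span n F v"
  shows "K i *v x \<in> cyclic_span n F v" "K' i *v x \<in> cyclic_span n F v" "E i *v x \<in> cyclic_span n F v"
proof -
  have gen: "M *v y \<in> cyclic_span n F v"
    if Mv: "\<exists>s. M *v v = s *s v" and MF: "\<And>j. j < n \<Longrightarrow> \<exists>s. M ** F j = mat s ** (F j ** M)" and "y \<in> cyclic_span n F v"
    for M y using \<open>y \<in> _\<close>
  proof induction
    case base show ?case using Mv cyclic_span.scale[OF cyclic_span.base] by force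
  next
    case (act j x)
    obtain s where "M ** F j = mat s ** (F j ** M)" using MF act by blast
    then have "M *v (F j *v x) = s *s (F j *v (M *v x))"
      by (simp add: matrix_vector_mul_assoc mat_mult_vector)
    then show ?case using act by (auto intro: cyclic_span.intros)
  qed (auto simp: matrix_vector_right_distrib vec.scale intro: cyclic_span.intros)
  have K: "K i *v x \<in> cyclic_span n F v" "K' i *v x \<in> cyclic_span n F v"
    if "i < n" "x \<in> cyclic_span n F v" for i x
    using that Kv KF by (auto intro!: gen)
  from K[OF i x] show "K i *v x \<in> cyclic_span n F v" "K' i *v x \<in> cyclic_span n F v" .
  show "E i *v x \<in> cyclic_span n F v"
    using x
  proof induction
    case base show ?case using Ev i by (simp add: cyclic_span_0)
  next
    case (act j x)
    have "E i *v (F j *v x) = F j *v (E i *v x)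
        + (if i = j then t i *s (K i *v x + (- 1) *s (K' i *v x)) else 0)"
      using EF[OF i act(1)]
      by (simp add: matrix_vector_mul_assoc matrix_vector_mult_add_rdistrib mat_mult_vector
          matrix_vector_mult_diff_rdistrib)
    moreover have "t i *s (K i *v x + (- 1) *s (K' i *v x)) \<in> cyclic_span n F v"
      by (intro cyclic_span.scale cyclic_span.add K i act.hyps)
    ultimately show ?case
      using act by (simp only:) (auto intro!: cyclic_span.add cyclic_span.act cyclic_span_0 simp del: vector_smult_lneg)
  qed (auto simp: matrix_vector_right_distrib vec.scale intro: cyclic_span.intros)
qed

text \<open>Take a normal vector for the real inner product, which is the real part of the Hermitian
  form; conjugating its coordinates gives the bilinear pairing that is compatible with
  transposes.\<close>

lemma ex_annihilator:
  fixes W :: "(complex^'p) set"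
  assumes W: "0 \<in> W" "\<And>x y. x \<in> W \<Longrightarrow> y \<in> W \<Longrightarrow> x + y \<in> W" "\<And>z x. x \<in> W \<Longrightarrow> z *s x \<in> W"
    and "W \<noteq> UNIV"
  obtains x where "x \<noteq> 0" "\<And>w. w \<in> W \<Longrightarrow> (\<Sum>i\<in>UNIV. w $ i * x $ i) = 0"
proof -
  have scaleR: "r *\<^sub>R w = complex_of_real r *s w" for r and w :: "complex^'p"
    by (simp add: vec_eq_iff) (simp add: scaleR_conv_of_real)
  have sub: "subspace W" unfolding subspace_def using W by (auto simp: scaleR)
  then have "dim W < DIM(complex^'p)"
    using \<open>W \<noteq> UNIV\<close> dim_subset_UNIV[of W] dim_eq_full[of W] span_eq_iff[of W] by (metis le_neq_implies_less)
  then obtain y where y: "y \<noteq> 0" "\<And>w. w \<in> span W \<Longrightarrow> orthogonal y w"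
    using orthogonal_to_subspace_exists by metis
  have inner: "w \<bullet> y = Re (\<Sum>i\<in>UNIV. w $ i * cnj (y $ i))" for w
    by (simp add: inner_vec_def inner_complex_def)
  have "(\<Sum>i\<in>UNIV. w $ i * cnj (y $ i)) = 0" (is "?s w = 0") if "w \<in> W" for w
  proof -
    have "Re (?s w) = 0" using y(2)[of w] that unfolding inner [symmetric] by (simp add: span_base orthogonal_def inner_commute)
    \<comment> \<open>\<open>W\<close> is a complex subspace, so \<open>\<i> *s w\<close> supplies
      the imaginary part.\<close>
    moreover have "Re (?s (\<i> *s w)) = 0"
      using y(2)[of "\<i> *s w"] W(3)[OF that] unfolding inner [symmetric] by (simp add: span_base orthogonal_def inner_commute)
    moreover have "?s (\<i> *s w) = \<i> * ?s w" by (simp add: sum_distrib_left mult.assoc)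
    ultimately show ?thesis by (simp add: complex_eq_iff)
  qed
  then show thesis using y(1) by (intro that[of "\<chi> i. cnj (y $ i)"]) (auto simp: vec_eq_iff)
qed

section \<open>Irreducible weight modules\<close>

lemma Rats_sum: "(\<And>i. i \<in> A \<Longrightarrow> f i \<in> \<rat>) \<Longrightarrow> (\<Sum>i\<in>A. f i) \<in> \<rat>"
  by (induction A rule: infinite_finite_induct) auto

lemma reflect_inner: "x \<bullet> reflect a y = reflect a x \<bullet> y"
  by (simp add: reflect_def inner_diff_left inner_diff_right inner_commute)

lemma reflect_reflect: "reflect a (reflect a x) = x"
  by (cases "a = 0") (simp_all add: reflect_def inner_diff_right scaleR_left_diff_distrib)

lemma reflect_minus: "reflect a (- x) = - reflect a x"
  by (simp add: reflect_def)

lemma weight_lattice_closed: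
  fixes \<alpha> :: "nat \<Rightarrow> 'e::real_inner"
  shows "0 \<in> weight_lattice n \<alpha> m"
    and "x \<in> weight_lattice n \<alpha> m \<Longrightarrow> y \<in> weight_lattice n \<alpha> m \<Longrightarrow> x + y \<in> weight_lattice n \<alpha> m"
    and "x \<in> weight_lattice n \<alpha> m \<Longrightarrow> - x \<in> weight_lattice n \<alpha> m"
    and "m > 0 \<Longrightarrow> i < n \<Longrightarrow> \<alpha> i \<in> weight_lattice n \<alpha> m"
    and "x \<in> weight_lattice n \<alpha> m \<Longrightarrow> x \<in> span (\<alpha> ` {..<n})"
proof -
  show "0 \<in> weight_lattice n \<alpha> m"
    unfolding weight_lattice_def by (intro range_eqI[of _ _ "\<lambda>_. 0"]) simp
  show "x + y \<in> weight_lattice n \<alpha> m" if xy: "x \<in> weight_lattice n \<alpha> m" "y \<in> weight_lattice n \<alpha> m"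
  proof -
    obtain z z' :: "nat \<Rightarrow> int" where "x = (\<Sum>i<n. (of_int (z i) / real m) *\<^sub>R \<alpha> i)"
      "y = (\<Sum>i<n. (of_int (z' i) / real m) *\<^sub>R \<alpha> i)"
      using xy unfolding weight_lattice_def by blast
    then show ?thesis unfolding weight_lattice_def
      by (intro range_eqI[of _ _ "\<lambda>i. z i + z' i"])
        (simp add: sum.distrib [symmetric] scaleR_left_distrib [symmetric] add_divide_distrib)
  qed
  show "- x \<in> weight_lattice n \<alpha> m" if x: "x \<in> weight_lattice n \<alpha> m"
  proof -
    obtain z :: "nat \<Rightarrow> int" where "x = (\<Sum>i<n. (of_int (z i) / real m) *\<^sub>R \<alpha> i)"
      using x unfolding weight_lattice_def by blast
    then show ?thesis unfolding weight_lattice_def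
      by (intro range_eqI[of _ _ "\<lambda>i. - z i"]) (simp add: sum_negf)
  qed
  show "\<alpha> i \<in> weight_lattice n \<alpha> m" if "m > 0" "i < n"
  proof -
    have "(\<Sum>j<n. (of_int (if j = i then int m else 0) / real m) *\<^sub>R \<alpha> j) = (\<Sum>j<n. if j = i then \<alpha> j else 0)"
      using that by (intro sum.cong) auto
    also have "\<dots> = \<alpha> i" using that by simp
    finally show ?thesis unfolding weight_lattice_def by (intro range_eqI[of _ _ "\<lambda>j. if j = i then int m else 0"]) simp
  qed
  show "x \<in> span (\<alpha> ` {..<n})" if "x \<in> weight_lattice n \<alpha> m"
    using that unfolding weight_lattice_def by (auto intro!: span_sum span_scale[OF span_base])
qed

lemma weight_lattice_sum:
  "(\<And>i. i \<in> A \<Longrightarrow> f i \<in> weight_lattice n \<alpha> m) \<Longrightarrow> (\<Sum>i\<in>A. f i) \<in> weight_lattice n \<alpha> m"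
  by (induction A rule: infinite_finite_induct) (auto intro: weight_lattice_closed)

lemma weight_lattice_scale_nat:
  "x \<in> weight_lattice n \<alpha> m \<Longrightarrow> real k *\<^sub>R x \<in> weight_lattice n \<alpha> m"
  by (induction k) (auto simp: scaleR_left_distrib intro: weight_lattice_closed)

lemma weight_lattice_scale_int:
  assumes "x \<in> weight_lattice n \<alpha> m"
  shows "of_int k *\<^sub>R x \<in> weight_lattice n \<alpha> m"
proof (cases k)
  case (nonneg l)
  then show ?thesis using weight_lattice_scale_nat[OF assms, of l] by simp
next
  case (neg l)
  then show ?thesis
    using weight_lattice_closed(3)[OF weight_lattice_scale_nat[OF assms, of "Suc l"]] 
    by (simp del: of_nat_Suc)
qed

lemma uq_ext_relations:
  assumes U: "uq_ext h n \<alpha> L E F K"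
    and L: "0 \<in> L" "\<And>\<beta> \<gamma>. \<beta> \<in> L \<Longrightarrow> \<gamma> \<in> L \<Longrightarrow> \<beta> + \<gamma> \<in> L" "\<And>\<beta>. \<beta> \<in> L \<Longrightarrow> - \<beta> \<in> L" "\<And>i. i < n \<Longrightarrow> \<alpha> i \<in> L"
  shows "K 0 = 1"
    and "\<beta> \<in> L \<Longrightarrow> \<gamma> \<in> L \<Longrightarrow> K \<beta> * K \<gamma> = K (\<beta> + \<gamma>)"
    and "\<beta> \<in> L \<Longrightarrow> i < n \<Longrightarrow> K \<beta> * E i = qpow h (\<beta> \<bullet> \<alpha> i) *\<^sub>C (E i * K \<beta>)"
    and "\<beta> \<in> L \<Longrightarrow> i < n \<Longrightarrow> K \<beta> * F i = qpow h (- (\<beta> \<bullet> \<alpha> i)) *\<^sub>C (F i * K \<beta>)"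
    and "i < n \<Longrightarrow> j < n \<Longrightarrow> E i * F j - F j * E i =
      (if i = j then (1 / (qroot h (\<alpha> i) - inverse (qroot h (\<alpha> i)))) *\<^sub>C (K (\<alpha> i) - K (- \<alpha> i)) else 0)"
    and "generated_alg (E ` {..<n} \<union> F ` {..<n} \<union> K ` L) = UNIV"
proof -
  let ?X = "GE ` {..<n} \<union> GF ` {..<n} \<union> GK ` L"
  have pres: "presented_by ?X (uq_relations h n \<alpha> L) (case_uq_gen E F K)"
    using U by (simp add: uq_ext_def)
  have rel: "eval_free (case_uq_gen E F K) r = 0" if "r \<in> uq_relations h n \<alpha> L" "r \<in> free_over ?X" for r
    using presented_by_relation[OF pres that] .
  note fo = free_over_closed eval_free_simps
  have "var (GK 0) - 1 \<in> uq_relations h n \<alpha> L" by (simp add: uq_relations_def)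
  from rel[OF this] show "K 0 = 1" using L by (simp add: fo image_iff)
  show "K \<beta> * K \<gamma> = K (\<beta> + \<gamma>)" if that: "\<beta> \<in> L" "\<gamma> \<in> L"
  proof -
    have "var (GK \<beta>) * var (GK \<gamma>) - var (GK (\<beta> + \<gamma>)) \<in> uq_relations h n \<alpha> L"
      unfolding uq_relations_def using that by blast
    from rel[OF this] show ?thesis using that L(2)[OF that] by (simp add: fo image_iff)
  qed
  show "K \<beta> * E i = qpow h (\<beta> \<bullet> \<alpha> i) *\<^sub>C (E i * K \<beta>)" if "\<beta> \<in> L" "i < n"
  proof -
    have "var (GK \<beta>) * var (GE i) - const (qpow h (\<beta> \<bullet> \<alpha> i)) * var (GE i) * var (GK \<beta>) \<in> uq_relations h n \<alpha> L"
      unfolding uq_relations_def using that by blast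
    from rel[OF this] show ?thesis using that by (simp add: fo image_iff mult_scaleC_left mult.assoc)
  qed
  show "K \<beta> * F i = qpow h (- (\<beta> \<bullet> \<alpha> i)) *\<^sub>C (F i * K \<beta>)" if "\<beta> \<in> L" "i < n"
  proof -
    have "var (GK \<beta>) * var (GF i) - const (qpow h (- (\<beta> \<bullet> \<alpha> i))) * var (GF i) * var (GK \<beta>) \<in> uq_relations h n \<alpha> L"
      unfolding uq_relations_def using that by blast
    from rel[OF this] show ?thesis using that by (simp add: fo image_iff mult_scaleC_left mult.assoc)
  qed
  show "E i * F j - F j * E i =
      (if i = j then (1 / (qroot h (\<alpha> i) - inverse (qroot h (\<alpha> i)))) *\<^sub>C (K (\<alpha> i) - K (- \<alpha> i)) else 0)"
    if "i < n" "j < n"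
  proof -
    let ?r = "var (GE i) * var (GF j) - var (GF j) * var (GE i)
        - (if i = j then const (1 / (qroot h (\<alpha> i) - inverse (qroot h (\<alpha> i))))
                           * (var (GK (\<alpha> i)) - var (GK (- \<alpha> i))) else 0)"
    have "?r \<in> uq_relations h n \<alpha> L" unfolding uq_relations_def using that by blast
    from rel[OF this] show ?thesis using that L(3,4)
      by (auto simp: fo image_iff mult_scaleC_left split: if_splits)
  qed
  show "generated_alg (E ` {..<n} \<union> F ` {..<n} \<union> K ` L) = UNIV"
    using presented_by_generated[OF pres] by (simp add: image_Un image_image)
qed

lemma representation_simps:
  fixes T :: "'u::complex_algebra_1 \<Rightarrow> complex^'p^'p"
  assumes "representation T"
  shows "T 1 = mat 1" "T (x + y) = T x + T y" "T (z *\<^sub>C x) = mat z ** T x" "T (x * y) = T x ** T y"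
    "T 0 = 0" "T (- x) = - T x" "T (x - y) = T x - T y"
proof -
  show 1: "T 1 = mat 1" "T (x + y) = T x + T y" "T (z *\<^sub>C x) = mat z ** T x" "T (x * y) = T x ** T y" for x y z
    using assms by (auto simp: representation_def)
  show 0: "T 0 = 0" using 1(2)[of 0 0] by simp
  show minus: "T (- x) = - T x" for x using 1(2)[of x "- x"] by (simp add: 0 add_eq_0_iff)
  show "T (x - y) = T x - T y" using 1(2)[of x "- y"] by (simp add: minus)
qed

lemma diag_mult_entry:
  fixes A D :: "complex^'p^'p"
  assumes "\<And>i j. D $ i $ j = (if i = j then d i else 0)"
  shows "(D ** A) $ i $ j = d i * A $ i $ j" "(A ** D) $ i $ j = A $ i $ j * d j"
  by (simp_all add: matrix_matrix_mult_def assms if_distrib[of "\<lambda>x. x * _"]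
      if_distrib[of "\<lambda>x. _ * x"] cong: if_cong)

lemma mult_axis: "(A *v axis j 1) $ i = (A :: complex^'p^'p) $ i $ j"
  by (simp add: matrix_vector_mult_def axis_def if_distrib[of "\<lambda>x. _ * x"] cong: if_cong)

lemma transpose_mat_mult: "transpose (mat z ** A) = mat z ** transpose (A :: complex^'p^'p)"
  by (simp add: vec_eq_iff transpose_def mat_mult_entry)

locale uq_module =
  fixes h :: complex
    and \<Phi> :: "'e::euclidean_space set" and n m :: nat and \<alpha> :: "nat \<Rightarrow> 'e" and L :: "'e set"
    and E F :: "nat \<Rightarrow> 'u::complex_algebra_1" and K :: "'e \<Rightarrow> 'u"
    and \<tau> :: "nat \<Rightarrow> 'u \<Rightarrow> 'u" and w :: "nat list"
    and T :: "'u \<Rightarrow> complex^('p::{finite,linorder})^('p::{finite,linorder})" and \<kappa> :: "'p \<Rightarrow> 'e"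
  assumes q_generic: "not_root_of_unity h"
    and lie_type: "simple_lie_type \<Phi> n \<alpha>"
    and rational_form: "\<forall>i<n. \<forall>j<n. \<alpha> i \<bullet> \<alpha> j \<in> \<rat>"
    and m_pos: "m > 0"
    and L_def: "L = weight_lattice n \<alpha> m"
    and U: "uq_ext h n \<alpha> L E F K"
    and braid: "braid_action h n \<alpha> L E F K \<tau>"
    and longest: "reduced_longest \<Phi> n \<alpha> w"
    and irreducible: "irreducible_rep n \<alpha> E F K T"
    and weights: "weight_basis h n L E F K T \<kappa>"
begin

abbreviation "hi \<equiv> (top_index :: 'p)"

lemmas inj_\<alpha> = simple_root_facts(1)[OF lie_type]
  and indep_\<alpha> = simple_root_facts(2)[OF lie_type]
  and \<alpha>_pos = simple_root_facts(4)[OF lie_type]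
  and cartan_Ints = simple_root_facts(5)[OF lie_type]

lemma L_0: "0 \<in> L" and L_add: "\<beta> \<in> L \<Longrightarrow> \<gamma> \<in> L \<Longrightarrow> \<beta> + \<gamma> \<in> L" and L_minus: "\<beta> \<in> L \<Longrightarrow> - \<beta> \<in> L"
  and L_\<alpha>: "i < n \<Longrightarrow> \<alpha> i \<in> L" and L_span: "\<beta> \<in> L \<Longrightarrow> \<beta> \<in> span (\<alpha> ` {..<n})"
  and L_sum: "(\<And>i. i \<in> A \<Longrightarrow> f i \<in> L) \<Longrightarrow> (\<Sum>i\<in>A. f i) \<in> L"
  and L_scale: "\<beta> \<in> L \<Longrightarrow> of_int k *\<^sub>R \<beta> \<in> L"
  using m_pos unfolding L_def
  by (auto intro: weight_lattice_closed weight_lattice_sum weight_lattice_scale_int)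

lemma L_diff: "\<beta> \<in> L \<Longrightarrow> \<gamma> \<in> L \<Longrightarrow> \<beta> - \<gamma> \<in> L"
  using L_add[OF _ L_minus] by fastforce

lemma L_scale_nat: "\<beta> \<in> L \<Longrightarrow> real k *\<^sub>R \<beta> \<in> L"
  using L_scale[of \<beta> "int k"] by simp

lemma L_\<kappa>: "\<kappa> i \<in> L"
  using weights by (auto simp: weight_basis_def)

lemma L_rational: "\<beta> \<in> L \<Longrightarrow> i < n \<Longrightarrow> \<alpha> i \<bullet> \<beta> \<in> \<rat>"
  unfolding L_def weight_lattice_def using rational_form
  by (auto simp: inner_sum_right intro!: Rats_sum Rats_mult Rats_divide)

text \<open>\<open>L\<close> is the root lattice scaled by 1/m, so this is integrality of the Cartan
  matrix. It lets the braid operators act on every \<open>K \<gamma>\<close> with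
  \<open>\<gamma>\<close> in \<open>L\<close>.\<close>

lemma L_reflect: assumes "\<beta> \<in> L" "i < n" shows "reflect (\<alpha> i) \<beta> \<in> L"
proof -
  obtain z :: "nat \<Rightarrow> int" where z: "\<beta> = (\<Sum>j<n. (of_int (z j) / real m) *\<^sub>R \<alpha> j)"
    using assms unfolding L_def weight_lattice_def by blast
  have "2 * (\<alpha> i \<bullet> \<beta>) / (\<alpha> i \<bullet> \<alpha> i) = (\<Sum>j<n. of_int (z j) * cartan \<alpha> i j) / real m"
    by (simp add: z inner_sum_right cartan_def sum_distrib_left sum_divide_distrib field_simps)
  moreover have "(\<Sum>j<n. of_int (z j) * cartan \<alpha> i j) \<in> \<int>"
    using cartan_Ints assms(2) by (intro Ints_sum Ints_mult) auto
  ultimately obtain k :: int where k: "2 * (\<alpha> i \<bullet> \<beta>) / (\<alpha> i \<bullet> \<alpha> i) = of_int k / real m"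
    by (metis Ints_cases)
  have "(of_int k / real m) *\<^sub>R \<alpha> i = (\<Sum>j<n. (of_int (if j = i then k else 0) / real m) *\<^sub>R \<alpha> j)"
    using assms(2) by (simp add: if_distrib[of "\<lambda>x. (of_int x / real m) *\<^sub>R _"] cong: if_cong)
  then have "(of_int k / real m) *\<^sub>R \<alpha> i \<in> L"
    unfolding L_def weight_lattice_def by (rule range_eqI[where x = "\<lambda>j. if j = i then k else 0"])
  then show ?thesis unfolding reflect_def k using assms(1) L_diff by blast
qed

lemma span_orth_0:
  assumes "\<beta> \<in> span (\<alpha> ` {..<n})" "\<And>i. i < n \<Longrightarrow> \<alpha> i \<bullet> \<beta> = 0"
  shows "\<beta> = 0"
proof -
  have "\<beta> \<bullet> \<beta> = 0"
    by (rule span_orthogonal[OF _ assms(1) span_base, of "{\<beta>}"]) (use assms(2) in auto)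
  then show ?thesis by simp
qed

lemma K_0: "K 0 = 1"
  and K_mult: "\<beta> \<in> L \<Longrightarrow> \<gamma> \<in> L \<Longrightarrow> K \<beta> * K \<gamma> = K (\<beta> + \<gamma>)"
  and K_E: "\<beta> \<in> L \<Longrightarrow> i < n \<Longrightarrow> K \<beta> * E i = qpow h (\<beta> \<bullet> \<alpha> i) *\<^sub>C (E i * K \<beta>)"
  and K_F: "\<beta> \<in> L \<Longrightarrow> i < n \<Longrightarrow> K \<beta> * F i = qpow h (- (\<beta> \<bullet> \<alpha> i)) *\<^sub>C (F i * K \<beta>)"
  and E_F: "i < n \<Longrightarrow> j < n \<Longrightarrow> E i * F j - F j * E i =
      (if i = j then (1 / (qroot h (\<alpha> i) - inverse (qroot h (\<alpha> i)))) *\<^sub>C (K (\<alpha> i) - K (- \<alpha> i)) else 0)"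
  and U_generated: "generated_alg (E ` {..<n} \<union> F ` {..<n} \<union> K ` L) = UNIV"
  by (rule uq_ext_relations[OF U L_0 L_add L_minus L_\<alpha>]; assumption)+

lemma rep: "representation T"
  using irreducible by (simp add: irreducible_rep_def)

lemmas T_simps = representation_simps[OF rep]

lemma T_K: "\<beta> \<in> L \<Longrightarrow> T (K \<beta>) $ i $ j = (if i = j then qpow h (\<beta> \<bullet> \<kappa> i) else 0)"
  using weights by (simp add: weight_basis_def)

lemma T_E_nonzero: "k < n \<Longrightarrow> T (E k) $ i $ j \<noteq> 0 \<Longrightarrow> j < i"
  and T_F_nonzero: "k < n \<Longrightarrow> T (F k) $ i $ j \<noteq> 0 \<Longrightarrow> i < j"
  using weights by (auto simp: weight_basis_def)

lemma le_top: "i \<le> hi"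
  unfolding top_index_def by simp

lemma T_E_top: "k < n \<Longrightarrow> T (E k) $ i $ hi = 0" and T_F_top: "k < n \<Longrightarrow> T (F k) $ hi $ i = 0"
  using T_E_nonzero[of k i hi] T_F_nonzero[of k hi i] le_top[of i] by force+

text \<open>The adjoint weight, expressed by commutation with the \<open>K \<gamma>\<close> instead
  of a grading: this form passes directly through \<open>\<tau> i\<close>, a homomorphism that
  permutes the \<open>K \<gamma>\<close>.\<close>

definition has_wt :: "'u \<Rightarrow> 'e \<Rightarrow> bool" where
  "has_wt x b \<longleftrightarrow> (\<forall>\<gamma>\<in>L. K \<gamma> * x = qpow h (\<gamma> \<bullet> b) *\<^sub>C (x * K \<gamma>))"

lemma has_wt_1: "has_wt 1 0"
  by (simp add: has_wt_def qpow_0 scaleC_one)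

lemma has_wt_mult:
  assumes "has_wt x b" "has_wt y b'"
  shows "has_wt (x * y) (b + b')"
  unfolding has_wt_def
proof
  fix \<gamma> assume \<gamma>: "\<gamma> \<in> L"
  have "K \<gamma> * (x * y) = qpow h (\<gamma> \<bullet> b) *\<^sub>C (x * (K \<gamma> * y))"
    using assms(1) \<gamma> by (simp add: has_wt_def mult_scaleC_left flip: mult.assoc)
  also have "\<dots> = qpow h (\<gamma> \<bullet> (b + b')) *\<^sub>C (x * y * K \<gamma>)"
    using assms(2) \<gamma> by (simp add: has_wt_def mult_scaleC_right scaleC_scaleC mult.assoc
        inner_add_right qpow_add)
  finally show "K \<gamma> * (x * y) = qpow h (\<gamma> \<bullet> (b + b')) *\<^sub>C (x * y * K \<gamma>)" .
qed

lemma has_wt_power: "has_wt x b \<Longrightarrow> has_wt (x ^ k) (real k *\<^sub>R b)"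
  by (induction k) (simp_all add: has_wt_1 has_wt_mult scaleR_left_distrib)

lemma has_wt_prod_list:
  "(\<And>i. i \<in> set xs \<Longrightarrow> has_wt (f i) (g i)) \<Longrightarrow> has_wt (prod_list (map f xs)) (sum_list (map g xs))"
  by (induction xs) (simp_all add: has_wt_1 has_wt_mult)

lemma has_wt_E: "i < n \<Longrightarrow> has_wt (E i) (\<alpha> i)" and has_wt_F: "i < n \<Longrightarrow> has_wt (F i) (- \<alpha> i)"
  by (simp_all add: has_wt_def K_E K_F)

text \<open>Apply \<open>\<tau> i\<close> to the commutation with K of the reflected weight;
  reflections are self-adjoint involutions.\<close>

lemma has_wt_\<tau>:
  assumes "i < n" "has_wt x b"
  shows "has_wt (\<tau> i x) (reflect (\<alpha> i) b)"
  unfolding has_wt_def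
proof
  fix \<gamma> assume \<gamma>: "\<gamma> \<in> L"
  let ?\<gamma> = "reflect (\<alpha> i) \<gamma>"
  have hom: "alg_hom (\<tau> i)" and \<tau>K: "\<tau> i (K ?\<gamma>) = K \<gamma>" and L: "?\<gamma> \<in> L"
    using braid assms(1) L_reflect[OF \<gamma> assms(1)] by (auto simp: braid_action_def reflect_reflect)
  have "K \<gamma> * \<tau> i x = \<tau> i (K ?\<gamma> * x)" by (simp add: alg_hom_simps[OF hom] \<tau>K)
  also have "K ?\<gamma> * x = qpow h (?\<gamma> \<bullet> b) *\<^sub>C (x * K ?\<gamma>)" using assms(2) L by (simp add: has_wt_def)
  also have "\<tau> i \<dots> = qpow h (\<gamma> \<bullet> reflect (\<alpha> i) b) *\<^sub>C (\<tau> i x * K \<gamma>)"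
    by (simp add: alg_hom_simps[OF hom] \<tau>K reflect_inner)
  finally show "K \<gamma> * \<tau> i x = qpow h (\<gamma> \<bullet> reflect (\<alpha> i) b) *\<^sub>C (\<tau> i x * K \<gamma>)" .
qed

lemma has_wt_foldr_\<tau>:
  "set ws \<subseteq> {..<n} \<Longrightarrow> has_wt x b \<Longrightarrow> has_wt (foldr \<tau> ws x) (foldr (\<lambda>i. reflect (\<alpha> i)) ws b)"
  by (induction ws) (simp_all add: has_wt_\<tau>)

abbreviation "\<beta> \<equiv> root_seq \<alpha> w"

lemma w_less: "set w \<subseteq> {..<n}" and \<beta>_bij: "bij_betw \<beta> {..<length w} (positive_roots \<Phi> n \<alpha>)"
  using longest by (auto simp: reduced_longest_def)

lemma the_simple: "k < n \<Longrightarrow> (THE l. l < n \<and> \<alpha> k = \<alpha> l) = k"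
  using inj_\<alpha> by (auto simp: inj_on_def)

lemma root_vector_simple:
  "k < n \<Longrightarrow> \<beta> j = \<alpha> k \<Longrightarrow> root_vector n \<alpha> w \<tau> X j = X k"
  by (auto simp: root_vector_def the_simple)

lemma has_wt_root_vector:
  assumes j: "j < length w"
  shows "has_wt (root_vector n \<alpha> w \<tau> E j) (\<beta> j)" "has_wt (root_vector n \<alpha> w \<tau> F j) (- \<beta> j)"
proof -
  have wj: "w ! j < n" "set (take j w) \<subseteq> {..<n}" 
    using w_less j by (auto dest: in_set_takeD nth_mem)
  have minus: "foldr (\<lambda>i. reflect (\<alpha> i)) ws (- x) = - foldr (\<lambda>i. reflect (\<alpha> i)) ws x" for ws x
    by (induction ws) (simp_all add: reflect_minus)
  show "has_wt (root_vector n \<alpha> w \<tau> E j) (\<beta> j)"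
  proof (cases "\<exists>k<n. \<beta> j = \<alpha> k")
    case True then show ?thesis using has_wt_E by (auto simp: root_vector_simple)
  next
    case False then show ?thesis
      using has_wt_foldr_\<tau>[OF wj(2) has_wt_E[OF wj(1)]]
      unfolding root_vector_def if_not_P[OF False] by (simp add: root_seq_def)
  qed
  show "has_wt (root_vector n \<alpha> w \<tau> F j) (- \<beta> j)"
  proof (cases "\<exists>k<n. \<beta> j = \<alpha> k")
    case True then show ?thesis using has_wt_F by (auto simp: root_vector_simple)
  next
    case False then show ?thesis
      using has_wt_foldr_\<tau>[OF wj(2) has_wt_F[OF wj(1)]]
      unfolding root_vector_def if_not_P[OF False] by (simp add: root_seq_def minus)
  qed
qed

definition wt :: "nat list \<Rightarrow> 'e" where
  "wt r = (\<Sum>j<length w. real (r ! j) *\<^sub>R \<beta> j)"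

lemma has_wt_root_monomial:
  "has_wt (root_monomial n \<alpha> w \<tau> E r) (wt r)" "has_wt (root_monomial n \<alpha> w \<tau> F r) (- wt r)"
proof -
  have wt: "wt r = sum_list (map (\<lambda>j. real (r ! j) *\<^sub>R \<beta> j) [0..<length w])"
    by (simp add: wt_def interv_sum_list_conv_sum_set_nat atLeast0LessThan)
  have minus: "- wt r = sum_list (map (\<lambda>j. real (r ! j) *\<^sub>R (- \<beta> j)) [0..<length w])"
    by (simp add: wt_def interv_sum_list_conv_sum_set_nat atLeast0LessThan sum_negf)
  show "has_wt (root_monomial n \<alpha> w \<tau> E r) (wt r)"
    unfolding wt root_monomial_def by (intro has_wt_prod_list has_wt_power has_wt_root_vector) auto
  show "has_wt (root_monomial n \<alpha> w \<tau> F r) (- wt r)"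
    unfolding minus root_monomial_def by (intro has_wt_prod_list has_wt_power has_wt_root_vector) auto
qed

lemma positive_root_L: "b \<in> positive_roots \<Phi> n \<alpha> \<Longrightarrow> b \<in> L"
  by (auto simp: positive_roots_def intro!: L_sum L_scale_nat L_\<alpha>)

lemma \<beta>_positive: "j < length w \<Longrightarrow> \<beta> j \<in> positive_roots \<Phi> n \<alpha>"
  using \<beta>_bij by (auto simp: bij_betw_def)

lemma wt_L: "wt r \<in> L"
  unfolding wt_def by (intro L_sum L_scale_nat positive_root_L \<beta>_positive) auto

text \<open>Comparing matrix entries only equates powers of q. The exponents are rational and q is
  no root of unity, so both weights have the same product with every simple root; their difference
  lies in the span of the simple roots and is therefore zero.\<close>

lemma T_has_wt:
  assumes x: "has_wt x b" and b: "b \<in> L" and nonzero: "T x $ i $ j \<noteq> 0"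
  shows "\<kappa> i = \<kappa> j + b"
proof -
  have "\<alpha> s \<bullet> (\<kappa> i - \<kappa> j - b) = 0" if s: "s < n" for s
  proof (rule qpow_eq_1_imp[OF q_generic])
    show "\<alpha> s \<bullet> (\<kappa> i - \<kappa> j - b) \<in> \<rat>" using b s by (intro L_rational L_diff L_\<kappa>)
    have "T (K (\<alpha> s) * x) = T (qpow h (\<alpha> s \<bullet> b) *\<^sub>C (x * K (\<alpha> s)))"
      using x s by (simp add: has_wt_def L_\<alpha>)
    then have "T (K (\<alpha> s) * x) $ i $ j = T (qpow h (\<alpha> s \<bullet> b) *\<^sub>C (x * K (\<alpha> s))) $ i $ j" by simp
    then have "qpow h (\<alpha> s \<bullet> \<kappa> i) * T x $ i $ j = qpow h (\<alpha> s \<bullet> b) * (T x $ i $ j * qpow h (\<alpha> s \<bullet> \<kappa> j))"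
      by (simp only: T_simps mat_mult_entry diag_mult_entry[OF T_K[OF L_\<alpha>[OF s]]])
    then show "qpow h (\<alpha> s \<bullet> (\<kappa> i - \<kappa> j - b)) = 1"
      using nonzero by (simp add: inner_diff_right qpow_diff qpow_nonzero)
  qed
  moreover have "\<kappa> i - \<kappa> j - b \<in> span (\<alpha> ` {..<n})"
    using b by (intro L_span L_diff L_\<kappa>)
  ultimately have "\<kappa> i - \<kappa> j - b = 0" using span_orth_0 by blast
  then show ?thesis by (simp add: algebra_simps)
qed

lemma T_E_wt: "s < n \<Longrightarrow> T (E s) $ i $ j \<noteq> 0 \<Longrightarrow> \<kappa> i = \<kappa> j + \<alpha> s"
  using T_has_wt[OF has_wt_E L_\<alpha>] .

lemma T_F_wt: "s < n \<Longrightarrow> T (F s) $ i $ j \<noteq> 0 \<Longrightarrow> \<kappa> j = \<kappa> i + \<alpha> s"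
  using T_has_wt[OF has_wt_F L_minus[OF L_\<alpha>], of s i j] by simp

lemma T_monomial_E_wt: "T (root_monomial n \<alpha> w \<tau> E r) $ i $ j \<noteq> 0 \<Longrightarrow> \<kappa> i = \<kappa> j + wt r"
  using T_has_wt[OF has_wt_root_monomial(1) wt_L] .

lemma T_monomial_F_wt: "T (root_monomial n \<alpha> w \<tau> F r) $ i $ j \<noteq> 0 \<Longrightarrow> \<kappa> j = \<kappa> i + wt r"
  using T_has_wt[OF has_wt_root_monomial(2) L_minus[OF wt_L], of r i j] by simp

section \<open>Cyclicity of the highest weight vector and of its dual\<close>

lemma invariant_UNIV:
  assumes "0 \<in> W" "\<And>x y. x \<in> W \<Longrightarrow> y \<in> W \<Longrightarrow> x + y \<in> W" "\<And>z x. x \<in> W \<Longrightarrow> z *s x \<in> W"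
    "\<And>i x. i < n \<Longrightarrow> x \<in> W \<Longrightarrow> T (E i) *v x \<in> W" "\<And>i x. i < n \<Longrightarrow> x \<in> W \<Longrightarrow> T (F i) *v x \<in> W"
    "\<And>i x. i < n \<Longrightarrow> x \<in> W \<Longrightarrow> T (K (\<alpha> i)) *v x \<in> W" "\<And>i x. i < n \<Longrightarrow> x \<in> W \<Longrightarrow> T (K (- \<alpha> i)) *v x \<in> W"
  shows "W = {0} \<or> W = UNIV"
proof -
  have "\<forall>W. 0 \<in> W \<and> (\<forall>x\<in>W. \<forall>y\<in>W. x + y \<in> W) \<and> (\<forall>z. \<forall>x\<in>W. z *s x \<in> W) \<and>
          (\<forall>i<n. \<forall>x\<in>W. T (E i) *v x \<in> W \<and> T (F i) *v x \<in> W \<and>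
                         T (K (\<alpha> i)) *v x \<in> W \<and> T (K (- \<alpha> i)) *v x \<in> W)
        \<longrightarrow> W = {0} \<or> W = UNIV"
    using irreducible unfolding irreducible_rep_def by (rule conjunct2)
  from spec[OF this, of W] show ?thesis using assms by simp
qed

lemma T_K_axis:
  assumes "\<gamma> \<in> L"
  shows "T (K \<gamma>) *v axis i 1 = qpow h (\<gamma> \<bullet> \<kappa> i) *s axis i 1"
    "transpose (T (K \<gamma>)) *v axis i 1 = qpow h (\<gamma> \<bullet> \<kappa> i) *s axis i 1"
  using assms by (simp_all add: vec_eq_iff mult_axis T_K transpose_def) (simp_all add: axis_def)

definition "cs s = qroot h (\<alpha> s) - inverse (qroot h (\<alpha> s))"

lemma cs_nonzero: assumes s: "s < n" shows "cs s \<noteq> 0"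
proof
  assume "cs s = 0"
  then have "qpow h (\<alpha> s \<bullet> \<alpha> s / 2) = qpow h (- (\<alpha> s \<bullet> \<alpha> s / 2))"
    by (simp add: cs_def qroot_def qpow_minus)
  then have "\<alpha> s \<bullet> \<alpha> s / 2 = - (\<alpha> s \<bullet> \<alpha> s / 2)"
    using rational_form s by (intro qpow_eq_imp[OF q_generic]) auto
  then show False using \<alpha>_pos[OF s] by simp
qed

abbreviation "t s \<equiv> 1 / cs s"

lemma T_E_F:
  assumes "i < n" "j < n"
  shows "T (E i) ** T (F j) = T (F j) ** T (E i)
    + (if i = j then mat (t i) ** (T (K (\<alpha> i)) - T (K (- \<alpha> i))) else 0)"
proof -
  have "T (E i * F j - F j * E i) = T (if i = j then t i *\<^sub>C (K (\<alpha> i) - K (- \<alpha> i)) else 0)"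
    using assms by (simp add: E_F cs_def)
  then have "T (E i) ** T (F j) - T (F j) ** T (E i)
    = (if i = j then mat (t i) ** (T (K (\<alpha> i)) - T (K (- \<alpha> i))) else 0)"
    by (simp add: T_simps split: if_splits)
  then show ?thesis by (simp only: diff_eq_eq add.commute)
qed

text \<open>No index lies above the top one, so every \<open>T (E i)\<close> kills the top basis
  vector and the highest weight argument applies.\<close>

lemma cyclic_F: "cyclic_span n (\<lambda>i. T (F i)) (axis hi 1) = UNIV"
proof -
  let ?W = "cyclic_span n (\<lambda>i. T (F i)) (axis hi 1)"
  have KF: "\<exists>s. T (K \<gamma>) ** T (F j) = mat s ** (T (F j) ** T (K \<gamma>))" if "\<gamma> \<in> L" "j < n" for \<gamma> j
    using K_F[OF that] by (metis T_simps(3,4))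
  have Ev: "T (E i) *v axis hi 1 = 0" if "i < n" for i
    using T_E_top[OF that] by (simp add: vec_eq_iff mult_axis)
  have Kv: "\<exists>s. T (K \<gamma>) *v axis hi 1 = s *s axis hi 1" if "\<gamma> \<in> L" for \<gamma>
    using T_K_axis(1)[OF that] by blast
  have "T (K (\<alpha> i)) *v x \<in> ?W" "T (K (- \<alpha> i)) *v x \<in> ?W" "T (E i) *v x \<in> ?W"
    if i: "i < n" and x: "x \<in> ?W" for i x
    using cyclic_span_invariant[where E = "\<lambda>i. T (E i)" and K = "\<lambda>i. T (K (\<alpha> i))"
          and K' = "\<lambda>i. T (K (- \<alpha> i))" and t = "\<lambda>s. t s",
        OF Ev Kv[OF L_\<alpha>] Kv[OF L_minus[OF L_\<alpha>]] KF[OF L_\<alpha>] KF[OF L_minus[OF L_\<alpha>]] T_E_F i x]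
    by blast+
  then have "?W = {0} \<or> ?W = UNIV"
    by (intro invariant_UNIV) (auto intro: cyclic_span.intros cyclic_span_0)
  moreover have "axis hi 1 \<in> ?W" "axis hi (1::complex) \<noteq> 0" 
    by (auto intro: cyclic_span.base)
  ultimately show ?thesis by blast
qed

text \<open>The dual statement, where irreducibility of the transposed module is not given. Instead,
  the annihilator of the cyclic span is a submodule of V that misses the highest weight vector,
  hence zero. This is what lets e^p generate all e^i.\<close>

lemma cyclic_E_transpose: "cyclic_span n (\<lambda>i. transpose (T (E i))) (axis hi 1) = UNIV"
proof -
  let ?W = "cyclic_span n (\<lambda>i. transpose (T (E i))) (axis hi 1)"
  have KE: "\<exists>s. transpose (T (K \<gamma>)) ** transpose (T (E j)) = mat s ** (transpose (T (E j)) ** transpose (T (K \<gamma>)))"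
    if "\<gamma> \<in> L" "j < n" for \<gamma> j
  proof -
    have "E j * K \<gamma> = inverse (qpow h (\<gamma> \<bullet> \<alpha> j)) *\<^sub>C (K \<gamma> * E j)"
      using K_E[OF that] by (simp add: scaleC_scaleC qpow_nonzero scaleC_one)
    then have "T (E j) ** T (K \<gamma>) = mat (inverse (qpow h (\<gamma> \<bullet> \<alpha> j))) ** (T (K \<gamma>) ** T (E j))"
      by (metis T_simps(3,4))
    then show ?thesis by (metis matrix_transpose_mul transpose_mat_mult)
  qed
  have EF: "transpose (T (F i)) ** transpose (T (E j)) = transpose (T (E j)) ** transpose (T (F i)) +
      (if i = j then mat (t i) ** (transpose (T (K (\<alpha> i))) - transpose (T (K (- \<alpha> i)))) else 0)"
    if "i < n" "j < n" for i j
  proof -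
    have "transpose (T (E j) ** T (F i)) = transpose (T (F i) ** T (E j)) +
        transpose (if j = i then mat (t j) ** (T (K (\<alpha> j)) - T (K (- \<alpha> j))) else 0)"
      by (simp add: T_E_F[OF that(2,1)] vec_eq_iff transpose_def)
    also have "transpose (if j = i then mat (t j) ** (T (K (\<alpha> j)) - T (K (- \<alpha> j))) else 0) =
        (if i = j then mat (t i) ** (transpose (T (K (\<alpha> i))) - transpose (T (K (- \<alpha> i)))) else 0)"
      by (auto simp: vec_eq_iff transpose_def mat_mult_entry)
    finally show ?thesis by (simp add: matrix_transpose_mul)
  qed
  have F_top: "transpose (T (F i)) *v axis hi 1 = 0" if "i < n" for i
    using T_F_top[OF that] by (simp add: vec_eq_iff mult_axis transpose_def)
  have Kv: "\<exists>s. transpose (T (K \<gamma>)) *v axis hi 1 = s *s axis hi 1" if "\<gamma> \<in> L" for \<gamma>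
    using T_K_axis(2)[OF that] by blast
  have inv: "transpose (T (K (\<alpha> i))) *v x \<in> ?W" "transpose (T (K (- \<alpha> i))) *v x \<in> ?W"
      "transpose (T (F i)) *v x \<in> ?W"
    if i: "i < n" and x: "x \<in> ?W" for i x
    using cyclic_span_invariant[where E = "\<lambda>i. transpose (T (F i))" and K = "\<lambda>i. transpose (T (K (\<alpha> i)))"
          and K' = "\<lambda>i. transpose (T (K (- \<alpha> i)))" and t = "\<lambda>s. t s",
        OF F_top Kv[OF L_\<alpha>] Kv[OF L_minus[OF L_\<alpha>]] KE[OF L_\<alpha>] KE[OF L_minus[OF L_\<alpha>]] EF i x]
    by blast+
  show ?thesis
  proof (rule ccontr)
    assume neq: "?W \<noteq> UNIV"
    have "\<exists>x :: (complex, 'p) vec. x \<noteq> 0 \<and> (\<forall>v\<in>?W. (\<Sum>i\<in>UNIV. v $ i * x $ i) = 0)"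
      by (rule ex_annihilator[of ?W, OF cyclic_span_0 cyclic_span.add cyclic_span.scale neq])
        (assumption | blast)+
    then obtain x :: "(complex, 'p) vec" where x: "x \<noteq> 0" "\<And>v. v \<in> ?W \<Longrightarrow> (\<Sum>i\<in>UNIV. v $ i * x $ i) = 0"
      by blast
    define N where "N = {x :: (complex, 'p) vec. \<forall>v\<in>?W. (\<Sum>i\<in>UNIV. v $ i * x $ i) = 0}"
    have adj: "(\<Sum>i\<in>UNIV. v $ i * (A *v y) $ i) = (\<Sum>i\<in>UNIV. (transpose A *v v) $ i * y $ i)"
      for A :: "((complex, 'p) vec, 'p) vec" and v y
      by (simp add: matrix_vector_mult_def transpose_def sum_distrib_left sum_distrib_right)
        (subst sum.swap, simp add: ac_simps)
    have N: "A *v y \<in> N" if "y \<in> N" "\<And>v. v \<in> ?W \<Longrightarrow> transpose A *v v \<in> ?W" for A y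
      using that by (simp add: N_def adj)
    have "N = {0} \<or> N = UNIV"
    proof (rule invariant_UNIV)
      show "y + z \<in> N" if "y \<in> N" "z \<in> N" for y z
        using that by (simp add: N_def distrib_left sum.distrib)
      show "z *s y \<in> N" if "y \<in> N" for y z
      proof -
        have "(\<Sum>i\<in>UNIV. v $ i * (z *s y) $ i) = z * (\<Sum>i\<in>UNIV. v $ i * y $ i)" for v
          by (simp add: sum_distrib_left ac_simps)
        then show ?thesis using that by (simp add: N_def)
      qed
      show "0 \<in> N" by (simp add: N_def)
    qed (rule N, assumption, (rule inv cyclic_span.act; assumption))+
    moreover have "x \<in> N" using x by (simp add: N_def)
    moreover have "axis hi 1 \<notin> N"
    proof -
      have "(\<Sum>i\<in>UNIV. axis hi 1 $ i * axis hi 1 $ i) = (1::complex)"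
        by (simp add: axis_def if_distrib[of "\<lambda>x. x * _"] cong: if_cong)
      then show ?thesis unfolding N_def using cyclic_span.base by fastforce
    qed
    ultimately show False using x(1) by auto
  qed
qed

end

lemma prod_list_map_neutral:
  "(\<And>i. i \<in> set xs \<Longrightarrow> f i = (1::'a::monoid_mult)) \<Longrightarrow> prod_list (map f xs) = 1"
  by (induction xs) auto

lemma prod_list_single:
  assumes "\<And>i. i \<in> set xs \<Longrightarrow> i \<noteq> j \<Longrightarrow> f i = (1::'a::monoid_mult)" "distinct xs" "j \<in> set xs"
  shows "prod_list (map f xs) = f j"
proof -
  obtain ys zs where "xs = ys @ j # zs" using assms(3) by (meson split_list)
  moreover from this have "prod_list (map f ys) = 1" "prod_list (map f zs) = 1"
    using assms(1,2) by (auto intro!: prod_list_map_neutral)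
  ultimately show ?thesis by simp
qed

context uq_module
begin

section \<open>Entries of R-matrices and L-operators\<close>

text \<open>The height, extended linearly to the whole space, which the simple roots need not span.
  It is evaluated only on elements of \<open>L\<close>, where it is determined.\<close>

definition ht :: "'e \<Rightarrow> real" where
  "ht = (SOME g. linear g \<and> (\<forall>x\<in>\<alpha> ` {..<n}. g x = 1))"

lemma linear_ht: "linear ht" and ht_\<alpha>: "i < n \<Longrightarrow> ht (\<alpha> i) = 1"
proof -
  have "\<exists>g :: 'e \<Rightarrow> real. linear g \<and> (\<forall>x\<in>\<alpha> ` {..<n}. g x = 1)"
    using linear_independent_extend[OF indep_\<alpha>, of "\<lambda>_. 1"] by blast
  from someI_ex[OF this] show "linear ht" "i < n \<Longrightarrow> ht (\<alpha> i) = 1"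
    unfolding ht_def by auto
qed

lemmas ht_add = linear_add[OF linear_ht] and ht_scale = linear_scale[OF linear_ht]
  and ht_sum = linear_sum[OF linear_ht]

text \<open>Each \<open>F s\<close> lowers the height by one, and from the top vector these
  operators reach everything. Heights rather than indices are compared because the terms of the
  quasi-R-matrix are sorted by weight.\<close>

lemma ht_\<kappa>_le_top: "ht (\<kappa> j) \<le> ht (\<kappa> hi)"
proof -
  have "\<forall>j. x $ j \<noteq> 0 \<longrightarrow> ht (\<kappa> j) \<le> ht (\<kappa> hi)"
    if "x \<in> cyclic_span n (\<lambda>i. T (F i)) (axis hi 1)" for x
    using that
  proof induction
    case base show ?case by (simp add: axis_def)
  next
    case (act s x)
    show ?case
    proof (intro allI impI)
      fix j assume "(T (F s) *v x) $ j \<noteq> 0"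
      then have "(\<Sum>k\<in>UNIV. T (F s) $ j $ k * x $ k) \<noteq> 0" by (simp add: matrix_vector_mult_def)
      then obtain k where "T (F s) $ j $ k * x $ k \<noteq> 0"
        by (rule sum.not_neutral_contains_not_neutral)
      then have "\<kappa> k = \<kappa> j + \<alpha> s" "ht (\<kappa> k) \<le> ht (\<kappa> hi)"
        using act T_F_wt by auto
      then show "ht (\<kappa> j) \<le> ht (\<kappa> hi)"
        using act(1) by (simp add: ht_add ht_\<alpha>)
    qed
  next
    case (add x y)
    then show ?case by (metis add_0 vector_add_component)
  qed auto
  from this[of "axis j 1", unfolded cyclic_F] show ?thesis by (simp add: axis_def)
qed

text \<open>On the basis vector of index \<open>j\<close> the Cartan term acts by a nonzero multiple
  of q^x - q^(-x) with x = \<open>\<alpha> s \<bullet> \<kappa> j\<close>, and this vanishes only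
  for x = 0.\<close>

lemma orth_if_commute:
  assumes s: "s < n" and eq: "mat (t s) ** (T (K (\<alpha> s)) - T (K (- \<alpha> s))) = 0"
  shows "\<alpha> s \<bullet> \<kappa> j = 0"
proof -
  from arg_cong[OF eq, of "\<lambda>A. A $ j $ j"]
  have "qpow h (\<alpha> s \<bullet> \<kappa> j) = qpow h (- (\<alpha> s \<bullet> \<kappa> j))"
    using cs_nonzero[OF s] s by (simp add: mat_mult_entry T_K L_\<alpha> L_minus)
  then have "\<alpha> s \<bullet> \<kappa> j = - (\<alpha> s \<bullet> \<kappa> j)"
    using L_rational[OF L_\<kappa> s] by (intro qpow_eq_imp[OF q_generic]) auto
  then show ?thesis by simp
qed

text \<open>The simple roots in \<open>J\<close> are orthogonal to all weights of V, hence also to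
  each \<open>\<alpha> l\<close> with \<open>T (E l) \<noteq> 0\<close>, a difference of two
  weights. By connectedness \<open>J\<close> is everything, so all weights vanish, every
  \<open>F s\<close> acts as zero, and the cyclic top vector spans V.\<close>

lemma trivial_module:
  assumes "s < n" "T (E s) = 0"
  shows "\<kappa> j = 0" "j = hi"
proof -
  define J where "J = {s. s < n \<and> T (E s) = 0}"
  have orth: "\<alpha> s \<bullet> \<kappa> j = 0" if s: "s \<in> J" for s j
  proof -
    have s: "s < n" "T (E s) = 0" using s by (auto simp: J_def)
    then have "mat (t s) ** (T (K (\<alpha> s)) - T (K (- \<alpha> s))) = 0"
      using T_E_F[OF s(1) s(1)] by simp
    then show ?thesis by (rule orth_if_commute[OF s(1)])
  qed
  have "J = {..<n}"
  proof (rule simple_roots_connected[OF lie_type])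
    show "J \<subseteq> {..<n}" "J \<noteq> {}" using assms by (auto simp: J_def)
    fix s l assume sl: "s \<in> J" "l < n" "l \<notin> J"
    then have "T (E l) \<noteq> 0" by (simp add: J_def)
    then obtain i k where "T (E l) $ i $ k \<noteq> 0" by (auto simp: vec_eq_iff)
    then have "\<kappa> i = \<kappa> k + \<alpha> l" by (rule T_E_wt[OF sl(2)])
    then have "\<alpha> s \<bullet> \<kappa> i = \<alpha> s \<bullet> \<kappa> k + \<alpha> s \<bullet> \<alpha> l" by (simp add: inner_add_right)
    then show "\<alpha> s \<bullet> \<alpha> l = 0" using orth[OF sl(1)] by simp
  qed
  then show \<kappa>: "\<kappa> j = 0" for j using orth by (intro span_orth_0 L_span L_\<kappa>) auto
  have F: "T (F s) $ i $ j = 0" if "s < n" for s i j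
    using T_F_wt[OF that, of i j] \<alpha>_pos[OF that] \<kappa> by auto
  have "\<forall>j. j \<noteq> hi \<longrightarrow> x $ j = 0"
    if "x \<in> cyclic_span n (\<lambda>i. T (F i)) (axis hi 1)" for x
    using that by induction (auto simp: axis_def matrix_vector_mult_def F)
  from this[of "axis j 1", unfolded cyclic_F] show "j = hi" by (auto simp: axis_def split: if_splits)
qed

text \<open>With \<open>T (F s) = 0\<close> the Cartan term would vanish and all weights would be
  orthogonal to \<open>\<alpha> s\<close>, although \<open>E s\<close> shifts one of them by
  \<open>\<alpha> s\<close> itself.\<close>

lemma T_F_nonzero_if:
  assumes s: "s < n" and E: "T (E s) \<noteq> 0"
  shows "T (F s) \<noteq> 0"
proof
  assume "T (F s) = 0"
  then have *: "mat (t s) ** (T (K (\<alpha> s)) - T (K (- \<alpha> s))) = 0"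
    using T_E_F[OF s s] by simp
  have orth: "\<alpha> s \<bullet> \<kappa> j = 0" for j by (rule orth_if_commute[OF s *])
  obtain i k where "T (E s) $ i $ k \<noteq> 0" using E by (auto simp: vec_eq_iff)
  then have "\<alpha> s \<bullet> \<kappa> i = \<alpha> s \<bullet> \<kappa> k + \<alpha> s \<bullet> \<alpha> s" using T_E_wt[OF s] by (simp add: inner_add_right)
  then show False using orth \<alpha>_pos[OF s] by simp
qed

section \<open>Terms of height zero and one in the quasi-R-matrix\<close>

abbreviation "r0 \<equiv> replicate (length w) (0::nat)"

text \<open>The place of a simple root in the enumeration of the positive roots by the reduced word.
  The tuple \<open>unit s\<close> then stands for the single term in \<open>E s\<close> and
  \<open>F s\<close>.\<close>

definition "pos s = (THE j. j < length w \<and> \<beta> j = \<alpha> s)"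
abbreviation "unit s \<equiv> r0[pos s := 1]"

lemma simple_positive: assumes "s < n" shows "\<alpha> s \<in> positive_roots \<Phi> n \<alpha>"
proof -
  have "\<alpha> s = (\<Sum>i<n. real (if i = s then 1 else 0) *\<^sub>R \<alpha> i)"
    using assms by (simp add: if_distrib[of "\<lambda>x. real x *\<^sub>R _"] cong: if_cong)
  moreover have "\<alpha> s \<in> \<Phi>" using simple_root_facts(3)[OF lie_type assms] .
  ultimately show ?thesis unfolding positive_roots_def
    by (auto intro!: exI[of _ "\<lambda>i. if i = s then 1 else 0"])
qed

lemma pos: assumes "s < n" shows "pos s < length w" "\<beta> (pos s) = \<alpha> s"
proof -
  have inj: "inj_on \<beta> {..<length w}" and "\<beta> ` {..<length w} = positive_roots \<Phi> n \<alpha>"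
    using \<beta>_bij by (auto simp: bij_betw_def)
  then obtain j where "j < length w" "\<beta> j = \<alpha> s"
    using simple_positive[OF assms] by (metis imageE lessThan_iff)
  then have "\<exists>!j. j < length w \<and> \<beta> j = \<alpha> s"
    using inj by (intro ex1I[of _ j]) (auto simp: inj_on_def)
  from theI'[OF this] show "pos s < length w" "\<beta> (pos s) = \<alpha> s" by (auto simp: pos_def)
qed

lemma \<beta>_ht:
  assumes "j < length w"
  shows "\<exists>k. k > 0 \<and> ht (\<beta> j) = real k \<and> (k = 1 \<longrightarrow> (\<exists>s<n. \<beta> j = \<alpha> s))"
proof -
  obtain z :: "nat \<Rightarrow> nat" where z: "\<beta> j = (\<Sum>i<n. real (z i) *\<^sub>R \<alpha> i)" and "\<beta> j \<in> \<Phi>"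
    using \<beta>_positive[OF assms] unfolding positive_roots_def by blast
  then have "\<beta> j \<noteq> 0" using lie_type by (auto simp: simple_lie_type_def root_system_def)
  have ht: "ht (\<beta> j) = real (\<Sum>i<n. z i)" by (simp add: z ht_sum ht_scale ht_\<alpha>)
  have "0 < (\<Sum>i<n. z i)"
  proof (rule gr0I)
    assume "(\<Sum>i<n. z i) = 0"
    then have "\<beta> j = 0" by (simp add: z)
    then show False using \<open>\<beta> j \<noteq> 0\<close> by simp
  qed
  moreover have "\<exists>s<n. \<beta> j = \<alpha> s" if sum1: "(\<Sum>i<n. z i) = 1"
  proof -
    obtain s where s: "s < n" "z s = 1" "\<And>i. i < n \<Longrightarrow> i \<noteq> s \<Longrightarrow> z i = 0"
      using iffD1[OF sum_eq_1_iff[OF finite_lessThan] sum1] by auto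
    have "\<beta> j = (\<Sum>i<n. if i = s then \<alpha> i else 0)"
      unfolding z by (intro sum.cong) (auto simp: s)
    then show ?thesis using s(1) by auto
  qed
  ultimately show ?thesis using ht by blast
qed

lemma length_X: "r \<in> exponents (length w) CARD('p) \<Longrightarrow> length r = length w"
  by (simp add: exponents_def)

text \<open>Positive roots have positive integral height, and height one only if simple. So a tuple
  of total height one consists of a single exponent 1 at a simple root.\<close>

lemma wt_ht:
  assumes "r \<in> exponents (length w) CARD('p)"
  shows "\<exists>N. ht (wt r) = real N \<and> (N = 0 \<longrightarrow> r = r0) \<and> (N = 1 \<longrightarrow> (\<exists>s<n. r = unit s))"
proof -
  from \<beta>_ht obtain k where k: "\<And>j. j < length w \<Longrightarrow> k j > 0" "\<And>j. j < length w \<Longrightarrow> ht (\<beta> j) = real (k j)"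
    "\<And>j. j < length w \<Longrightarrow> k j = 1 \<Longrightarrow> \<exists>s<n. \<beta> j = \<alpha> s"
    by metis
  let ?N = "\<Sum>j<length w. r ! j * k j"
  have N: "ht (wt r) = real ?N" by (simp add: wt_def ht_sum ht_scale k)
  have N0: "r = r0" if "?N = 0"
  proof (rule nth_equalityI)
    fix j assume j: "j < length r"
    then have "r ! j * k j = 0" using that length_X[OF assms] by simp
    then show "r ! j = r0 ! j" using j k(1)[of j] length_X[OF assms] by simp
  qed (simp add: length_X[OF assms])
  have N1: "\<exists>s<n. r = unit s" if sum1: "?N = 1"
  proof -
    obtain j where j: "j < length w" "r ! j * k j = 1" "\<And>i. i < length w \<Longrightarrow> i \<noteq> j \<Longrightarrow> r ! i * k i = 0"
      using iffD1[OF sum_eq_1_iff[OF finite_lessThan] sum1] by auto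
    then obtain s where s: "s < n" "\<beta> j = \<alpha> s" using k(3) by auto
    then have "pos s = j"
      using pos[OF s(1)] \<beta>_bij j(1) by (auto simp: bij_betw_def inj_on_def)
    have "r = unit s"
    proof (rule nth_equalityI)
      fix i assume i: "i < length r"
      then show "r ! i = unit s ! i"
        using j(1,2) j(3)[of i] k(1)[of i] length_X[OF assms] by (cases "i = j") (auto simp: \<open>pos s = j\<close>)
    qed (simp add: length_X[OF assms])
    then show ?thesis using s by blast
  qed
  show ?thesis by (intro exI[of _ ?N] conjI impI N N0 N1)
qed

lemma wt_r0: "wt r0 = 0"
  by (simp add: wt_def)

lemma wt_unit:
  assumes "s < n"
  shows "wt (unit s) = \<alpha> s"
proof -
  have "wt (unit s) = (\<Sum>j<length w. if j = pos s then \<beta> j else 0)"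
    unfolding wt_def using pos[OF assms] by (intro sum.cong) auto
  then show ?thesis using pos[OF assms] by simp
qed

lemma wt_eq_\<alpha>:
  assumes r: "r \<in> exponents (length w) CARD('p)" and s: "s < n" and eq: "wt r = \<alpha> s"
  shows "r = unit s"
proof -
  have "ht (wt r) = 1" using eq s by (simp add: ht_\<alpha>)
  then obtain s' where "s' < n" "r = unit s'" using wt_ht[OF r] by auto
  then have "\<alpha> s' = \<alpha> s" using eq wt_unit by simp
  then show ?thesis using \<open>r = unit s'\<close> inj_\<alpha> s \<open>s' < n\<close> by (auto simp: inj_on_def)
qed

lemma ht_wt_pos: "r \<in> exponents (length w) CARD('p) \<Longrightarrow> r \<noteq> r0 \<Longrightarrow> ht (wt r) \<ge> 1"
  using wt_ht[of r] by (metis One_nat_def Suc_leI gr0I of_nat_1 of_nat_mono)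

lemma finite_X: "finite (exponents (length w) CARD('p))"
  using finite_lists_length_eq[of "{..<CARD('p)}" "length w"] by (simp add: exponents_def conj_commute)

lemma r0_X: "r0 \<in> exponents (length w) CARD('p)"
  by (auto simp: exponents_def)

text \<open>Exponents are cut off at p, so the exponent 1 requires p > 1. Where it is needed, two
  weights differ by a simple root and \<open>card_gt_1\<close> supplies this.\<close>

lemma unit_X: assumes "CARD('p) > 1" shows "unit s \<in> exponents (length w) CARD('p)"
proof -
  have "set (unit s) \<subseteq> insert 1 (set r0)" by (rule set_update_subset_insert)
  then show ?thesis using assms by (auto simp: exponents_def)
qed

lemma sum_r0: "(\<And>r. r \<in> exponents (length w) CARD('p) \<Longrightarrow> r \<noteq> r0 \<Longrightarrow> g r = 0) \<Longrightarrow> sum g (exponents (length w) CARD('p)) = g r0"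
  using finite_X r0_X by (subst sum.mono_neutral_right[of "exponents (length w) CARD('p)" "{r0}"]) auto

lemma sum_unit:
  "CARD('p) > 1 \<Longrightarrow> (\<And>r. r \<in> exponents (length w) CARD('p) \<Longrightarrow> r \<noteq> unit s \<Longrightarrow> g r = 0) \<Longrightarrow> sum g (exponents (length w) CARD('p)) = g (unit s)"
  using finite_X unit_X[of s] by (subst sum.mono_neutral_right[of "exponents (length w) CARD('p)" "{unit s}"]) auto

lemma root_monomial_r0: "root_monomial n \<alpha> w \<tau> Y r0 = 1"
  unfolding root_monomial_def by (rule prod_list_map_neutral) auto

lemma root_monomial_unit:
  assumes "s < n"
  shows "root_monomial n \<alpha> w \<tau> Y (unit s) = Y s"
  unfolding root_monomial_def using pos[OF assms]
  by (subst prod_list_single[where j = "pos s"]) (auto simp: root_vector_simple[OF assms])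

lemma quasi_R_coeff_r0: "quasi_R_coeff h \<alpha> w r0 = 1"
  unfolding quasi_R_coeff_def by (rule prod.neutral) (simp add: qfact_def)

text \<open>For r = 1 the power r (r + 1) / 2 is 1 and [1] = 1, which uses
  \<open>cs_nonzero\<close>; what remains is (1 - t^(-2)) t = t - 1/t.\<close>

lemma quasi_R_coeff_unit:
  assumes s: "s < n"
  shows "quasi_R_coeff h \<alpha> w (unit s) = cs s"
proof -
  let ?t = "qroot h (\<alpha> s)"
  let ?c = "\<lambda>j. let t = qroot h (\<beta> j) in
        (1 - inverse t ^ 2) ^ (unit s ! j) / qfact t (unit s ! j) * t ^ (unit s ! j * (unit s ! j + 1) div 2)"
  have "?t \<noteq> 0" by (simp add: qroot_def qpow_nonzero)
  have "quasi_R_coeff h \<alpha> w (unit s) = ?c (pos s) * prod ?c ({..<length w} - {pos s})"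
    unfolding quasi_R_coeff_def using pos[OF s] by (intro prod.remove) auto
  also have "prod ?c ({..<length w} - {pos s}) = 1"
    by (rule prod.neutral) (auto simp: qfact_def)
  also have "?c (pos s) = (1 - inverse ?t ^ 2) * ?t"
    using pos[OF s] cs_nonzero[OF s] by (simp add: qfact_def qnum_def cs_def Let_def)
  also have "\<dots> = cs s" using \<open>?t \<noteq> 0\<close> by (simp add: cs_def field_simps power2_eq_square)
  finally show ?thesis by simp
qed

abbreviation "RV \<equiv> R_VV h n \<alpha> w \<tau> E F T \<kappa>"
abbreviation "lp \<equiv> l_plus h n \<alpha> w \<tau> E F K T \<kappa>"
abbreviation "lh \<equiv> l_hat h n \<alpha> w \<tau> E F K T \<kappa>"
abbreviation "TE r \<equiv> T (root_monomial n \<alpha> w \<tau> E r)"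
abbreviation "TF r \<equiv> T (root_monomial n \<alpha> w \<tau> F r)"

lemma card_gt_1:
  assumes s: "s < n" and eq: "\<kappa> i = \<kappa> j + \<alpha> s"
  shows "CARD('p) > 1"
proof -
  have "i \<noteq> j" using eq \<alpha>_pos[OF s] by auto
  moreover have "card {i, j} \<le> CARD('p)" by (rule card_mono) auto
  ultimately show ?thesis by simp
qed

lemma RV_entry:
  "RV $ (i, j) $ (b, a) = qpow h (\<kappa> i \<bullet> \<kappa> j) *
     (\<Sum>r\<in> exponents (length w) CARD('p). quasi_R_coeff h \<alpha> w r * TE r $ i $ b * TF r $ j $ a)"
  by (simp add: R_VV_def)

lemma RV_nonzero:
  assumes "RV $ (i, j) $ (b, a) \<noteq> 0"
  obtains r where "r \<in> exponents (length w) CARD('p)" "\<kappa> i = \<kappa> b + wt r" "\<kappa> a = \<kappa> j + wt r"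
proof -
  have "(\<Sum>r\<in> exponents (length w) CARD('p). quasi_R_coeff h \<alpha> w r * TE r $ i $ b * TF r $ j $ a) \<noteq> 0"
    using assms by (simp add: RV_entry)
  then obtain r where "r \<in> exponents (length w) CARD('p)" "quasi_R_coeff h \<alpha> w r * TE r $ i $ b * TF r $ j $ a \<noteq> 0"
    by (rule sum.not_neutral_contains_not_neutral)
  then show thesis using that T_monomial_E_wt T_monomial_F_wt by auto
qed

text \<open>The first tensor factor gains and the second loses the weight of the exponent tuple, of
  height at least one unless the tuple is zero. Excluding this on either factor leaves only the
  diagonal part.\<close>

lemma RV_same_ht:
  assumes "ht (\<kappa> i) \<le> ht (\<kappa> b) \<or> ht (\<kappa> a) \<le> ht (\<kappa> j)"
  shows "RV $ (i, j) $ (b, a) = (if i = b \<and> j = a then qpow h (\<kappa> i \<bullet> \<kappa> j) else 0)"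
proof -
  have "TE r $ i $ b = 0 \<or> TF r $ j $ a = 0" if r: "r \<in> exponents (length w) CARD('p)" "r \<noteq> r0" for r
    using assms ht_wt_pos[OF r] T_monomial_E_wt[of r i b] T_monomial_F_wt[of r j a]
    by (cases "TE r $ i $ b = 0"; cases "TF r $ j $ a = 0") (auto simp: ht_add)
  then show ?thesis unfolding RV_entry
    by (subst sum_r0) (auto simp: quasi_R_coeff_r0 root_monomial_r0 T_simps mat_def)
qed

text \<open>A weight change by \<open>\<alpha> s\<close> on one tensor factor already pins the tuple
  down to \<open>unit s\<close>; on the other factor the entries of \<open>T (E s)\<close> or
  \<open>T (F s)\<close> take care of the weights themselves.\<close>

lemma RV_simple:
  assumes s: "s < n" and "\<kappa> i = \<kappa> b + \<alpha> s \<or> \<kappa> a = \<kappa> j + \<alpha> s"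
  shows "RV $ (i, j) $ (b, a) = qpow h (\<kappa> i \<bullet> \<kappa> j) * (cs s * T (E s) $ i $ b * T (F s) $ j $ a)"
proof -
  have "TE r $ i $ b = 0 \<or> TF r $ j $ a = 0" if r: "r \<in> exponents (length w) CARD('p)" "r \<noteq> unit s" for r
    using assms wt_eq_\<alpha>[OF r(1) s] r(2) T_monomial_E_wt[of r i b] T_monomial_F_wt[of r j a]
    by (cases "TE r $ i $ b = 0"; cases "TF r $ j $ a = 0") auto
  moreover have "CARD('p) > 1"
    using assms(2) card_gt_1[OF s] by blast
  ultimately show ?thesis unfolding RV_entry
    by (subst sum_unit[where s = s]) (auto simp: quasi_R_coeff_unit[unfolded One_nat_def] root_monomial_unit[unfolded One_nat_def] s)
qed

lemma lp_same_ht: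
  assumes "ht (\<kappa> j) \<le> ht (\<kappa> i)"
  shows "lp i j = (if i = j then K (\<kappa> i) else 0)"
proof -
  have "TF r $ i $ j = 0" if r: "r \<in> exponents (length w) CARD('p)" "r \<noteq> r0" for r
    using assms ht_wt_pos[OF r] T_monomial_F_wt[of r i j]
    by (cases "TF r $ i $ j = 0") (auto simp: ht_add)
  then show ?thesis unfolding l_plus_def
    by (subst sum_r0) (auto simp: quasi_R_coeff_r0 root_monomial_r0 T_simps mat_def scaleC_one
        cvs.scale_zero_left)
qed

lemma lp_simple:
  assumes s: "s < n" and eq: "\<kappa> j = \<kappa> i + \<alpha> s"
  shows "lp i j = (cs s * T (F s) $ i $ j) *\<^sub>C (K (\<kappa> i) * E s)"
proof -
  have "TF r $ i $ j = 0" if r: "r \<in> exponents (length w) CARD('p)" "r \<noteq> unit s" for r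
    using eq wt_eq_\<alpha>[OF r(1) s] r(2) T_monomial_F_wt[of r i j]
    by (cases "TF r $ i $ j = 0") auto
  moreover have "CARD('p) > 1" using card_gt_1[OF s eq] .
  ultimately show ?thesis unfolding l_plus_def
    by (subst sum_unit[where s = s]) (auto simp: quasi_R_coeff_unit[unfolded One_nat_def] root_monomial_unit[unfolded One_nat_def] s cvs.scale_zero_left)
qed

lemma lh_same_ht:
  assumes "ht (\<kappa> i) \<le> ht (\<kappa> j)"
  shows "lh i j = (if i = j then K (\<kappa> i) else 0)"
proof -
  have "TE r $ i $ j = 0" if r: "r \<in> exponents (length w) CARD('p)" "r \<noteq> r0" for r
    using assms ht_wt_pos[OF r] T_monomial_E_wt[of r i j]
    by (cases "TE r $ i $ j = 0") (auto simp: ht_add)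
  then show ?thesis unfolding l_hat_def
    by (subst sum_r0) (auto simp: quasi_R_coeff_r0 root_monomial_r0 T_simps mat_def scaleC_one
        cvs.scale_zero_left)
qed

lemma lh_simple:
  assumes s: "s < n" and eq: "\<kappa> i = \<kappa> j + \<alpha> s"
  shows "lh i j = (cs s * T (E s) $ i $ j) *\<^sub>C (K (\<kappa> i) * F s)"
proof -
  have "TE r $ i $ j = 0" if r: "r \<in> exponents (length w) CARD('p)" "r \<noteq> unit s" for r
    using eq wt_eq_\<alpha>[OF r(1) s] r(2) T_monomial_E_wt[of r i j]
    by (cases "TE r $ i $ j = 0") auto
  moreover have "CARD('p) > 1" using card_gt_1[OF s eq] .
  ultimately show ?thesis unfolding l_hat_def
    by (subst sum_unit[where s = s]) (auto simp: quasi_R_coeff_unit[unfolded One_nat_def] root_monomial_unit[unfolded One_nat_def] s cvs.scale_zero_left)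
qed

end

section \<open>Double-bosonization\<close>

lemma sum_sum_single:
  assumes "\<And>x y. (x, y) \<noteq> (i, j) \<Longrightarrow> G x y = 0"
  shows "(\<Sum>x\<in>UNIV. \<Sum>y\<in>UNIV. G (x::'x::finite) (y::'y::finite)) = (G i j :: 'z::comm_monoid_add)"
proof -
  have "(\<Sum>x\<in>UNIV. \<Sum>y\<in>UNIV. G x y) = (\<Sum>x\<in>UNIV. if x = i then G i j else 0)"
  proof (rule sum.cong)
    fix x
    have "(\<Sum>y\<in>UNIV. G i y) = (\<Sum>y\<in>UNIV. if y = j then G i j else 0)"
      by (rule sum.cong) (auto intro: assms)
    then show "(\<Sum>y\<in>UNIV. G x y) = (if x = i then G i j else 0)" using assms by auto
  qed simp
  then show ?thesis by simp
qed

lemma sum_two: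
  assumes "i \<noteq> j" "\<And>x. x \<noteq> i \<Longrightarrow> x \<noteq> j \<Longrightarrow> G x = 0"
  shows "(\<Sum>x\<in>UNIV. G (x::'x::finite)) = (G i + G j :: 'z::comm_monoid_add)"
proof -
  have "(\<Sum>x\<in>UNIV. G x) = (\<Sum>x\<in>{i, j}. G x)"
    by (rule sum.mono_neutral_right) (use assms(2) in auto)
  then show ?thesis using assms(1) by simp
qed

text \<open>Nonzero elements can be completed to bases, so the product is a basis vector of the
  double-bosonization, and different powers of \<open>c\<close> give different basis
  vectors.\<close>

lemma triangular_nonzero:
  fixes c :: "'d::complex_algebra_1"
  assumes tri: "triangular_decomposition jw ju c jv"
    and x: "x \<noteq> 0" and y: "y \<noteq> 0" and z: "z \<noteq> 0"
  shows "jw x * ju y * int_pow c k * jv z \<noteq> 0"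
    and "jw x * ju y * int_pow c k * jv z = jw x * ju y * int_pow c l * jv z \<Longrightarrow> k = l"
proof -
  obtain X where X: "is_basis X" "x \<in> X" using ex_basis_containing[OF x] .
  obtain Y where Y: "is_basis Y" "y \<in> Y" using ex_basis_containing[OF y] .
  obtain Z where Z: "is_basis Z" "z \<in> Z" using ex_basis_containing[OF z] .
  define g where "g = (\<lambda>(x, y, k, z). jw x * ju y * int_pow c k * jv z)"
  define B where "B = X \<times> Y \<times> (UNIV :: int set) \<times> Z"
  have inj: "inj_on g B" and basis: "is_basis (g ` B)"
    using tri X(1) Y(1) Z(1) unfolding triangular_decomposition_def Let_def g_def B_def by blast+
  have mem: "(x, y, k, z) \<in> B" for k using X Y Z by (simp add: B_def)
  have "0 \<notin> g ` B" using basis cvs.dependent_zero unfolding is_basis_def by blast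
  then have "g (x, y, k, z) \<noteq> 0" using mem by (metis imageI)
  then show "jw x * ju y * int_pow c k * jv z \<noteq> 0" by (simp add: g_def)
  show "k = l" if "jw x * ju y * int_pow c k * jv z = jw x * ju y * int_pow c l * jv z"
    using inj_onD[OF inj _ mem mem, of k l] that by (simp add: g_def)
qed

lemma triangular_generated:
  fixes c :: "'d::complex_algebra_1" and jw :: "'w::complex_algebra_1 \<Rightarrow> 'd"
    and ju :: "'u::complex_algebra_1 \<Rightarrow> 'd" and jv :: "'v::complex_algebra_1 \<Rightarrow> 'd"
  assumes tri: "triangular_decomposition jw ju c jv"
    and G: "\<And>x. jw x \<in> generated_alg G" "\<And>x. ju x \<in> generated_alg G" "\<And>x. jv x \<in> generated_alg G"
      "\<And>k. int_pow c k \<in> generated_alg G"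
    and nontrivial: "(1::'w) \<noteq> 0" "(1::'u) \<noteq> 0" "(1::'v) \<noteq> 0"
  shows "generated_alg G = UNIV"
proof -
  obtain X where X: "is_basis (X :: 'w set)" using ex_basis_containing[OF nontrivial(1)] .
  obtain Y where Y: "is_basis (Y :: 'u set)" using ex_basis_containing[OF nontrivial(2)] .
  obtain Z where Z: "is_basis (Z :: 'v set)" using ex_basis_containing[OF nontrivial(3)] .
  define g where "g = (\<lambda>(x, y, k, z). jw x * ju y * int_pow c k * jv z)"
  define B where "B = X \<times> Y \<times> (UNIV :: int set) \<times> Z"
  have "is_basis (g ` B)"
    using tri X Y Z unfolding triangular_decomposition_def Let_def g_def B_def by blast
  then have span: "cvs.span (g ` B) = UNIV" by (simp add: is_basis_def)
  have "g ` B \<subseteq> generated_alg G"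
    by (auto simp: g_def intro!: generated_alg.mult G)
  then have "cvs.span (g ` B) \<subseteq> generated_alg G"
    by (rule cvs.span_minimal) (rule generated_alg_subspace)
  then show ?thesis using span by blast
qed

locale bosonized_module = uq_module h \<Phi> n m \<alpha> L E F K \<tau> w T \<kappa>
  for h :: complex
    and \<Phi> :: "'e::euclidean_space set" and n m :: nat and \<alpha> :: "nat \<Rightarrow> 'e" and L :: "'e set"
    and E F :: "nat \<Rightarrow> 'u::complex_algebra_1" and K :: "'e \<Rightarrow> 'u"
    and \<tau> :: "nat \<Rightarrow> 'u \<Rightarrow> 'u" and w :: "nat list"
    and T :: "'u \<Rightarrow> complex^('p::{finite,linorder})^('p::{finite,linorder})" and \<kappa> :: "'p \<Rightarrow> 'e" +
  fixes S :: "'u \<Rightarrow> 'u" and \<mu> :: 'e and R' :: "complex^('p::{finite,linorder} \<times> 'p)^('p \<times> 'p)" and lam qs :: complex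
    and lm mp mm :: "'p \<Rightarrow> 'p \<Rightarrow> 'u"
    and e :: "'p \<Rightarrow> 'v::complex_algebra_1" and f :: "'p \<Rightarrow> 'w::complex_algebra_1"
    and jw :: "'w \<Rightarrow> 'd::complex_algebra_1" and ju :: "'u \<Rightarrow> 'd" and c :: 'd and jv :: "'v \<Rightarrow> 'd"
    and in1 in2 \<Delta> :: "'d \<Rightarrow> 't::complex_algebra_1"
  assumes antipode: "uq_antipode n \<alpha> L E F K S"
    and highest_weight: "\<kappa> top_index = - \<mu>"
    and l_minus: "inverse_matrices (l_hat h n \<alpha> w \<tau> E F K T \<kappa>) lm"
    and mp_def: "\<And>i j. mp i j = S (l_plus h n \<alpha> w \<tau> E F K T \<kappa> i j)"
    and mm_def: "\<And>i j. mm i j = S (lm i j)"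
    and V: "vector_algebra R' e"
    and V_dual: "covector_algebra R' f"
    and D: "double_bosonization n \<alpha> L E F K e f mp mm (R_VV h n \<alpha> w \<tau> E F T \<kappa>) lam qs jw ju c jv in1 in2 \<Delta>"
begin

abbreviation "k \<gamma> \<equiv> ju (K \<gamma>)"
abbreviation "eb i \<equiv> jv (e i)"
abbreviation "fb i \<equiv> jw (f i)"
text \<open>Antipode and embedding both reverse products, so their composite preserves them. Hence
  the matrix products of L-operators survive, and \<open>A\<close> and \<open>B\<close> stay inverse
  to each other.\<close>

definition "\<phi> = ju \<circ> S"
abbreviation "P i j \<equiv> \<phi> (lp i j)"
abbreviation "A i j \<equiv> \<phi> (lh i j)"
abbreviation "B i j \<equiv> \<phi> (lm i j)"

lemma \<mu>: "\<kappa> hi = - \<mu>" "\<mu> \<in> L"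
  using highest_weight L_minus[OF L_\<kappa>[of hi]] by simp_all

lemma jw: "alg_hom jw" and ju: "alg_antihom ju" and jv: "alg_hom jv"
  and c_invertible: "invertible_elem c" and c_ju: "c * ju x = ju x * c"
  and triangular: "triangular_decomposition jw ju c jv"
  using D by (auto simp: double_bosonization_def)

lemma S: "alg_antihom S"
  using antipode by (simp add: uq_antipode_def)

lemma \<phi>: "alg_hom \<phi>"
  unfolding \<phi>_def by (rule alg_antihom_comp[OF ju S])

lemmas ju_simps = alg_antihom_simps[OF ju]
  and jw_simps = alg_hom_simps[OF jw] and jv_simps = alg_hom_simps[OF jv]
  and \<phi>_simps = alg_hom_simps[OF \<phi>]

text \<open>With \<open>R_entry\<close> unfolded, the generators e, f occupy the first tensor slot
  of \<open>RV\<close> in the relations with \<open>P\<close> and the second slot in those with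
  \<open>B\<close>. This decides below whether \<open>T (E s)\<close> or \<open>T (F s)\<close> acts
  on them.\<close>

lemma cross:
  shows eb_c: "eb i * c = lam *\<^sub>C (c * eb i)"
    and eb_fb: "eb i * fb j - fb j * eb i = (1 / (qs - inverse qs)) *\<^sub>C (P i j * inv_elem c - c * B i j)"
    and eb_P: "eb i * P j l = (\<Sum>a\<in>UNIV. \<Sum>b\<in>UNIV. RV $ (i, j) $ (b, a) *\<^sub>C (P a l * eb b))"
    and B_eb: "B i j * eb l = (\<Sum>a\<in>UNIV. \<Sum>b\<in>UNIV. RV $ (i, l) $ (b, a) *\<^sub>C (eb a * B b j))"
    and P_fb: "P i j * fb l = (\<Sum>a\<in>UNIV. \<Sum>b\<in>UNIV. RV $ (b, a) $ (l, j) *\<^sub>C (fb b * P i a))"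
    and fb_B: "fb i * B j l = (\<Sum>a\<in>UNIV. \<Sum>b\<in>UNIV. RV $ (b, a) $ (l, i) *\<^sub>C (B j b * fb a))"
  using D unfolding double_bosonization_def cross_relations_def
  by (simp_all add: R_entry_def mp_def mm_def \<phi>_def)

lemma scaleC_cancel: "z \<noteq> 0 \<Longrightarrow> z *\<^sub>C (x::'d) = z *\<^sub>C y \<longleftrightarrow> x = y"
  by (simp add: cvs.scale_cancel_left)

lemmas scaleC_simps = mult_scaleC_left mult_scaleC_right scaleC_scaleC

lemma k_0: "k 0 = 1"
  by (simp add: K_0 ju_simps)

lemma k_mult: "\<gamma> \<in> L \<Longrightarrow> \<delta> \<in> L \<Longrightarrow> k \<gamma> * k \<delta> = k (\<gamma> + \<delta>)"
  by (simp add: K_mult add.commute flip: ju_simps)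

lemma k_minus: assumes "\<gamma> \<in> L" shows "k \<gamma> * k (- \<gamma>) = 1" "k (- \<gamma>) * k \<gamma> = 1"
  using assms by (simp_all add: k_mult L_minus k_0)

lemma k_cancel: assumes "\<gamma> \<in> L" shows "k \<gamma> * x = k \<gamma> * y \<longleftrightarrow> x = y"
proof
  assume "k \<gamma> * x = k \<gamma> * y"
  then have "k (- \<gamma>) * (k \<gamma> * x) = k (- \<gamma>) * (k \<gamma> * y)" by simp
  then show "x = y" using k_minus[OF assms] by (simp flip: mult.assoc)
qed simp

lemma juE_k: "\<gamma> \<in> L \<Longrightarrow> s < n \<Longrightarrow> ju (E s) * k \<gamma> = qpow h (\<gamma> \<bullet> \<alpha> s) *\<^sub>C (k \<gamma> * ju (E s))"
  by (simp add: K_E flip: ju_simps)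

lemma juF_k: "\<gamma> \<in> L \<Longrightarrow> s < n \<Longrightarrow> ju (F s) * k \<gamma> = qpow h (- (\<gamma> \<bullet> \<alpha> s)) *\<^sub>C (k \<gamma> * ju (F s))"
  by (simp add: K_F flip: ju_simps)

text \<open>\<open>ju\<close> reverses the product in the antipode of \<open>F s\<close>, leaving K
  on the right; moving it back to the left produces the power of q.\<close>

lemma \<phi>_K: "\<gamma> \<in> L \<Longrightarrow> \<phi> (K \<gamma>) = k (- \<gamma>)"
  and \<phi>_E: "s < n \<Longrightarrow> \<phi> (E s) = - (k (- \<alpha> s) * ju (E s))"
  and \<phi>_F: "s < n \<Longrightarrow> \<phi> (F s) = - (qpow h (- (\<alpha> s \<bullet> \<alpha> s)) *\<^sub>C (k (\<alpha> s) * ju (F s)))"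
  using antipode by (simp_all add: uq_antipode_def \<phi>_def ju_simps juF_k[symmetric] L_\<alpha>)

lemma A_B: "(\<Sum>l\<in>UNIV. A i l * B l j) = (if i = j then 1 else 0)"
  "(\<Sum>l\<in>UNIV. B i l * A l j) = (if i = j then 1 else 0)"
proof -
  have "\<phi> (\<Sum>l\<in>UNIV. lh i l * lm l j) = (if i = j then 1 else 0)"
    "\<phi> (\<Sum>l\<in>UNIV. lm i l * lh l j) = (if i = j then 1 else 0)"
    using l_minus unfolding inverse_matrices_def by (auto simp: \<phi>_simps)
  then show "(\<Sum>l\<in>UNIV. A i l * B l j) = (if i = j then 1 else 0)"
    "(\<Sum>l\<in>UNIV. B i l * A l j) = (if i = j then 1 else 0)"
    by (simp_all only: alg_hom_sum[OF \<phi>] \<phi>_simps)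
qed

lemma P_same_ht: "ht (\<kappa> j) \<le> ht (\<kappa> i) \<Longrightarrow> P i j = (if i = j then k (- \<kappa> i) else 0)"
  using lp_same_ht[of j i] \<phi>_K[OF L_\<kappa>] \<phi>_simps(5) by simp

lemma A_same_ht: "ht (\<kappa> i) \<le> ht (\<kappa> j) \<Longrightarrow> A i j = (if i = j then k (- \<kappa> i) else 0)"
  using lh_same_ht[of i j] \<phi>_K[OF L_\<kappa>] \<phi>_simps(5) by simp

lemma P_simple:
  assumes s: "s < n" and eq: "\<kappa> j = \<kappa> i + \<alpha> s"
  shows "P i j = - ((cs s * T (F s) $ i $ j) *\<^sub>C (k (- \<kappa> j) * ju (E s)))"
proof -
  have "P i j = (cs s * T (F s) $ i $ j) *\<^sub>C (\<phi> (K (\<kappa> i)) * \<phi> (E s))"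
    by (simp only: lp_simple[OF assms] \<phi>_simps)
  also have "\<phi> (K (\<kappa> i)) * \<phi> (E s) = - (k (- \<kappa> i) * k (- \<alpha> s) * ju (E s))"
    by (simp only: \<phi>_K[OF L_\<kappa>] \<phi>_E[OF s] mult_minus_right mult.assoc)
  also have "k (- \<kappa> i) * k (- \<alpha> s) = k (- \<kappa> j)"
    using s by (simp add: k_mult L_minus L_diff L_\<kappa> L_\<alpha> eq)
  finally show ?thesis by (simp add: cvs.scale_minus_right)
qed

lemma A_simple:
  assumes s: "s < n" and eq: "\<kappa> i = \<kappa> j + \<alpha> s"
  shows "A i j = - ((cs s * T (E s) $ i $ j * qpow h (- (\<alpha> s \<bullet> \<alpha> s))) *\<^sub>C (k (- \<kappa> j) * ju (F s)))"
proof -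
  have "A i j = (cs s * T (E s) $ i $ j) *\<^sub>C (\<phi> (K (\<kappa> i)) * \<phi> (F s))"
    by (simp only: lh_simple[OF assms] \<phi>_simps)
  also have "\<phi> (K (\<kappa> i)) * \<phi> (F s) = - (qpow h (- (\<alpha> s \<bullet> \<alpha> s)) *\<^sub>C (k (- \<kappa> i) * k (\<alpha> s) * ju (F s)))"
    by (simp only: \<phi>_K[OF L_\<kappa>] \<phi>_F[OF s] mult_minus_right mult.assoc mult_scaleC_right)
  also have "k (- \<kappa> i) * k (\<alpha> s) = k (- \<kappa> j)"
    using s by (simp add: k_mult L_minus L_diff L_\<kappa> L_\<alpha> eq)
  finally show ?thesis by (simp add: cvs.scale_minus_right scaleC_scaleC)
qed

section \<open>Diagonal relations of the top generators\<close>

lemma P_fb_top: "P i j * fb hi = qpow h (\<kappa> j \<bullet> \<kappa> hi) *\<^sub>C (fb hi * P i j)"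
  unfolding P_fb
  by (subst sum_sum_single[where i = j and j = hi])
    (auto simp: RV_same_ht ht_\<kappa>_le_top cvs.scale_zero_left inner_commute)

lemma B_eb_top: "B i j * eb hi = qpow h (\<kappa> i \<bullet> \<kappa> hi) *\<^sub>C (eb hi * B i j)"
  unfolding B_eb
  by (subst sum_sum_single[where i = hi and j = i])
    (auto simp: RV_same_ht ht_\<kappa>_le_top cvs.scale_zero_left)

text \<open>Conjugation of the relations for \<open>B\<close> by its inverse matrix \<open>A\<close>.\<close>

lemma eb_A_top: "eb hi * A i j = qpow h (\<kappa> j \<bullet> \<kappa> hi) *\<^sub>C (A i j * eb hi)"
proof -
  have "qpow h (\<kappa> j \<bullet> \<kappa> hi) *\<^sub>C (A i j * eb hi)
    = (\<Sum>y\<in>UNIV. if y = j then qpow h (\<kappa> y \<bullet> \<kappa> hi) *\<^sub>C (A i y * eb hi) else 0)" by simp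
  also have "\<dots> = (\<Sum>y\<in>UNIV. qpow h (\<kappa> y \<bullet> \<kappa> hi) *\<^sub>C (A i y * eb hi * (\<Sum>x\<in>UNIV. B y x * A x j)))"
    by (intro sum.cong) (auto simp: A_B cvs.scale_zero_right)
  also have "\<dots> = (\<Sum>y\<in>UNIV. \<Sum>x\<in>UNIV. A i y * (qpow h (\<kappa> y \<bullet> \<kappa> hi) *\<^sub>C (eb hi * B y x)) * A x j)"
    by (simp only: sum_distrib_left cvs.scale_sum_right scaleC_simps mult.assoc)
  also have "\<dots> = (\<Sum>y\<in>UNIV. \<Sum>x\<in>UNIV. A i y * B y x * eb hi * A x j)"
    by (simp only: B_eb_top mult.assoc)
  also have "\<dots> = (\<Sum>x\<in>UNIV. (\<Sum>y\<in>UNIV. A i y * B y x) * eb hi * A x j)"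
    by (subst sum.swap) (simp only: sum_distrib_right)
  also have "\<dots> = (\<Sum>x\<in>UNIV. if x = i then eb hi * A i j else 0)"
    by (intro sum.cong) (auto simp: A_B)
  finally show ?thesis by simp
qed

lemma A_fb: "A l x * fb i = (\<Sum>y\<in>UNIV. \<Sum>a\<in>UNIV. RV $ (l, a) $ (y, i) *\<^sub>C (fb a * A y x))"
proof -
  have "A l x * fb i = (\<Sum>j\<in>UNIV. if j = x then A l j * fb i else 0)" by simp
  also have "\<dots> = (\<Sum>j\<in>UNIV. A l j * fb i * (\<Sum>y\<in>UNIV. B j y * A y x))"
    by (intro sum.cong) (auto simp: A_B)
  also have "\<dots> = (\<Sum>j\<in>UNIV. \<Sum>y\<in>UNIV. A l j * (fb i * B j y) * A y x)"
    by (simp only: sum_distrib_left mult.assoc)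
  also have "\<dots> = (\<Sum>j\<in>UNIV. \<Sum>y\<in>UNIV. \<Sum>a\<in>UNIV. \<Sum>b\<in>UNIV. RV $ (b, a) $ (y, i) *\<^sub>C (A l j * B j b * fb a * A y x))"
    by (simp only: fb_B sum_distrib_left sum_distrib_right scaleC_simps mult.assoc)
  \<comment> \<open>The sum over \<open>j\<close> is moved innermost, where \<open>A\<close> and
    \<open>B\<close> cancel.\<close>
  also have "\<dots> = (\<Sum>y\<in>UNIV. \<Sum>a\<in>UNIV. \<Sum>b\<in>UNIV. \<Sum>j\<in>UNIV. RV $ (b, a) $ (y, i) *\<^sub>C (A l j * B j b * fb a * A y x))"
    by (subst sum.swap, rule sum.cong[OF refl], subst sum.swap, rule sum.cong[OF refl], subst sum.swap, rule refl)
  also have "\<dots> = (\<Sum>y\<in>UNIV. \<Sum>a\<in>UNIV. \<Sum>b\<in>UNIV. RV $ (b, a) $ (y, i) *\<^sub>C ((\<Sum>j\<in>UNIV. A l j * B j b) * fb a * A y x))"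
    by (simp only: cvs.scale_sum_right sum_distrib_right)
  also have "\<dots> = (\<Sum>y\<in>UNIV. \<Sum>a\<in>UNIV. \<Sum>b\<in>UNIV. if b = l then RV $ (l, a) $ (y, i) *\<^sub>C (fb a * A y x) else 0)"
    by (intro sum.cong refl) (auto simp: A_B cvs.scale_zero_right)
  finally show ?thesis by simp
qed

text \<open>It says that e^i has weight -\<kappa>_i with respect to K_\<gamma>; at the top index
  this is \<mu>. It is a property of \<open>\<gamma>\<close> rather than a lemma about
  \<open>L\<close>: the cross relations provide it for weights of V, and sums and negatives extend
  it.\<close>

definition comm_e :: "'e \<Rightarrow> bool" where
  "comm_e \<gamma> \<longleftrightarrow> (\<forall>i. eb i * k \<gamma> = qpow h (- (\<gamma> \<bullet> \<kappa> i)) *\<^sub>C (k \<gamma> * eb i))"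

definition comm_f :: "'e \<Rightarrow> bool" where
  "comm_f \<gamma> \<longleftrightarrow> (\<forall>i. fb i * k \<gamma> = qpow h (\<gamma> \<bullet> \<kappa> i) *\<^sub>C (k \<gamma> * fb i))"

lemma comm_uminus:
  assumes \<gamma>: "\<gamma> \<in> L"
  shows "comm_e \<gamma> \<Longrightarrow> comm_e (- \<gamma>)" "comm_f \<gamma> \<Longrightarrow> comm_f (- \<gamma>)"
proof -
  have *: "y * k (- \<gamma>) = qpow h (- x) *\<^sub>C (k (- \<gamma>) * y)" if "y * k \<gamma> = qpow h x *\<^sub>C (k \<gamma> * y)" for y x
  proof -
    have "k (- \<gamma>) * y = k (- \<gamma>) * (y * k \<gamma>) * k (- \<gamma>)"
      using k_minus[OF \<gamma>] by (simp add: mult.assoc)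
    also have "\<dots> = qpow h x *\<^sub>C (k (- \<gamma>) * k \<gamma> * y * k (- \<gamma>))"
      by (simp only: that scaleC_simps mult.assoc)
    finally show ?thesis using k_minus[OF \<gamma>] by (simp add: scaleC_simps qpow_minus qpow_nonzero scaleC_one)
  qed
  show "comm_e \<gamma> \<Longrightarrow> comm_e (- \<gamma>)" "comm_f \<gamma> \<Longrightarrow> comm_f (- \<gamma>)"
    unfolding comm_e_def comm_f_def using *[of "eb _" "- (\<gamma> \<bullet> \<kappa> _)"] *[of "fb _" "\<gamma> \<bullet> \<kappa> _"]
    by simp_all
qed

lemma comm_add:
  assumes \<gamma>: "\<gamma> \<in> L" "\<delta> \<in> L"
  shows "comm_e \<gamma> \<Longrightarrow> comm_e \<delta> \<Longrightarrow> comm_e (\<gamma> + \<delta>)" "comm_f \<gamma> \<Longrightarrow> comm_f \<delta> \<Longrightarrow> comm_f (\<gamma> + \<delta>)"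
proof -
  have *: "y * k (\<gamma> + \<delta>) = qpow h (x + x') *\<^sub>C (k (\<gamma> + \<delta>) * y)"
    if "y * k \<gamma> = qpow h x *\<^sub>C (k \<gamma> * y)" "y * k \<delta> = qpow h x' *\<^sub>C (k \<delta> * y)" for y x x'
  proof -
    have "y * (k \<gamma> * k \<delta>) = qpow h x *\<^sub>C (k \<gamma> * (y * k \<delta>))"
      by (simp only: that(1) scaleC_simps flip: mult.assoc)
    also have "\<dots> = qpow h (x + x') *\<^sub>C (k \<gamma> * k \<delta> * y)"
      by (simp only: that(2) scaleC_simps qpow_add mult.assoc)
    finally show ?thesis using k_mult[OF \<gamma>] by simp
  qed
  show "comm_e \<gamma> \<Longrightarrow> comm_e \<delta> \<Longrightarrow> comm_e (\<gamma> + \<delta>)" "comm_f \<gamma> \<Longrightarrow> comm_f \<delta> \<Longrightarrow> comm_f (\<gamma> + \<delta>)"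
    unfolding comm_e_def comm_f_def
    using *[of "eb _" "- (\<gamma> \<bullet> \<kappa> _)" "- (\<delta> \<bullet> \<kappa> _)"] *[of "fb _" "\<gamma> \<bullet> \<kappa> _" "\<delta> \<bullet> \<kappa> _"]
    by (simp_all add: inner_add_left)
qed

text \<open>The diagonal entries of \<open>P\<close> and \<open>A\<close> are K's. In their
  relations all other terms drop out: depending on the height of the summation index, either the
  R-entry or the entry of the triangular matrix vanishes.\<close>

lemma comm_\<kappa>: "comm_e (- \<kappa> j)" "comm_f (- \<kappa> j)"
proof -
  have "eb i * k (- \<kappa> j) = qpow h (\<kappa> i \<bullet> \<kappa> j) *\<^sub>C (k (- \<kappa> j) * eb i)" for i
  proof -
    have zero: "RV $ (i, j) $ (b, a) *\<^sub>C (P a j * eb b) = 0" if "(a, b) \<noteq> (j, i)" for a b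
      using that by (cases "ht (\<kappa> a) \<le> ht (\<kappa> j)") (auto simp: RV_same_ht P_same_ht cvs.scale_zero_left)
    have "eb i * P j j = RV $ (i, j) $ (i, j) *\<^sub>C (P j j * eb i)"
      unfolding eb_P using zero by (rule sum_sum_single)
    then show ?thesis by (simp add: P_same_ht RV_same_ht)
  qed
  then show "comm_e (- \<kappa> j)" by (simp add: comm_e_def inner_commute)
  have "k (- \<kappa> j) * fb i = qpow h (\<kappa> j \<bullet> \<kappa> i) *\<^sub>C (fb i * k (- \<kappa> j))" for i
  proof -
    have zero: "RV $ (j, a) $ (y, i) *\<^sub>C (fb a * A y j) = 0" if "(y, a) \<noteq> (j, i)" for a y
      using that by (cases "ht (\<kappa> j) \<le> ht (\<kappa> y)") (auto simp: RV_same_ht A_same_ht cvs.scale_zero_left)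
    have "A j j * fb i = RV $ (j, i) $ (j, i) *\<^sub>C (fb i * A j j)"
      unfolding A_fb[of j j i] using zero by (rule sum_sum_single)
    then show ?thesis by (simp add: A_same_ht RV_same_ht)
  qed
  then show "comm_f (- \<kappa> j)"
    by (simp add: comm_f_def scaleC_simps qpow_minus qpow_nonzero scaleC_one)
qed

lemma comm_\<mu>: "comm_e \<mu>" "comm_f \<mu>"
  using comm_\<kappa>[of hi] \<mu> by simp_all

text \<open>A nonzero entry of \<open>T (E s)\<close> presents \<open>\<alpha> s\<close> as a
  difference of two weights of V.\<close>

lemma comm_\<alpha>:
  assumes s: "s < n" and nz: "T (E s) \<noteq> 0"
  shows "comm_e (\<alpha> s)" "comm_f (\<alpha> s)"
proof -
  obtain i j where "T (E s) $ i $ j \<noteq> 0" using nz by (auto simp: vec_eq_iff)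
  then have "\<kappa> i + - \<kappa> j = \<alpha> s" using T_E_wt[OF s] by auto
  moreover have "comm_e (\<kappa> i + - \<kappa> j)" "comm_f (\<kappa> i + - \<kappa> j)"
    using comm_\<kappa>[of j] comm_uminus[OF L_minus[OF L_\<kappa>], of i] comm_\<kappa>[of i]
    by (simp_all only: comm_add L_\<kappa> L_minus minus_minus)
  ultimately show "comm_e (\<alpha> s)" "comm_f (\<alpha> s)" by simp_all
qed

lemma comm_eD: "comm_e \<gamma> \<Longrightarrow> eb i * k \<gamma> = qpow h (- (\<gamma> \<bullet> \<kappa> i)) *\<^sub>C (k \<gamma> * eb i)"
  and comm_fD: "comm_f \<gamma> \<Longrightarrow> fb i * k \<gamma> = qpow h (\<gamma> \<bullet> \<kappa> i) *\<^sub>C (k \<gamma> * fb i)"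
  by (simp_all add: comm_e_def comm_f_def)

text \<open>A nonzero entry of \<open>T (F s)\<close> turns an entry of \<open>P\<close> into a
  nonzero multiple of a K times \<open>ju (E s)\<close>. The power of q in its relation with f_p is
  exactly the one caused by moving that K past f_p.\<close>

lemma juE_fb_top:
  assumes s: "s < n" and nz: "T (E s) \<noteq> 0"
  shows "ju (E s) * fb hi = fb hi * ju (E s)"
proof -
  obtain i j where ij: "T (F s) $ i $ j \<noteq> 0" using T_F_nonzero_if[OF s nz] by (auto simp: vec_eq_iff)
  then have \<kappa>: "\<kappa> j = \<kappa> i + \<alpha> s" by (rule T_F_wt[OF s])
  let ?x = "cs s * T (F s) $ i $ j"
  have x: "?x \<noteq> 0" using ij cs_nonzero[OF s] by simp
  have "?x *\<^sub>C (k (- \<kappa> j) * ju (E s) * fb hi) = ?x *\<^sub>C (qpow h (\<kappa> j \<bullet> \<kappa> hi) *\<^sub>C (fb hi * (k (- \<kappa> j) * ju (E s))))"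
    using P_fb_top[of i j] P_simple[OF s \<kappa>] by (simp add: scaleC_simps cvs.scale_minus_right mult.commute)
  then have "k (- \<kappa> j) * ju (E s) * fb hi = qpow h (\<kappa> j \<bullet> \<kappa> hi) *\<^sub>C (fb hi * k (- \<kappa> j) * ju (E s))"
    using scaleC_cancel[OF x] by (simp only: mult.assoc)
  also have "\<dots> = k (- \<kappa> j) * (fb hi * ju (E s))"
    by (simp add: comm_fD[OF comm_\<kappa>(2)] scaleC_simps mult.assoc qpow_minus qpow_nonzero scaleC_one)
  finally show ?thesis by (simp add: mult.assoc k_cancel L_minus L_\<kappa>)
qed

lemma juF_eb_top:
  assumes s: "s < n" and nz: "T (E s) \<noteq> 0"
  shows "eb hi * ju (F s) = ju (F s) * eb hi"
proof -
  obtain i j where ij: "T (E s) $ i $ j \<noteq> 0" using nz by (auto simp: vec_eq_iff)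
  then have \<kappa>: "\<kappa> i = \<kappa> j + \<alpha> s" by (rule T_E_wt[OF s])
  let ?x = "cs s * T (E s) $ i $ j * qpow h (- (\<alpha> s \<bullet> \<alpha> s))"
  have x: "?x \<noteq> 0" using ij cs_nonzero[OF s] by (simp add: qpow_nonzero)
  have "?x *\<^sub>C (eb hi * (k (- \<kappa> j) * ju (F s))) = ?x *\<^sub>C (qpow h (\<kappa> j \<bullet> \<kappa> hi) *\<^sub>C (k (- \<kappa> j) * ju (F s) * eb hi))"
    using eb_A_top[of i j] A_simple[OF s \<kappa>] by (simp add: scaleC_simps cvs.scale_minus_right mult.commute)
  then have "qpow h (\<kappa> j \<bullet> \<kappa> hi) *\<^sub>C (k (- \<kappa> j) * (ju (F s) * eb hi)) = eb hi * k (- \<kappa> j) * ju (F s)"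
    using scaleC_cancel[OF x] by (simp only: mult.assoc)
  also have "\<dots> = qpow h (\<kappa> j \<bullet> \<kappa> hi) *\<^sub>C (k (- \<kappa> j) * (eb hi * ju (F s)))"
    by (simp add: comm_eD[OF comm_\<kappa>(1)] scaleC_simps mult.assoc)
  finally show ?thesis by (simp add: scaleC_cancel qpow_nonzero k_cancel L_minus L_\<kappa>)
qed

end

lemma quadratic_relation_keys:
  assumes "w \<in> Poly_Mapping.keys (var i * var j - (\<Sum>a\<in>A. \<Sum>b\<in>B. const (z a b) * var (x a b) * var (y a b)))"
  shows "2 \<le> length (letters w)"
proof -
  define Q where "Q = {p :: 'a free_alg. \<forall>w\<in>Poly_Mapping.keys p. 2 \<le> length (letters w)}"
  have Q_diff: "p - q \<in> Q" and Q_add: "p + q \<in> Q" if "p \<in> Q" "q \<in> Q" for p q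
    using that keys_diff[of p q] Poly_Mapping.keys_add[of p q] by (auto simp: Q_def)
  have Q_0: "0 \<in> Q" by (simp add: Q_def)
  have Q_sum: "(\<Sum>a\<in>A. g a) \<in> Q" if "\<And>a. g a \<in> Q" for g and A :: "'z set"
    using that Q_0 by (induction A rule: infinite_finite_induct) (simp_all add: Q_add)
  have Q_word: "const z * var x * var y \<in> Q" "var x * var y \<in> Q" for z x y
    by (auto simp: Q_def const_def var_def mult_single plus_word_def zero_word_def)
  have "var i * var j - (\<Sum>a\<in>A. \<Sum>b\<in>B. const (z a b) * var (x a b) * var (y a b)) \<in> Q"
    by (intro Q_diff Q_sum Q_word)
  then show ?thesis using assms by (auto simp: Q_def)
qed

context bosonized_module
begin

text \<open>The representation separates 1 from 0 in U_q, and quadratic relations can kill neither a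
  generator nor the unit.\<close>

lemma one_nonzero: "(1::'u) \<noteq> 0" "(1::'v) \<noteq> 0" "(1::'w) \<noteq> 0"
  and e_nonzero: "e i \<noteq> 0" and f_nonzero: "f i \<noteq> 0"
proof -
  show "(1::'u) \<noteq> 0"
  proof
    assume "(1::'u) = 0"
    then have "T 1 $ hi $ hi = T 0 $ hi $ hi" by simp
    then show False by (simp add: T_simps mat_def)
  qed
  show "(1::'v) \<noteq> 0" "e i \<noteq> 0"
    by (rule presented_by_quadratic[OF V[unfolded vector_algebra_def]],
        clarify, erule quadratic_relation_keys)+
  show "(1::'w) \<noteq> 0" "f i \<noteq> 0"
    by (rule presented_by_quadratic[OF V_dual[unfolded covector_algebra_def]],
        clarify, erule quadratic_relation_keys)+
qed

lemma ju_nonzero: "y \<noteq> 0 \<Longrightarrow> ju y \<noteq> 0" and eb_nonzero: "eb i \<noteq> 0" and fb_nonzero: "fb i \<noteq> 0"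
  and int_pow_c_eq_1: "int_pow c z = 1 \<Longrightarrow> z = 0"
  using triangular_nonzero(1)[OF triangular one_nonzero(3) _ one_nonzero(2), of y 0]
    triangular_nonzero(1)[OF triangular one_nonzero(3,1) e_nonzero, of 0 i]
    triangular_nonzero(1)[OF triangular f_nonzero one_nonzero(1,2), of i 0]
    triangular_nonzero(2)[OF triangular one_nonzero(3,1,2), of z 0]
  by (simp_all add: jw_simps ju_simps jv_simps int_pow_0[OF c_invertible])

lemma P_top: "P hi j = (if j = hi then k \<mu> else 0)"
  using P_same_ht[OF ht_\<kappa>_le_top] \<mu> by auto

text \<open>\<open>B\<close> has no explicit formula, but the top column of \<open>A\<close> has a
  single nonzero entry, so one column of the equation B A = 1 can be solved.\<close>

lemma B_top: "B i hi = (if i = hi then k (- \<mu>) else 0)"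
proof -
  have A: "A l hi = (if l = hi then k \<mu> else 0)" for l
    using A_same_ht[OF ht_\<kappa>_le_top, of l] \<mu> by auto
  have "B i hi * k \<mu> = (if i = hi then 1 else 0)"
    using A_B(2)[of i hi] by (simp add: A if_distrib[of "\<lambda>x. _ * x"] cong: if_cong)
  then have "B i hi * k \<mu> * k (- \<mu>) = (if i = hi then k (- \<mu>) else 0)" by simp
  then show ?thesis using k_minus[OF \<mu>(2)] by (simp add: mult.assoc)
qed

text \<open>Take the relation of e^i with an entry \<open>P j l\<close> whose weights differ by
  \<open>\<alpha> s\<close>. Its term a = j reproduces that entry; its term a = l contains
  \<open>E s\<close> acting on the generators. Solved for the latter, the relation is a
  q-commutator.\<close>

lemma eb_action:
  assumes s: "s < n" and nz: "T (E s) \<noteq> 0"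
  shows "(\<Sum>b\<in>UNIV. T (E s) $ i $ b *\<^sub>C eb b) = ju (E s) * eb i - k (\<alpha> s) * eb i * k (- \<alpha> s) * ju (E s)"
proof -
  obtain j l where jl: "T (F s) $ j $ l \<noteq> 0" using T_F_nonzero_if[OF s nz] by (auto simp: vec_eq_iff)
  then have \<kappa>: "\<kappa> l = \<kappa> j + \<alpha> s" by (rule T_F_wt[OF s])
  have "l \<noteq> j" using \<kappa> \<alpha>_pos[OF s] by auto
  let ?x = "cs s * T (F s) $ j $ l"
  let ?q = "qpow h (\<kappa> i \<bullet> \<kappa> j)"
  let ?\<Sigma> = "\<Sum>b\<in>UNIV. T (E s) $ i $ b *\<^sub>C eb b"
  have x: "?x \<noteq> 0" using jl cs_nonzero[OF s] by simp
  \<comment> \<open>A nonzero R-entry with \<open>a\<close> different from \<open>j\<close> puts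
    \<open>a\<close> at least one step above \<open>j\<close>, hence at least as high as
    \<open>l\<close>, and there \<open>P a l\<close> vanishes off the diagonal.\<close>
  have zero: "RV $ (i, j) $ (b, a) *\<^sub>C (P a l * eb b) = 0" if a: "a \<noteq> j" "a \<noteq> l" for a b
  proof (cases "RV $ (i, j) $ (b, a) = 0 \<or> ht (\<kappa> a) \<le> ht (\<kappa> j)")
    case True then show ?thesis using a by (auto simp: RV_same_ht cvs.scale_zero_left)
  next
    case False
    then obtain r where r: "r \<in> exponents (length w) CARD('p)" "\<kappa> a = \<kappa> j + wt r"
      by (auto elim: RV_nonzero)
    then have "r \<noteq> r0" using False by (auto simp: wt_r0)
    then have "ht (\<kappa> l) \<le> ht (\<kappa> a)"
      using ht_wt_pos[OF r(1)] s by (simp add: r(2) \<kappa> ht_add ht_\<alpha>)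
    then show ?thesis using a by (simp add: P_same_ht cvs.scale_zero_right)
  qed
  have "eb i * P j l = (\<Sum>b\<in>UNIV. RV $ (i, j) $ (b, j) *\<^sub>C (P j l * eb b)) + (\<Sum>b\<in>UNIV. RV $ (i, j) $ (b, l) *\<^sub>C (P l l * eb b))"
    unfolding eb_P by (rule sum_two, use \<open>l \<noteq> j\<close> in simp, rule sum.neutral, simp add: zero)
  also have "(\<Sum>b\<in>UNIV. RV $ (i, j) $ (b, j) *\<^sub>C (P j l * eb b)) = (\<Sum>b\<in>UNIV. if b = i then ?q *\<^sub>C (P j l * eb i) else 0)"
    by (rule sum.cong) (auto simp: RV_same_ht cvs.scale_zero_left)
  also have "\<dots> = ?q *\<^sub>C (P j l * eb i)" by simp
  also have "(\<Sum>b\<in>UNIV. RV $ (i, j) $ (b, l) *\<^sub>C (P l l * eb b)) = (?q * ?x) *\<^sub>C (k (- \<kappa> l) * ?\<Sigma>)"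
    by (simp add: RV_simple[OF s] \<kappa> P_same_ht sum_distrib_left cvs.scale_sum_right scaleC_simps ac_simps)
  finally have "?x *\<^sub>C (?q *\<^sub>C (k (- \<kappa> l) * ?\<Sigma>)) = ?x *\<^sub>C (?q *\<^sub>C (k (- \<kappa> l) * (ju (E s) * eb i)) - eb i * k (- \<kappa> l) * ju (E s))"
    unfolding P_simple[OF s \<kappa>]
    by (simp add: scaleC_simps mult.assoc cvs.scale_minus_right cvs.scale_right_diff_distrib algebra_simps)
  then have "?q *\<^sub>C (k (- \<kappa> l) * ?\<Sigma>) = ?q *\<^sub>C (k (- \<kappa> l) * (ju (E s) * eb i)) - eb i * k (- \<kappa> l) * ju (E s)"
    by (rule iffD1[OF scaleC_cancel[OF x]])
  also have "eb i * k (- \<kappa> l) * ju (E s) = ?q *\<^sub>C (k (- \<kappa> l) * (qpow h (\<alpha> s \<bullet> \<kappa> i) *\<^sub>C (eb i * ju (E s))))"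
  proof -
    have "\<kappa> l \<bullet> \<kappa> i = \<kappa> i \<bullet> \<kappa> j + \<alpha> s \<bullet> \<kappa> i" by (simp add: \<kappa> inner_add_right inner_commute)
    then show ?thesis
      by (simp add: comm_eD[OF comm_\<kappa>(1)] scaleC_simps qpow_add mult.assoc)
  qed
  also have "?q *\<^sub>C (k (- \<kappa> l) * (ju (E s) * eb i)) - \<dots> = ?q *\<^sub>C (k (- \<kappa> l) * (ju (E s) * eb i - qpow h (\<alpha> s \<bullet> \<kappa> i) *\<^sub>C (eb i * ju (E s))))"
    by (simp only: cvs.scale_right_diff_distrib right_diff_distrib)
  finally have "?\<Sigma> = ju (E s) * eb i - qpow h (\<alpha> s \<bullet> \<kappa> i) *\<^sub>C (eb i * ju (E s))"
    by (simp only: scaleC_cancel[OF qpow_nonzero] k_cancel[OF L_minus[OF L_\<kappa>]])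
  \<comment> \<open>The power of q depends on \<open>i\<close>. Conjugation by
    \<open>k (\<alpha> s)\<close> replaces it by an expression uniform in \<open>i\<close>, so that
    the formula extends to linear combinations of the e^i.\<close>
  also have "qpow h (\<alpha> s \<bullet> \<kappa> i) *\<^sub>C (eb i * ju (E s)) = k (\<alpha> s) * k (- \<alpha> s) * (qpow h (\<alpha> s \<bullet> \<kappa> i) *\<^sub>C (eb i * ju (E s)))"
    using k_minus[OF L_\<alpha>[OF s]] by simp
  also have "\<dots> = k (\<alpha> s) * (eb i * k (- \<alpha> s)) * ju (E s)"
    using comm_eD[OF comm_uminus(1)[OF L_\<alpha>[OF s] comm_\<alpha>(1)[OF s nz]], of i]
    by (simp add: scaleC_simps mult.assoc)
  finally show ?thesis by (simp add: mult.assoc)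
qed

text \<open>The counterpart of \<open>eb_action\<close>, with \<open>A\<close> in place of
  \<open>P\<close>: in \<open>A_fb\<close> the generators f sit in the second tensor slot, so the
  matrix of \<open>F s\<close> appears.\<close>

lemma fb_action:
  assumes s: "s < n" and nz: "T (E s) \<noteq> 0"
  shows "(\<Sum>a\<in>UNIV. T (F s) $ a $ i *\<^sub>C fb a) = fb i * ju (F s) - ju (F s) * k (\<alpha> s) * fb i * k (- \<alpha> s)"
proof -
  obtain l j where lj: "T (E s) $ l $ j \<noteq> 0" using nz by (auto simp: vec_eq_iff)
  then have \<kappa>: "\<kappa> l = \<kappa> j + \<alpha> s" by (rule T_E_wt[OF s])
  have "l \<noteq> j" using \<kappa> \<alpha>_pos[OF s] by auto
  let ?x = "cs s * T (E s) $ l $ j"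
  let ?q = "qpow h (\<alpha> s \<bullet> \<kappa> i)" and ?q2 = "qpow h (- (\<alpha> s \<bullet> \<alpha> s))"
  let ?\<Sigma> = "\<Sum>a\<in>UNIV. T (F s) $ a $ i *\<^sub>C fb a"
  have x: "?x * ?q2 \<noteq> 0" using lj cs_nonzero[OF s] by (simp add: qpow_nonzero)
  have zero: "RV $ (l, a) $ (y, i) *\<^sub>C (fb a * A y j) = 0" if y: "y \<noteq> l" "y \<noteq> j" for a y
  proof (cases "RV $ (l, a) $ (y, i) = 0 \<or> ht (\<kappa> l) \<le> ht (\<kappa> y)")
    case True then show ?thesis using y by (auto simp: RV_same_ht cvs.scale_zero_left)
  next
    case False
    then obtain r where r: "r \<in> exponents (length w) CARD('p)" "\<kappa> l = \<kappa> y + wt r"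
      by (auto elim: RV_nonzero)
    then have "r \<noteq> r0" using False by (auto simp: wt_r0)
    moreover have "ht (\<kappa> j) + 1 = ht (\<kappa> y) + ht (wt r)"
      using arg_cong[OF r(2), of ht] s by (simp add: \<kappa> ht_add ht_\<alpha>)
    ultimately have "ht (\<kappa> y) \<le> ht (\<kappa> j)" using ht_wt_pos[OF r(1)] by simp
    then show ?thesis using y by (simp add: A_same_ht cvs.scale_zero_right)
  qed
  have f_k: "fb a * k (- \<kappa> j) = qpow h (- (\<kappa> j \<bullet> \<kappa> a)) *\<^sub>C (k (- \<kappa> j) * fb a)" for a
    using comm_fD[OF comm_\<kappa>(2), of a j] by simp
  have "A l j * fb i = (\<Sum>a\<in>UNIV. RV $ (l, a) $ (l, i) *\<^sub>C (fb a * A l j)) + (\<Sum>a\<in>UNIV. RV $ (l, a) $ (j, i) *\<^sub>C (fb a * A j j))"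
    unfolding A_fb[of l j i] by (rule sum_two, use \<open>l \<noteq> j\<close> in simp, rule sum.neutral, simp add: zero)
  also have "(\<Sum>a\<in>UNIV. RV $ (l, a) $ (l, i) *\<^sub>C (fb a * A l j)) = (\<Sum>a\<in>UNIV. if a = i then qpow h (\<kappa> l \<bullet> \<kappa> i) *\<^sub>C (fb i * A l j) else 0)"
    by (rule sum.cong) (auto simp: RV_same_ht cvs.scale_zero_left)
  also have "\<dots> = qpow h (\<kappa> l \<bullet> \<kappa> i) *\<^sub>C (fb i * A l j)" by simp
  also have "(\<Sum>a\<in>UNIV. RV $ (l, a) $ (j, i) *\<^sub>C (fb a * A j j)) = (\<Sum>a\<in>UNIV. (?x * ?q2 * ?q) *\<^sub>C (k (- \<kappa> j) * (T (F s) $ a $ i *\<^sub>C fb a)))"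
  proof (rule sum.cong)
    fix a
    show "RV $ (l, a) $ (j, i) *\<^sub>C (fb a * A j j) = (?x * ?q2 * ?q) *\<^sub>C (k (- \<kappa> j) * (T (F s) $ a $ i *\<^sub>C fb a))"
    proof (cases "T (F s) $ a $ i = 0")
      case True then show ?thesis by (simp add: RV_simple[OF s] \<kappa> cvs.scale_zero_left cvs.scale_zero_right)
    next
      case False
      \<comment> \<open>A nonzero entry fixes the weight of the summation index, so the powers of q
        combine to a constant that can be taken out of the sum.\<close>
      then have "\<kappa> i = \<kappa> a + \<alpha> s" by (rule T_F_wt[OF s])
      then have "qpow h (\<kappa> l \<bullet> \<kappa> a) * qpow h (- (\<kappa> j \<bullet> \<kappa> a)) = ?q2 * ?q"
        by (simp add: \<kappa> inner_add_left inner_add_right flip: qpow_add)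
      then show ?thesis
        by (simp add: RV_simple[OF s] \<kappa>[symmetric] A_same_ht f_k scaleC_simps)
    qed
  qed simp
  also have "\<dots> = (?x * ?q2) *\<^sub>C (?q *\<^sub>C (k (- \<kappa> j) * ?\<Sigma>))"
    by (simp add: sum_distrib_left cvs.scale_sum_right scaleC_simps mult.assoc)
  also have "qpow h (\<kappa> l \<bullet> \<kappa> i) *\<^sub>C (fb i * A l j) = - ((?x * ?q2) *\<^sub>C (?q *\<^sub>C (k (- \<kappa> j) * (fb i * ju (F s)))))"
  proof -
    have "qpow h (\<kappa> l \<bullet> \<kappa> i) *\<^sub>C (fb i * k (- \<kappa> j)) = ?q *\<^sub>C (k (- \<kappa> j) * fb i)"
      by (simp add: f_k scaleC_simps \<kappa> inner_add_left qpow_add qpow_minus qpow_nonzero)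
    then have "qpow h (\<kappa> l \<bullet> \<kappa> i) *\<^sub>C (fb i * k (- \<kappa> j)) * ju (F s) = ?q *\<^sub>C (k (- \<kappa> j) * fb i) * ju (F s)" by simp
    then have "(?x * ?q2) *\<^sub>C (qpow h (\<kappa> l \<bullet> \<kappa> i) *\<^sub>C (fb i * (k (- \<kappa> j) * ju (F s)))) = (?x * ?q2) *\<^sub>C (?q *\<^sub>C (k (- \<kappa> j) * (fb i * ju (F s))))"
      by (simp add: scaleC_simps mult.assoc)
    then show ?thesis unfolding A_simple[OF s \<kappa>]
      by (simp add: scaleC_simps cvs.scale_minus_right ac_simps)
  qed
  also have "A l j * fb i = - ((?x * ?q2) *\<^sub>C (k (- \<kappa> j) * (ju (F s) * fb i)))"
    unfolding A_simple[OF s \<kappa>] by (simp add: scaleC_simps mult.assoc)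
  finally have "(?x * ?q2) *\<^sub>C (k (- \<kappa> j) * (?q *\<^sub>C ?\<Sigma>)) = (?x * ?q2) *\<^sub>C (k (- \<kappa> j) * (?q *\<^sub>C (fb i * ju (F s)) - ju (F s) * fb i))"
    by (simp add: cvs.scale_right_diff_distrib right_diff_distrib mult_scaleC_right algebra_simps)
  then have eq: "?q *\<^sub>C ?\<Sigma> = ?q *\<^sub>C (fb i * ju (F s)) - ju (F s) * fb i"
    by (simp only: scaleC_cancel[OF x] k_cancel[OF L_minus[OF L_\<kappa>]])
  have "ju (F s) * fb i = ju (F s) * (k (\<alpha> s) * k (- \<alpha> s)) * fb i"
    using k_minus[OF L_\<alpha>[OF s]] by simp
  also have "\<dots> = ?q *\<^sub>C (ju (F s) * k (\<alpha> s) * (fb i * k (- \<alpha> s)))"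
    using comm_fD[OF comm_uminus(2)[OF L_\<alpha>[OF s] comm_\<alpha>(2)[OF s nz]], of i]
    by (simp add: scaleC_simps mult.assoc qpow_minus qpow_nonzero scaleC_one)
  finally have "?q *\<^sub>C ?\<Sigma> = ?q *\<^sub>C (fb i * ju (F s) - ju (F s) * k (\<alpha> s) * (fb i * k (- \<alpha> s)))"
    using eq by (simp only: cvs.scale_right_diff_distrib)
  then show ?thesis by (simp only: scaleC_cancel[OF qpow_nonzero] mult.assoc)
qed

text \<open>The coefficient vectors x for which the combination of the e^i lies in the generated
  algebra form a subspace that contains the top basis vector and, by \<open>eb_action\<close>, is
  stable under the transposed \<open>E s\<close>. Cyclicity makes it everything; for f the operators
  are the \<open>F s\<close> themselves.\<close>

lemma bosonization_generated:
  assumes nz: "\<And>s. s < n \<Longrightarrow> T (E s) \<noteq> 0"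
    and G: "\<And>\<gamma>. \<gamma> \<in> L \<Longrightarrow> k \<gamma> \<in> generated_alg G" "\<And>z. int_pow c z \<in> generated_alg G"
      "\<And>s. s < n \<Longrightarrow> ju (E s) \<in> generated_alg G" "\<And>s. s < n \<Longrightarrow> ju (F s) \<in> generated_alg G"
      "eb hi \<in> generated_alg G" "fb hi \<in> generated_alg G"
  shows "generated_alg G = UNIV"
proof (rule triangular_generated[OF triangular])
  show "(1::'w) \<noteq> 0" "(1::'u) \<noteq> 0" "(1::'v) \<noteq> 0" by (rule one_nonzero)+
  show "int_pow c z \<in> generated_alg G" for z by (rule G)
  show ju_G: "ju x \<in> generated_alg G" for x
  proof (rule generated_alg_hom_image[where g = ju])
    show "alg_hom ju \<or> alg_antihom ju" using ju by simp
    show "x \<in> generated_alg (E ` {..<n} \<union> F ` {..<n} \<union> K ` L)" by (simp add: U_generated)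
  qed (use G in auto)
  have sum_axis: "(\<Sum>i\<in>UNIV. axis j 1 $ i *\<^sub>C g i) = g j" for j and g :: "'p \<Rightarrow> 'd"
    by (simp add: axis_def if_distrib[of "\<lambda>x. x *\<^sub>C _"] cvs.scale_zero_left scaleC_one cong: if_cong)
  have "(\<Sum>i\<in>UNIV. x $ i *\<^sub>C eb i) \<in> generated_alg G"
    if "x \<in> cyclic_span n (\<lambda>i. transpose (T (E i))) (axis hi 1)" for x
    using that
  proof induction
    case base show ?case unfolding sum_axis by (rule G)
  next
    case (add x y)
    then show ?case by (simp add: scaleC_add_left sum.distrib generated_alg.add)
  next
    case (scale x z)
    then have "z *\<^sub>C (\<Sum>i\<in>UNIV. x $ i *\<^sub>C eb i) \<in> generated_alg G" by (intro generated_alg.scale)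
    then show ?case by (simp add: cvs.scale_sum_right scaleC_scaleC)
  next
    case (act s x)
    let ?y = "\<Sum>i\<in>UNIV. x $ i *\<^sub>C eb i"
    have "(\<Sum>b\<in>UNIV. (transpose (T (E s)) *v x) $ b *\<^sub>C eb b) = (\<Sum>i\<in>UNIV. x $ i *\<^sub>C (\<Sum>b\<in>UNIV. T (E s) $ i $ b *\<^sub>C eb b))"
      by (simp add: matrix_vector_mult_def transpose_def cvs.scale_sum_left cvs.scale_sum_right scaleC_scaleC)
        (subst sum.swap, simp add: mult.commute)
    also have "\<dots> = ju (E s) * ?y - k (\<alpha> s) * ?y * k (- \<alpha> s) * ju (E s)"
      by (simp add: eb_action[OF act(1) nz[OF act(1)]] cvs.scale_right_diff_distrib sum_subtractf
          sum_distrib_left sum_distrib_right scaleC_simps)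
    also have "\<dots> \<in> generated_alg G"
      using act by (intro generated_alg_diff generated_alg.mult ju_G) auto
    finally show ?case .
  qed
  then have eb_G: "eb i \<in> generated_alg G" for i
    using sum_axis[of i eb] by (metis UNIV_I cyclic_E_transpose)
  have "(\<Sum>i\<in>UNIV. x $ i *\<^sub>C fb i) \<in> generated_alg G"
    if "x \<in> cyclic_span n (\<lambda>i. T (F i)) (axis hi 1)" for x
    using that
  proof induction
    case base show ?case unfolding sum_axis by (rule G)
  next
    case (add x y)
    then show ?case by (simp add: scaleC_add_left sum.distrib generated_alg.add)
  next
    case (scale x z)
    then have "z *\<^sub>C (\<Sum>i\<in>UNIV. x $ i *\<^sub>C fb i) \<in> generated_alg G" by (intro generated_alg.scale)
    then show ?case by (simp add: cvs.scale_sum_right scaleC_scaleC)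
  next
    case (act s x)
    let ?y = "\<Sum>i\<in>UNIV. x $ i *\<^sub>C fb i"
    have "(\<Sum>b\<in>UNIV. (T (F s) *v x) $ b *\<^sub>C fb b) = (\<Sum>i\<in>UNIV. x $ i *\<^sub>C (\<Sum>b\<in>UNIV. T (F s) $ b $ i *\<^sub>C fb b))"
      by (simp add: matrix_vector_mult_def cvs.scale_sum_left cvs.scale_sum_right scaleC_scaleC)
        (subst sum.swap, simp add: mult.commute)
    also have "\<dots> = ?y * ju (F s) - ju (F s) * k (\<alpha> s) * ?y * k (- \<alpha> s)"
      by (simp add: fb_action[OF act(1) nz[OF act(1)]] cvs.scale_right_diff_distrib sum_subtractf
          sum_distrib_left sum_distrib_right scaleC_simps)
    also have "\<dots> \<in> generated_alg G"
      using act by (intro generated_alg_diff generated_alg.mult ju_G) auto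
    finally show ?case .
  qed
  then have fb_G: "fb i \<in> generated_alg G" for i
    using sum_axis[of i fb] by (metis UNIV_I cyclic_F)
  show "jv x \<in> generated_alg G" for x
  proof (rule generated_alg_hom_image[where g = jv])
    show "alg_hom jv \<or> alg_antihom jv" using jv by simp
    show "x \<in> generated_alg (e ` UNIV)"
      using presented_by_generated[OF V[unfolded vector_algebra_def]] by simp
  qed (use eb_G in auto)
  show "jw x \<in> generated_alg G" for x
  proof (rule generated_alg_hom_image[where g = jw])
    show "alg_hom jw \<or> alg_antihom jw" using jw by simp
    show "x \<in> generated_alg (f ` UNIV)"
      using presented_by_generated[OF V_dual[unfolded covector_algebra_def]] by simp
  qed (use fb_G in auto)
qed


section \<open>The group-like elements\<close>

text \<open>On \<open>L\<close> times the integers this is a homomorphism, which reduces all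
  computations with group-likes to additions of exponents.\<close>

definition G :: "'e \<Rightarrow> int \<Rightarrow> 'd" where
  "G \<gamma> z = k \<gamma> * int_pow c z"

lemma int_pow_c_ju: "int_pow c z * ju x = ju x * int_pow c z"
  by (rule int_pow_commute[OF c_invertible c_ju])

lemma G_0: "G 0 0 = 1"
  by (simp add: G_def k_0 int_pow_0[OF c_invertible])

lemma G_c_0: "G \<gamma> 0 = k \<gamma>"
  by (simp add: G_def int_pow_0[OF c_invertible])

lemma G_mult:
  assumes "\<gamma> \<in> L" "\<delta> \<in> L"
  shows "G \<gamma> y * G \<delta> z = G (\<gamma> + \<delta>) (y + z)"
proof -
  have "G \<gamma> y * G \<delta> z = k \<gamma> * (int_pow c y * k \<delta>) * int_pow c z" by (simp add: G_def mult.assoc)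
  also have "\<dots> = k \<gamma> * k \<delta> * (int_pow c y * int_pow c z)" by (simp only: int_pow_c_ju mult.assoc)
  finally show ?thesis by (simp add: G_def k_mult[OF assms] int_pow_add[OF c_invertible])
qed

lemma G_inverse:
  assumes "\<gamma> \<in> L"
  shows "invertible_elem (G \<gamma> z)" "inv_elem (G \<gamma> z) = G (- \<gamma>) (- z)"
proof -
  have "G \<gamma> z * G (- \<gamma>) (- z) = 1" "G (- \<gamma>) (- z) * G \<gamma> z = 1"
    using assms by (simp_all add: G_mult L_minus G_0)
  then show "invertible_elem (G \<gamma> z)" "inv_elem (G \<gamma> z) = G (- \<gamma>) (- z)"
    by (auto intro: invertible_elemI inv_elem_unique)
qed

lemma G_int_pow:
  assumes "\<gamma> \<in> L"
  shows "int_pow (G \<gamma> y) z = G (of_int z *\<^sub>R \<gamma>) (z * y)"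
  using int_pow_of_hom[of "\<lambda>z. G (of_int z *\<^sub>R \<gamma>) (z * y)" z] assms
  by (simp add: G_0 G_mult L_scale scaleR_left_distrib distrib_right)

lemma G_torus:
  assumes "\<And>i. i < r \<Longrightarrow> \<gamma> i \<in> L"
  shows "torus_monomial r (\<lambda>i. G (\<gamma> i) (y i)) z = G (\<Sum>i<r. of_int (z i) *\<^sub>R \<gamma> i) (\<Sum>i<r. z i * y i)"
  using assms
proof (induction r)
  case 0 show ?case by (simp add: torus_monomial_def G_0)
next
  case (Suc r)
  have "torus_monomial (Suc r) (\<lambda>i. G (\<gamma> i) (y i)) z = torus_monomial r (\<lambda>i. G (\<gamma> i) (y i)) z * int_pow (G (\<gamma> r) (y r)) (z r)"
    by (simp add: torus_monomial_def)
  moreover have "(\<Sum>i<r. of_int (z i) *\<^sub>R \<gamma> i) \<in> L" by (rule L_sum) (simp add: L_scale Suc.prems)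
  ultimately show ?case using Suc by (simp add: G_int_pow G_mult L_scale)
qed

lemma juE_G: "\<gamma> \<in> L \<Longrightarrow> s < n \<Longrightarrow> ju (E s) * G \<gamma> z = qpow h (\<gamma> \<bullet> \<alpha> s) *\<^sub>C (G \<gamma> z * ju (E s))"
  and juF_G: "\<gamma> \<in> L \<Longrightarrow> s < n \<Longrightarrow> ju (F s) * G \<gamma> z = qpow h (- (\<gamma> \<bullet> \<alpha> s)) *\<^sub>C (G \<gamma> z * ju (F s))"
  unfolding G_def
  by (subst mult.assoc [symmetric], simp add: juE_k juF_k mult_scaleC_left mult.assoc int_pow_c_ju)+

text \<open>Commutation with \<open>E s\<close> detects the product of \<open>\<gamma>\<close> with
  \<open>\<alpha> s\<close> but not the power of \<open>c\<close>, which commutes with U_q; that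
  power is recovered from the triangular decomposition.\<close>

lemma G_eq_1:
  assumes nz: "\<And>s. s < n \<Longrightarrow> E s \<noteq> 0" and \<gamma>: "\<gamma> \<in> L" and "G \<gamma> z = 1"
  shows "\<gamma> = 0" "z = 0"
proof -
  have "\<alpha> s \<bullet> \<gamma> = 0" if s: "s < n" for s
  proof (rule qpow_eq_1_imp[OF q_generic L_rational[OF \<gamma> s]])
    have "qpow h (\<gamma> \<bullet> \<alpha> s) *\<^sub>C ju (E s) = 1 *\<^sub>C ju (E s)"
      using juE_G[OF \<gamma> s, of z] \<open>G \<gamma> z = 1\<close> by (simp add: scaleC_one)
    then show "qpow h (\<alpha> s \<bullet> \<gamma>) = 1"
      using ju_nonzero[OF nz[OF s]] by (simp only: cvs.scale_cancel_right inner_commute) simp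
  qed
  then show "\<gamma> = 0" using span_orth_0[OF L_span[OF \<gamma>]] by blast
  then show "z = 0" using \<open>G \<gamma> z = 1\<close> by (intro int_pow_c_eq_1) (simp add: G_def k_0)
qed

section \<open>Group-likes and the coproducts of the top generators\<close>

lemma \<Delta>: "alg_hom \<Delta>" and tensor: "tensor_square in1 in2"
  and coproduct: "bosonization_coproduct n \<alpha> L (ju \<circ> E) (ju \<circ> F) (ju \<circ> K) (jv \<circ> e) (jw \<circ> f)
       (\<lambda>i j. ju (mp i j)) (\<lambda>i j. ju (mm i j)) c in1 in2 \<Delta>"
  using D by (auto simp: double_bosonization_def bosonization_coproduct_def)

lemma in_hom: "alg_hom in1" "alg_hom in2" and in_commute: "in1 x * in2 y = in2 y * in1 x"
  using tensor by (auto simp: tensor_square_def)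

abbreviation "grouplike x \<equiv> \<Delta> x = in1 x * in2 x"

lemma grouplike_mult: assumes "grouplike x" "grouplike y" shows "grouplike (x * y)"
proof -
  have "\<Delta> (x * y) = in1 x * (in2 x * in1 y) * in2 y"
    by (simp add: alg_hom_simps[OF \<Delta>] assms mult.assoc)
  also have "\<dots> = in1 (x * y) * in2 (x * y)"
    by (simp add: in_commute[symmetric] alg_hom_simps[OF in_hom(1)] alg_hom_simps[OF in_hom(2)] mult.assoc)
  finally show ?thesis .
qed

lemma grouplike_inv_elem:
  assumes x: "grouplike x" "invertible_elem x"
  shows "grouplike (inv_elem x)"
proof -
  note inv = inv_elem[OF x(2)]
  have in1: "in1 x * in1 (inv_elem x) = 1" "in1 (inv_elem x) * in1 x = 1"
    and in2: "in2 x * in2 (inv_elem x) = 1" "in2 (inv_elem x) * in2 x = 1"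
    using inv alg_hom_simps(1,4)[OF in_hom(1)] alg_hom_simps(1,4)[OF in_hom(2)] by metis+
  have "inv_elem (\<Delta> x) = in1 (inv_elem x) * in2 (inv_elem x)"
  proof (rule inv_elem_unique)
    have "\<Delta> x * (in1 (inv_elem x) * in2 (inv_elem x)) = in1 x * (in2 x * in1 (inv_elem x)) * in2 (inv_elem x)"
      by (simp add: x mult.assoc)
    also have "\<dots> = in1 x * in1 (inv_elem x) * (in2 x * in2 (inv_elem x))"
      by (simp only: in_commute[symmetric] mult.assoc)
    finally show "\<Delta> x * (in1 (inv_elem x) * in2 (inv_elem x)) = 1" by (simp add: in1 in2)
    have "in1 (inv_elem x) * in2 (inv_elem x) * \<Delta> x = in1 (inv_elem x) * (in2 (inv_elem x) * in1 x) * in2 x"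
      by (simp add: x mult.assoc)
    also have "\<dots> = in1 (inv_elem x) * in1 x * (in2 (inv_elem x) * in2 x)"
      by (simp only: in_commute[symmetric] mult.assoc)
    finally show "in1 (inv_elem x) * in2 (inv_elem x) * \<Delta> x = 1" by (simp add: in1 in2)
  qed
  then show ?thesis using alg_hom_inv_elem[OF \<Delta> x(2)] by simp
qed

lemma grouplike_power: "grouplike x \<Longrightarrow> grouplike (x ^ i)"
proof (induction i)
  case 0 show ?case by (simp add: alg_hom_simps[OF \<Delta>] alg_hom_simps[OF in_hom(1)] alg_hom_simps[OF in_hom(2)])
next
  case (Suc i) then show ?case using grouplike_mult[of x "x ^ i"] by simp
qed

lemma grouplike_G: assumes "\<gamma> \<in> L" shows "grouplike (G \<gamma> z)"
proof -
  have k: "grouplike (k \<gamma>)" and c: "grouplike c"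
    using coproduct assms by (auto simp: bosonization_coproduct_def)
  have "grouplike (int_pow c z)"
    using c grouplike_inv_elem[OF c c_invertible] by (auto simp: int_pow_def intro!: grouplike_power)
  then show ?thesis unfolding G_def by (rule grouplike_mult[OF k])
qed

lemma \<Delta>_E: "s < n \<Longrightarrow> \<Delta> (ju (E s)) = in1 (ju (E s)) * in2 (k (\<alpha> s)) + in2 (ju (E s))"
  and \<Delta>_F: "s < n \<Longrightarrow> \<Delta> (ju (F s)) = in1 (ju (F s)) + in1 (k (- \<alpha> s)) * in2 (ju (F s))"
  and \<Delta>_e: "\<Delta> (eb i) = (\<Sum>a\<in>UNIV. in1 (eb a) * in2 (P i a * inv_elem c)) + in2 (eb i)"
  and \<Delta>_f: "\<Delta> (fb i) = in1 (fb i) + (\<Sum>a\<in>UNIV. in1 (c * B a i) * in2 (fb a))"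
  using coproduct by (simp_all add: bosonization_coproduct_def mp_def mm_def \<phi>_def)

lemma G_top: "P hi hi * inv_elem c = G \<mu> (- 1)" "c * B hi hi = G (- \<mu>) 1"
  by (simp_all add: P_top B_top G_def int_pow_1[OF c_invertible] int_pow_minus_1[OF c_invertible] c_ju)

lemma \<Delta>_e_top: "\<Delta> (eb hi) = in1 (eb hi) * in2 (G \<mu> (- 1)) + in2 (eb hi)"
proof -
  have "(\<Sum>a\<in>UNIV. in1 (eb a) * in2 (P hi a * inv_elem c)) = (\<Sum>a\<in>UNIV. if a = hi then in1 (eb hi) * in2 (G \<mu> (- 1)) else 0)"
    by (rule sum.cong) (auto simp: P_top alg_hom_simps[OF in_hom(2)] simp flip: G_top)
  then show ?thesis by (simp add: \<Delta>_e)
qed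

lemma \<Delta>_f_top: "\<Delta> (fb hi) = in1 (fb hi) + in1 (G (- \<mu>) 1) * in2 (fb hi)"
proof -
  have "(\<Sum>a\<in>UNIV. in1 (c * B a hi) * in2 (fb a)) = (\<Sum>a\<in>UNIV. if a = hi then in1 (G (- \<mu>) 1) * in2 (fb hi) else 0)"
    by (rule sum.cong) (auto simp: B_top alg_hom_simps[OF in_hom(1)] simp flip: G_top)
  then show ?thesis by (simp add: \<Delta>_f)
qed

text \<open>On a one-dimensional module of weight zero all matrices are scalars with R_VV = P = 1.
  The only eigenvalue of PR is then R itself, so R = -1, while \<lambda> R = 1.\<close>

lemma trivial_module_lam:
  assumes "RV = mat lam ** R" "eigenvalue_of (perm_matrix ** R) (- 1)" "s < n" "T (E s) = 0"
  shows "lam = - 1"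
proof -
  note triv = trivial_module[OF assms(3,4)]
  have hi: "x = (hi, hi)" for x :: "'p \<times> 'p" using triv(2)[of "fst x"] triv(2)[of "snd x"] by (simp add: prod_eq_iff)
  have "UNIV = {(hi, hi)}" using hi by auto
  then have sum: "(\<Sum>x\<in>UNIV. g x) = g (hi, hi)" for g :: "'p \<times> 'p \<Rightarrow> complex"
    unfolding \<open>UNIV = _\<close> by simp
  have "RV $ (hi, hi) $ (hi, hi) = 1"
    by (simp add: RV_same_ht triv(1) qpow_0)
  then have R: "lam * R $ (hi, hi) $ (hi, hi) = 1"
    unfolding assms(1) mat_mult_entry .
  obtain v where v: "v \<noteq> 0" "(perm_matrix ** R) *v v = (- 1) *s v"
    using assms(2) unfolding eigenvalue_of_def by blast
  have "v $ (hi, hi) \<noteq> 0"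
  proof
    assume "v $ (hi, hi) = 0"
    then have "v = 0" unfolding vec_eq_iff using hi by (metis zero_index)
    then show False using v by simp
  qed
  moreover have "R $ (hi, hi) $ (hi, hi) * v $ (hi, hi) = - v $ (hi, hi)"
    using arg_cong[OF v(2), of "\<lambda>v. v $ (hi, hi)"]
    by (simp add: matrix_vector_mult_def matrix_matrix_mult_def sum perm_matrix_def)
  ultimately have "R $ (hi, hi) $ (hi, hi) = - 1"
    by (metis mult_cancel_right mult_minus1)
  then show ?thesis using R by (simp add: minus_equation_iff)
qed

text \<open>The trivial representation is excluded by the weight of \<open>c\<^sup>-\<^sup>1\<close>: it would give \<open>\<lambda> = - 1\<close>,
  which is not a rational power of \<open>q\<close>.\<close>

lemma nontrivial:
  assumes R: "RV = mat lam ** R" "eigenvalue_of (perm_matrix ** R) (- 1)"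
    and x: "x \<in> \<rat>" "eb hi * inv_elem c = qpow h x *\<^sub>C (inv_elem c * eb hi)" and s: "s < n"
  shows "T (E s) \<noteq> 0"
proof
  assume "T (E s) = 0"
  then have lam: "lam = - 1" using trivial_module_lam[OF R s] by blast
  note inv = inv_elem[OF c_invertible]
  have "inv_elem c * eb hi = inv_elem c * (eb hi * c) * inv_elem c"
    using inv by (simp add: mult.assoc)
  also have "\<dots> = - (eb hi * inv_elem c)"
    by (simp only: eb_c lam mult_scaleC_left mult_scaleC_right)
      (simp add: inv cvs.scale_minus_left scaleC_one flip: mult.assoc)
  finally have eq: "eb hi * inv_elem c = - (inv_elem c * eb hi)" by simp
  have "inv_elem c * eb hi \<noteq> 0"
  proof
    assume "inv_elem c * eb hi = 0"
    then have "c * inv_elem c * eb hi = 0" by (simp add: mult.assoc)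
    then show False using inv eb_nonzero by simp
  qed
  moreover have "(qpow h x + 1) *\<^sub>C (inv_elem c * eb hi) = 0"
    by (simp add: scaleC_add_left scaleC_one x(2) [symmetric] eq)
  ultimately have "qpow h x = - 1" by (simp add: cvs.scale_eq_0_iff eq_neg_iff_add_eq_0)
  \<comment> \<open>Squaring removes the sign; the rational exponent 2x must then be zero, but q^0
    is not -1.\<close>
  then have "qpow h (x + x) = 1" by (simp only: qpow_add) simp
  then have "x + x = 0" using x(1) by (intro qpow_eq_1_imp[OF q_generic]) auto
  then show False using \<open>qpow h x = - 1\<close> by (simp add: qpow_0)
qed

end

section \<open>The quantum group of rank n + 1\<close>

lemma adjoin_less: "i < n \<Longrightarrow> adjoin n X y i = X i" and adjoin_eq: "adjoin n X y n = y"
  by (simp_all add: adjoin_def)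

theorem proposition4p1:
  fixes h :: complex
    and \<Phi> :: "'e::euclidean_space set" and n m :: nat and \<alpha> :: "nat \<Rightarrow> 'e" and L :: "'e set"
    and E F :: "nat \<Rightarrow> 'u::complex_algebra_1" and K :: "'e \<Rightarrow> 'u"
    and S :: "'u \<Rightarrow> 'u" and \<tau> :: "nat \<Rightarrow> 'u \<Rightarrow> 'u" and w :: "nat list"
    and T :: "'u \<Rightarrow> complex^('p::{finite,linorder})^('p::{finite,linorder})" and \<kappa> :: "'p \<Rightarrow> 'e" and \<mu> \<nu> :: 'e
    and RVV R R' :: "complex^('p \<times> 'p)^('p \<times> 'p)" and lam :: complex
    and lm :: "'p \<Rightarrow> 'p \<Rightarrow> 'u" and mp mm :: "'p \<Rightarrow> 'p \<Rightarrow> 'u"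
    and e :: "'p \<Rightarrow> 'v::complex_algebra_1" and f :: "'p \<Rightarrow> 'w::complex_algebra_1"
    and jw :: "'w \<Rightarrow> 'd::complex_algebra_1" and ju :: "'u \<Rightarrow> 'd" and c :: 'd and jv :: "'v \<Rightarrow> 'd"
    and in1 in2 \<Delta> :: "'d \<Rightarrow> 't::complex_algebra_1"
    and EE FF KK :: "nat \<Rightarrow> 'd" and \<alpha>\<alpha> :: "nat \<Rightarrow> 'e"
  assumes q_generic: "not_root_of_unity h"
    and lie_type: "simple_lie_type \<Phi> n \<alpha>"
    and rational_form: "\<forall>i<n. \<forall>j<n. \<alpha> i \<bullet> \<alpha> j \<in> \<rat>"
    and m_pos: "m > 0"
    and L_def: "L = weight_lattice n \<alpha> m"
    and U: "uq_ext h n \<alpha> L E F K"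
    and antipode: "uq_antipode n \<alpha> L E F K S"
    and braid: "braid_action h n \<alpha> L E F K \<tau>"
    and longest: "reduced_longest \<Phi> n \<alpha> w"
    and irreducible: "irreducible_rep n \<alpha> E F K T"
    and weights: "weight_basis h n L E F K T \<kappa>"
    and highest_weight: "\<kappa> top_index = - \<mu>"
    and RVV_def: "RVV = R_VV h n \<alpha> w \<tau> E F T \<kappa>"
    and normalization: "RVV = mat lam ** R"
    and lam_nonzero: "lam \<noteq> 0"
    and R': "braided_pair R' R"
    and l_minus: "inverse_matrices (l_hat h n \<alpha> w \<tau> E F K T \<kappa>) lm"
    and mp_def: "\<And>i j. mp i j = S (l_plus h n \<alpha> w \<tau> E F K T \<kappa> i j)"
    and mm_def: "\<And>i j. mm i j = S (lm i j)"
    and V: "vector_algebra R' e"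
    and V_dual: "covector_algebra R' f"
    and D: "double_bosonization n \<alpha> L E F K e f mp mm RVV lam (qroot h (\<mu> + \<nu>))
              jw ju c jv in1 in2 \<Delta>"
    and EE_def: "EE = adjoin n (ju \<circ> E) (jv (e top_index))"
    and FF_def: "FF = adjoin n (\<lambda>i. - ju (F i)) (jw (f top_index))"
    and KK_def: "KK = adjoin n (\<lambda>i. ju (K (\<alpha> i))) (ju (mp top_index top_index) * inv_elem c)"
    and roots_def: "\<alpha>\<alpha> = adjoin n \<alpha> (\<mu> + \<nu>)"
    and nu_weight: "has_weight h (Suc n) \<alpha>\<alpha> EE FF (inv_elem c) \<nu>"
  shows "quantum_group h (Suc n)
           (\<lambda>i j. if i < n \<and> j < n then 2 * (\<alpha> i \<bullet> \<alpha> j) / (\<alpha> i \<bullet> \<alpha> i)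
                  else if i < n then 2 * (\<alpha> i \<bullet> \<mu>) / (\<alpha> i \<bullet> \<alpha> i)
                  else if j < n then 2 * (\<mu> \<bullet> \<alpha> j) / (\<mu> \<bullet> \<mu> + \<nu> \<bullet> \<nu>)
                  else 2)
           (\<lambda>i. (\<alpha>\<alpha> i \<bullet> \<alpha>\<alpha> i) / 2)
           {ju (K \<beta>) * int_pow c k | \<beta> k. \<beta> \<in> L}
           EE FF KK in1 in2 \<Delta>
       \<and> \<nu> \<bullet> \<mu> = 0 \<and> (\<forall>i<n. \<nu> \<bullet> \<alpha> i = 0)"
proof -
  interpret bosonized_module h \<Phi> n m \<alpha> L E F K \<tau> w T \<kappa> S \<mu> R' lam "qroot h (\<mu> + \<nu>)" lm mp mm
    e f jw ju c jv in1 in2 \<Delta>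
    by unfold_locales (fact q_generic lie_type rational_form m_pos L_def U braid longest irreducible
        weights antipode highest_weight l_minus mp_def mm_def V V_dual D[unfolded RVV_def])+
  have EE: "EE i = ju (E i)" "FF i = - ju (F i)" "\<alpha>\<alpha> i = \<alpha> i" if "i < n" for i
    using that by (simp_all add: EE_def FF_def roots_def adjoin_less)
  have EE_n: "EE n = eb hi" "FF n = fb hi" "\<alpha>\<alpha> n = \<mu> + \<nu>"
    by (simp_all add: EE_def FF_def roots_def adjoin_eq)
  \<comment> \<open>Exponents with \<open>KK i = G (\<gamma> i) (y i)\<close>; the new group-like is
    K_\<mu> c^(-1), whence the values \<mu> and -1.\<close>
  define \<gamma> where "\<gamma> = adjoin n \<alpha> \<mu>"
  define y where "y = (\<lambda>i. if i < n then 0 else - 1 :: int)"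
  have \<gamma>: "\<gamma> i \<in> L" for i
    using \<mu>(2) L_\<alpha> by (simp add: \<gamma>_def adjoin_def)
  have KK: "KK i = G (\<gamma> i) (y i)" for i
    using G_top(1) by (simp add: KK_def adjoin_def \<gamma>_def y_def G_c_0 mp_def \<phi>_def)
  have KK_n: "KK n = k \<mu> * inv_elem c"
    by (simp add: KK \<gamma>_def y_def adjoin_eq G_def int_pow_minus_1[OF c_invertible])
  have KK_less: "KK i = k (\<alpha> i)" if "i < n" for i
    using that by (simp add: KK \<gamma>_def y_def adjoin_less G_c_0)

  have weight: "\<alpha>\<alpha> i \<bullet> \<nu> \<in> \<rat>" "EE i * inv_elem c = qpow h (\<alpha>\<alpha> i \<bullet> \<nu>) *\<^sub>C (inv_elem c * EE i)"
    "FF i * inv_elem c = qpow h (- (\<alpha>\<alpha> i \<bullet> \<nu>)) *\<^sub>C (inv_elem c * FF i)" if "i < Suc n" for i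
    using nu_weight that by (auto simp: has_weight_def)
  have E_acts: "T (E s) \<noteq> 0" if "s < n" for s
  proof (rule nontrivial[OF _ _ weight(1)[of n] _ that])
    show "RV = mat lam ** R" using normalization RVV_def by simp
    show "eigenvalue_of (perm_matrix ** R) (- 1)" using R' by (simp add: braided_pair_def Let_def)
    show "eb hi * inv_elem c = qpow h (\<alpha>\<alpha> n \<bullet> \<nu>) *\<^sub>C (inv_elem c * eb hi)"
      using weight(2)[of n] by (simp add: EE_n)
  qed simp
  have E_nonzero: "E s \<noteq> 0" if "s < n" for s
    using E_acts[OF that] by (auto simp: T_simps)
  have F_nonzero: "F s \<noteq> 0" if "s < n" for s
    using T_F_nonzero_if[OF that E_acts[OF that]] by (auto simp: T_simps)

  have \<nu>_\<alpha>: "\<alpha> s \<bullet> \<nu> = 0" if s: "s < n" for s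
  proof (rule qpow_eq_1_imp[OF q_generic])
    show "\<alpha> s \<bullet> \<nu> \<in> \<rat>" using weight(1)[of s] s by (simp add: EE)
    have comm: "inv_elem c * ju (E s) = ju (E s) * inv_elem c"
      using int_pow_c_ju[of "- 1"] by (simp add: int_pow_minus_1[OF c_invertible])
    have "inv_elem c * ju (E s) \<noteq> 0"
    proof
      assume "inv_elem c * ju (E s) = 0"
      then have "c * inv_elem c * ju (E s) = 0" by (simp add: mult.assoc)
      then show False using ju_nonzero[OF E_nonzero[OF s]] by (simp add: inv_elem[OF c_invertible])
    qed
    moreover have "qpow h (\<alpha> s \<bullet> \<nu>) *\<^sub>C (inv_elem c * ju (E s)) = 1 *\<^sub>C (inv_elem c * ju (E s))"
      using weight(2)[of s] s comm by (simp add: EE scaleC_one)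
    ultimately show "qpow h (\<alpha> s \<bullet> \<nu>) = 1" by (simp only: cvs.scale_cancel_right) simp
  qed
  have \<nu>_\<mu>: "\<mu> \<bullet> \<nu> = 0"
    by (rule span_orthogonal[of "\<alpha> ` {..<n}" "{\<nu>}", OF _ L_span[OF \<mu>(2)] span_base]) (auto simp: \<nu>_\<alpha>)

  define H where "H = {ju (K \<beta>) * int_pow c k | \<beta> k. \<beta> \<in> L}"
  have H: "H = {G \<beta> z | \<beta> z. \<beta> \<in> L}" by (simp add: H_def G_def)
  have H_I: "G \<beta> z \<in> H" if "\<beta> \<in> L" for \<beta> z
    using that unfolding H by blast
  have H_E: Q if "x \<in> H" "\<And>\<beta> z. \<beta> \<in> L \<Longrightarrow> x = G \<beta> z \<Longrightarrow> Q" for x Q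
    using that unfolding H by blast
  define a where "a = (\<lambda>i j. if i < n \<and> j < n then 2 * (\<alpha> i \<bullet> \<alpha> j) / (\<alpha> i \<bullet> \<alpha> i)
                  else if i < n then 2 * (\<alpha> i \<bullet> \<mu>) / (\<alpha> i \<bullet> \<alpha> i)
                  else if j < n then 2 * (\<mu> \<bullet> \<alpha> j) / (\<mu> \<bullet> \<mu> + \<nu> \<bullet> \<nu>)
                  else 2)"
  define d where "d = (\<lambda>i. (\<alpha>\<alpha> i \<bullet> \<alpha>\<alpha> i) / 2)"
  \<comment> \<open>Multiplication by \<open>d i\<close> symmetrizes the matrix: the exponents of q
    are inner products. In these rows \<open>\<nu>\<close> does not appear, since \<open>c\<close>
    commutes with U_q.\<close>
  have da_less: "d i * a i j = \<gamma> j \<bullet> \<alpha> i" if "i < n" "j < Suc n" for i j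
    using \<alpha>_pos[OF that(1)] that(2) by (auto simp: d_def a_def EE that(1) \<gamma>_def adjoin_def inner_commute)
  have \<mu>\<nu>: "(\<mu> + \<nu>) \<bullet> (\<mu> + \<nu>) = \<mu> \<bullet> \<mu> + \<nu> \<bullet> \<nu>"
    using \<nu>_\<mu> by (simp add: inner_add_left inner_add_right inner_commute)
  have da_n: "d n * a n j = \<mu> \<bullet> \<alpha> j" if "j < n" for j
  proof (cases "\<mu> \<bullet> \<mu> + \<nu> \<bullet> \<nu> = 0")
    \<comment> \<open>If the denominator is zero then \<mu> = 0, so the value 0 of the quotient by
      zero is the correct exponent.\<close>
    case True
    then have "\<mu> \<bullet> \<mu> = 0" using inner_ge_zero[of \<mu>] inner_ge_zero[of \<nu>] by linarith
    then show ?thesis using that by (simp add: a_def)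
  qed (use that in \<open>simp add: d_def a_def EE_n \<mu>\<nu>\<close>)
  have da_nn: "d n * a n n = \<mu> \<bullet> \<mu> + \<nu> \<bullet> \<nu>"
    by (simp add: d_def a_def EE_n \<mu>\<nu>)

  have EF_K: "EE i * KK j = qpow h (d i * a i j) *\<^sub>C (KK j * EE i) \<and>
              FF i * KK j = qpow h (- (d i * a i j)) *\<^sub>C (KK j * FF i)" if ij: "i < Suc n" "j < Suc n" for i j
  proof -
    consider "i < n" | "i = n" "j < n" | "i = n" "j = n" using ij by linarith
    then show ?thesis
    proof cases
      case 1
      then show ?thesis using ij
        by (simp add: EE KK da_less juE_G[OF \<gamma>] juF_G[OF \<gamma>] cvs.scale_minus_right)
    next
      case 2
      then show ?thesis
        using comm_eD[OF comm_\<alpha>(1)[OF _ E_acts], of j hi] comm_fD[OF comm_\<alpha>(2)[OF _ E_acts], of j hi]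
        by (simp add: EE_n KK_less da_n \<mu> inner_commute)
    next
      case 3
      \<comment> \<open>\<open>KK n\<close> has two factors: K_\<mu> contributes (\<mu>, \<mu>)
        through \<open>comm_\<mu>\<close>, and c^(-1) contributes (\<nu>, \<nu>) through
        \<open>nu_weight\<close>.\<close>
      have "eb hi * k \<mu> * inv_elem c = qpow h (\<mu> \<bullet> \<mu>) *\<^sub>C (k \<mu> * (eb hi * inv_elem c))"
        using comm_eD[OF comm_\<mu>(1), of hi] by (simp add: \<mu> mult_scaleC_left mult.assoc)
      moreover have "fb hi * k \<mu> * inv_elem c = qpow h (- (\<mu> \<bullet> \<mu>)) *\<^sub>C (k \<mu> * (fb hi * inv_elem c))"
        using comm_fD[OF comm_\<mu>(2), of hi] by (simp add: \<mu> mult_scaleC_left mult.assoc)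
      moreover have "(\<mu> + \<nu>) \<bullet> \<nu> = \<nu> \<bullet> \<nu>" by (simp add: inner_add_left \<nu>_\<mu>)
      ultimately show ?thesis
        using weight(2,3)[of n] 3
        by (simp add: EE_n KK_n da_nn scaleC_simps qpow_add qpow_minus qpow_diff divide_inverse mult.assoc)
    qed
  qed

  have EF: "EE i * FF j - FF j * EE i =
        (if i = j then (1 / (qpow h (d i) - inverse (qpow h (d i)))) *\<^sub>C (KK i - inv_elem (KK i)) else 0)"
    if ij: "i < Suc n" "j < Suc n" for i j
  proof -
    consider "i < n" "j < n" | "i < n" "j = n" | "i = n" "j < n" | "i = n" "j = n" using ij by linarith
    then show ?thesis
    proof cases
      case 1
      \<comment> \<open>\<open>ju\<close> reverses products and with them the sign of the
        commutator; the minus sign in \<open>FF\<close> restores it.\<close>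
      have "ju (E i * F j - F j * E i) = (if i = j then (1 / (qpow h (d i) - inverse (qpow h (d i)))) *\<^sub>C (k (\<alpha> i) - k (- \<alpha> i)) else 0)"
        using 1 by (simp add: E_F d_def EE qroot_def ju_simps)
      moreover have "inv_elem (KK i) = k (- \<alpha> i)"
        using G_inverse(2)[OF L_\<alpha>[OF 1(1)], of 0] 1 by (simp add: KK_less G_c_0)
      ultimately show ?thesis using 1 by (cases "i = j") (simp_all add: EE KK_less ju_simps)
    next
      case 2 then show ?thesis using juE_fb_top[OF _ E_acts, of i] by (simp add: EE EE_n)
    next
      case 3 then show ?thesis using juF_eb_top[OF _ E_acts, of j] by (simp add: EE EE_n)
    next
      case 4
      have "inv_elem (KK n) = c * B hi hi"
        using G_inverse(2)[OF \<mu>(2), of "- 1"] by (simp add: KK \<gamma>_def y_def adjoin_eq G_top)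
      moreover have "KK n = P hi hi * inv_elem c" by (simp add: KK \<gamma>_def y_def adjoin_eq G_top)
      \<comment> \<open>The constant q_* of the cross relation was taken to be the q-parameter of
        the new root \<mu> + \<nu>.\<close>
      moreover have "qpow h (d n) = qroot h (\<mu> + \<nu>)" by (simp add: d_def EE_n qroot_def)
      ultimately show ?thesis using 4 eb_fb[of hi hi] by (simp add: EE_n)
    qed
  qed

  have coproducts: "\<Delta> (EE i) = in1 (EE i) * in2 (KK i) + in2 (EE i) \<and>
            \<Delta> (FF i) = in1 (FF i) + in1 (inv_elem (KK i)) * in2 (FF i)" if "i < Suc n" for i
  proof (cases "i < n")
    case True
    have "inv_elem (KK i) = k (- \<alpha> i)"
      using G_inverse(2)[OF L_\<alpha>[OF True], of 0] True by (simp add: KK_less G_c_0)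
    then show ?thesis using True
      by (simp add: EE KK_less \<Delta>_E \<Delta>_F alg_hom_simps[OF \<Delta>] alg_hom_simps[OF in_hom(1)]
          alg_hom_simps[OF in_hom(2)])
  next
    case False
    then have "i = n" using that by simp
    then show ?thesis
      using G_inverse(2)[OF \<mu>(2), of "- 1"]
      by (simp add: EE_n KK \<gamma>_def y_def adjoin_eq \<Delta>_e_top \<Delta>_f_top)
  qed

  have torus: "torus_monomial (Suc n) KK z
      = G ((\<Sum>i<n. of_int (z i) *\<^sub>R \<alpha> i) + of_int (z n) *\<^sub>R \<mu>) (- z n)" for z
  proof -
    have "torus_monomial (Suc n) KK z = torus_monomial (Suc n) (\<lambda>i. G (\<gamma> i) (y i)) z"
      by (simp add: torus_monomial_def KK)
    also have "\<dots> = G (\<Sum>i<Suc n. of_int (z i) *\<^sub>R \<gamma> i) (\<Sum>i<Suc n. z i * y i)"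
      by (rule G_torus) (rule \<gamma>)
    finally show ?thesis by (simp add: \<gamma>_def y_def adjoin_def)
  qed
  have torus_independent: "z i = 0" if z: "torus_monomial (Suc n) KK z = 1" and i: "i < Suc n" for z i
  proof -
    have "(\<Sum>i<n. of_int (z i) *\<^sub>R \<alpha> i) + of_int (z n) *\<^sub>R \<mu> \<in> L"
      by (intro L_add L_sum L_scale \<mu>(2) L_\<alpha>) simp
    \<comment> \<open>The exponent of \<open>c\<close> gives \<open>z n = 0\<close>; what remains is
      a linear relation among the simple roots.\<close>
    from G_eq_1[OF E_nonzero this z[unfolded torus]]
    have zn: "z n = 0" and "(\<Sum>i<n. of_int (z i) *\<^sub>R \<alpha> i) = 0" by auto
    then have "i < n \<Longrightarrow> real_of_int (z i) = 0"
      by (intro independent_sum_zero[OF inj_\<alpha> indep_\<alpha>])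
    then show ?thesis using zn i by (cases "i = n") auto
  qed
  have torus_power: "\<exists>N>0. \<exists>z. x ^ N = torus_monomial (Suc n) KK z" if xH: "x \<in> H" for x
  proof -
    obtain \<beta> y where x: "x = G \<beta> y" "\<beta> \<in> L" using xH by (rule H_E)
    obtain b u :: "nat \<Rightarrow> int" where b: "\<beta> = (\<Sum>i<n. (of_int (b i) / real m) *\<^sub>R \<alpha> i)"
      and u: "\<mu> = (\<Sum>i<n. (of_int (u i) / real m) *\<^sub>R \<alpha> i)"
      using x(2) \<mu>(2) unfolding L_def weight_lattice_def by blast
    \<comment> \<open>The m-th power moves \<open>\<beta>\<close> into the root lattice. The factor
      c^(m y) has to come from \<open>KK n\<close> to the power -m y, which brings along K of -m y
      \<mu>; the summands \<open>y * u i\<close> compensate for it.\<close>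
    define z where "z = (\<lambda>i. if i < n then b i + y * u i else - int m * y)"
    have mb: "real m *\<^sub>R \<beta> = (\<Sum>i<n. of_int (b i) *\<^sub>R \<alpha> i)"
      and mu: "real m *\<^sub>R \<mu> = (\<Sum>i<n. of_int (u i) *\<^sub>R \<alpha> i)"
      using m_pos by (simp_all add: b u scaleR_sum_right)
    have "(\<Sum>i<n. of_int (z i) *\<^sub>R \<alpha> i) = real m *\<^sub>R \<beta> + of_int y *\<^sub>R (real m *\<^sub>R \<mu>)"
      unfolding mb mu scaleR_sum_right sum.distrib [symmetric]
      by (rule sum.cong) (auto simp: z_def scaleR_left_distrib)
    then have "torus_monomial (Suc n) KK z = G (real m *\<^sub>R \<beta>) (int m * y)"
      by (simp add: torus z_def mult.commute)
    moreover have "x ^ m = G (real m *\<^sub>R \<beta>) (int m * y)"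
      using G_int_pow[OF x(2), of y "int m"] by (simp add: x int_pow_def)
    ultimately show ?thesis using m_pos by metis
  qed

  have "generated_alg (H \<union> EE ` {..<Suc n} \<union> FF ` {..<Suc n}) = UNIV"
  proof (rule bosonization_generated[OF E_acts])
    let ?G = "H \<union> EE ` {..<Suc n} \<union> FF ` {..<Suc n}"
    have H_gen: "G \<gamma> z \<in> generated_alg ?G" if "\<gamma> \<in> L" for \<gamma> z
      using that by (intro generated_alg.gen) (auto intro: H_I)
    show "k \<gamma> \<in> generated_alg ?G" if "\<gamma> \<in> L" for \<gamma> using H_gen[OF that, of 0] by (simp add: G_c_0)
    show "int_pow c z \<in> generated_alg ?G" for z using H_gen[OF L_0, of z] by (simp add: G_def k_0)
    show "ju (E s) \<in> generated_alg ?G" if "s < n" for s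
      unfolding EE(1)[OF that, symmetric] using that by (intro generated_alg.gen) auto
    have "FF s \<in> generated_alg ?G" if "s < n" for s
      using that by (intro generated_alg.gen) auto
    then show "ju (F s) \<in> generated_alg ?G" if "s < n" for s
      using generated_alg_uminus[of "FF s" ?G] that by (simp add: EE)
    show "eb hi \<in> generated_alg ?G" "fb hi \<in> generated_alg ?G"
      unfolding EE_n(1,2) [symmetric] by (intro generated_alg.gen; simp)+
  qed
  moreover have "1 \<in> H" using H_I[OF L_0, of 0] by (simp add: G_0)
  moreover have "x * y \<in> H \<and> x * y = y * x" if "x \<in> H" "y \<in> H" for x y
    using that by (auto elim!: H_E simp: G_mult add.commute intro!: H_I L_add)
  moreover have "invertible_elem x \<and> inv_elem x \<in> H \<and> grouplike x" if "x \<in> H" for x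
    using that by (auto elim!: H_E simp: G_inverse intro!: H_I L_minus grouplike_G)
  moreover have "KK ` {..<Suc n} \<subseteq> H"
    using \<gamma> by (auto simp: KK intro!: H_I)
  moreover have "EE i \<noteq> 0 \<and> FF i \<noteq> 0" if "i < Suc n" for i
    using that E_nonzero F_nonzero eb_nonzero fb_nonzero ju_nonzero
    by (cases "i = n") (auto simp: EE EE_n)
  ultimately have "quantum_group h (Suc n) a d H EE FF KK in1 in2 \<Delta>"
    unfolding quantum_group_def using torus_independent torus_power EF_K EF coproducts by auto
  then show ?thesis
    using \<nu>_\<mu> \<nu>_\<alpha> unfolding a_def d_def H_def by (simp add: inner_commute)
qed

end
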